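(* Let $N\ge 2$, $N_-=\frac{N(N-1)}{2}$ and $N_+=\frac{N(N+1)}{2}$. Assume that the following statement (a conjecture) is true: for every admissible function $f:[0,1]^{N_-}\times\mathbb{T}^{N_+-1}\to\mathbb{C}$, if $$\int_{[0,1]^{N_-}}\int_{\mathbb{T}^{N_+-1}}f^P\,\tilde{J}_{SU(N)}\,\frac{dz_1}{z_1}\cdots\frac{dz_{N_+-1}}{z_{N_+-1}}\,dx_1\cdots dx_{N_-}=0\qquad\text{for all }P\in\mathbb{N},$$ then $\vec 0$ does not lie in the convex hull of $\mathrm{Sp}(f)$. Then the Mathieu Conjecture is true for $SU(N)$.
   Context: $\mathbb{N}=\{1,2,\dots\}$ and $\mathbb{T}$ is the unit circle in $\mathbb{C}$. Admissible functions: let $k,l$ be non-negative integers. A function $f:[0,1]^k\times\mathbb{T}^l\to\mathbb{C}$ is admissible if it can be written as a finite sum $f(x_1,\dots,x_k,z_1,\dots,z_l)=\sum_{\vec m}c_{\vec m}(x)z^{\vec m}$, where $\vec m\in\mathbb{Z}^l$ and $c_{\vec m}(x)\in\mathbb{C}[x_1,\sqrt{1-x_1^2},\dots,x_k,\sqrt{1-x_k^2}]$ is a complex polynomial in the $x_i$ and $\sqrt{1-x_i^2}$. The spectrum $\mathrm{Sp}(f)\subset\mathbb{Z}^l\subset\mathbb{R}^l$ is the set of $\vec m$ with $c_{\vec m}\neq0$. The weight $\tilde J_{SU(N)}$ is defined recursively by $\tilde J_{SU(1)}\equiv1$ and $$\tilde J_{SU(N)}(x_1,\dots,x_{N_-})=2^{N-1}C_N\left(\prod_{j=1}^{N-1}x_j^{2j-1}\right)\tilde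 J_{SU(N-1)}(x_N,\dots,x_{N_-}),\qquad N_-=\tfrac{N(N-1)}{2},$$ where $C_N>0$ are constants (positive normalization constants, irrelevant to the vanishing of the integrals). A finite-type function on a compact Lie group $G$ is a finite linear combination of matrix coefficients of irreducible (finite-dimensional) representations of $G$. Mathieu Conjecture for a compact connected Lie group $G$ with Haar measure $dg$: if $f,h$ are finite-type functions on $G$ and $\int_G f^P\,dg=0$ for all $P\in\mathbb{N}$, then $\int_G f^P h\,dg=0$ for all sufficiently large $P\in\mathbb{N}$. *)

theory Defs
  imports
    "HOL-Analysis.Analysis"
    "HOL-Analysis.Finite_Function_Topology"
    "Jordan_Normal_Form.VS_Connect"
begin

section \<open>Admissible functions and their spectrum\<close>

text \<open>
  Points of $[0,1]^k$ and $T^l$ are functions on \<^term>\<open>{1..k}\<close> and \<^term>\<open>{1..l}\<close>,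
  extensional (equal to \<^term>\<open>undefined\<close>) outside these index sets, as in the library's
  product measures. A function on $[0,1]^k \times T^l$ is a total function of which only the
  values on \<^term>\<open>cube k\<close> and \<^term>\<open>torus l\<close> matter.
\<close>

definition cube :: "nat \<Rightarrow> (nat \<Rightarrow> real) set" where
  "cube k = {1..k} \<rightarrow>\<^sub>E {0..1}"

definition torus :: "nat \<Rightarrow> (nat \<Rightarrow> complex) set" where
  "torus l = {1..l} \<rightarrow>\<^sub>E sphere 0 1"

text \<open>The function algebra $C[x_1,\sqrt{1-x_1^2},\dots,x_k,\sqrt{1-x_k^2}]$.\<close>

inductive_set coeff_algebra :: "nat \<Rightarrow> ((nat \<Rightarrow> real) \<Rightarrow> complex) set" for k :: nat where
  const: "(\<lambda>x. a) \<in> coeff_algebra k"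
| coord: "i \<in> {1..k} \<Longrightarrow> (\<lambda>x. complex_of_real (x i)) \<in> coeff_algebra k"
| sqrt: "i \<in> {1..k} \<Longrightarrow> (\<lambda>x. complex_of_real (sqrt (1 - (x i)\<^sup>2))) \<in> coeff_algebra k"
| add: "p \<in> coeff_algebra k \<Longrightarrow> q \<in> coeff_algebra k \<Longrightarrow> (\<lambda>x. p x + q x) \<in> coeff_algebra k"
| mult: "p \<in> coeff_algebra k \<Longrightarrow> q \<in> coeff_algebra k \<Longrightarrow> (\<lambda>x. p x * q x) \<in> coeff_algebra k"

text \<open>
  $Z^l$ and $R^l$ are the finitely supported functions on the naturals with support in
  \<^term>\<open>{1..l}\<close>; these form a \<^class>\<open>real_vector\<close>, so that the library's convex hull
  applies to the spectrum although \<open>l\<close> is a term.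
\<close>

definition is_expansion ::
  "nat \<Rightarrow> nat \<Rightarrow> ((nat \<Rightarrow> real) \<Rightarrow> (nat \<Rightarrow> complex) \<Rightarrow> complex)
    \<Rightarrow> (nat \<Rightarrow>\<^sub>0 int) set \<Rightarrow> ((nat \<Rightarrow>\<^sub>0 int) \<Rightarrow> (nat \<Rightarrow> real) \<Rightarrow> complex) \<Rightarrow> bool" where
  "is_expansion k l f M c \<longleftrightarrow>
     finite M \<and>
     (\<forall>m\<in>M. Poly_Mapping.keys m \<subseteq> {1..l} \<and> c m \<in> coeff_algebra k) \<and>
     (\<forall>x\<in>cube k. \<forall>z\<in>torus l.
        f x z = (\<Sum>m\<in>M. c m x * (\<Prod>j=1..l. z j powi Poly_Mapping.lookup m j)))"

definition admissible ::
  "nat \<Rightarrow> nat \<Rightarrow> ((nat \<Rightarrow> real) \<Rightarrow> (nat \<Rightarrow> complex) \<Rightarrow> complex) \<Rightarrow> bool" where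
  "admissible k l f \<longleftrightarrow> (\<exists>M c. is_expansion k l f M c)"

text \<open>
  The coefficients $c_m$ are determined by \<open>f\<close> as functions on the cube (linear independence of
  the monomials $z^m$ on the torus), so the choice of the expansion is immaterial.
\<close>

definition spectrum ::
  "nat \<Rightarrow> nat \<Rightarrow> ((nat \<Rightarrow> real) \<Rightarrow> (nat \<Rightarrow> complex) \<Rightarrow> complex) \<Rightarrow> (nat \<Rightarrow>\<^sub>0 int) set" where
  "spectrum k l f =
     {m. \<exists>M c. is_expansion k l f M c \<and> m \<in> M \<and> (\<exists>x\<in>cube k. c m x \<noteq> 0)}"


section \<open>The conjecture on admissible functions\<close>

text \<open>
  With $N = n + 2$ the factors are $x_1,\dots,x_{n+1}$, and the remaining variables
  $x_N, x_{N+1}, \dots$ are passed on to the weight of $SU(N-1)$.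
  The value at \<open>0\<close> is a dummy.
\<close>

fun J_SU :: "(nat \<Rightarrow> real) \<Rightarrow> nat \<Rightarrow> (nat \<Rightarrow> real) \<Rightarrow> real" where
  "J_SU C 0 x = 1"
| "J_SU C (Suc 0) x = 1"
| "J_SU C (Suc (Suc n)) x =
     2 ^ Suc n * C (Suc (Suc n)) * (\<Prod>j=1..Suc n. x j ^ (2 * j - 1))
       * J_SU C (Suc n) (\<lambda>i. x (i + Suc n))"

definition cube_integral :: "nat \<Rightarrow> ((nat \<Rightarrow> real) \<Rightarrow> complex) \<Rightarrow> complex" where
  "cube_integral k g = (LINT x|(\<Pi>\<^sub>M i\<in>{1..k}. restrict_space lborel {0..1}). g x)"

text \<open>
  The contour integral of $g\,dz_1 \cdots dz_l$ over $T^l$, with each circle parametrized by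
  $z_j = e^{i\theta_j}$ for $0 \le \theta_j \le 2\pi$, hence $dz_j = i e^{i\theta_j}\,d\theta_j$.
\<close>

definition torus_integral :: "nat \<Rightarrow> ((nat \<Rightarrow> complex) \<Rightarrow> complex) \<Rightarrow> complex" where
  "torus_integral l g =
     (LINT \<theta>|(\<Pi>\<^sub>M j\<in>{1..l}. restrict_space lborel {0..2 * pi}).
        g (\<lambda>j\<in>{1..l}. cis (\<theta> j)) * (\<Prod>j=1..l. \<i> * cis (\<theta> j)))"

definition admissible_conjecture_SU :: "(nat \<Rightarrow> real) \<Rightarrow> nat \<Rightarrow> bool" where
  "admissible_conjecture_SU C N \<longleftrightarrow>
     (let k = N * (N - 1) div 2; l = N * (N + 1) div 2 - 1 in
      \<forall>f. admissible k l f \<longrightarrow>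
        (\<forall>P\<ge>1. cube_integral k (\<lambda>x. torus_integral l (\<lambda>z.
            f x z ^ P * complex_of_real (J_SU C N x) * (\<Prod>j=1..l. 1 / z j))) = 0) \<longrightarrow>
        0 \<notin> convex hull (Poly_Mapping.map real_of_int ` spectrum k l f))"


section \<open>The Mathieu conjecture\<close>

definition SU :: "(complex ^ 'n ^ 'n) set" where
  "SU = {A. A ** (\<chi> i j. cnj (A $ j $ i)) = Finite_Cartesian_Product.mat 1
          \<and> Determinants.det A = 1}"

text \<open>
  The following notions are stated for a compact group \<open>G\<close> of complex matrices with the
  topology and the Borel sets of the ambient matrix space. Representations are continuous and
  given by matrices; \<open>d > 0\<close> excludes the zero representation from the irreducible ones.
\<close>

definition matrix_representation ::
  "(complex ^ 'n ^ 'n) set \<Rightarrow> nat \<Rightarrow> (complex ^ 'n ^ 'n \<Rightarrow> complex mat) \<Rightarrow> bool" where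
  "matrix_representation G d \<rho> \<longleftrightarrow>
     (\<forall>g\<in>G. \<rho> g \<in> carrier_mat d d) \<and>
     \<rho> (Finite_Cartesian_Product.mat 1) = 1\<^sub>m d \<and>
     (\<forall>g\<in>G. \<forall>h\<in>G. \<rho> (g ** h) = \<rho> g * \<rho> h) \<and>
     (\<forall>i<d. \<forall>j<d. continuous_on G (\<lambda>g. \<rho> g $$ (i, j)))"

definition irreducible_representation ::
  "(complex ^ 'n ^ 'n) set \<Rightarrow> nat \<Rightarrow> (complex ^ 'n ^ 'n \<Rightarrow> complex mat) \<Rightarrow> bool" where
  "irreducible_representation G d \<rho> \<longleftrightarrow>
     matrix_representation G d \<rho> \<and> 0 < d \<and>
     (\<forall>W. VectorSpace.subspace class_ring W (module_vec TYPE(complex) d) \<longrightarrow>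
        (\<forall>g\<in>G. \<forall>w\<in>W. \<rho> g *\<^sub>v w \<in> W) \<longrightarrow>
        W = {0\<^sub>v d} \<or> W = carrier_vec d)"

definition matrix_coefficient ::
  "(complex ^ 'n ^ 'n) set \<Rightarrow> (complex ^ 'n ^ 'n \<Rightarrow> complex) \<Rightarrow> bool" where
  "matrix_coefficient G \<phi> \<longleftrightarrow>
     (\<exists>d \<rho>. irreducible_representation G d \<rho> \<and>
        (\<exists>v\<in>carrier_vec d. \<exists>w\<in>carrier_vec d. \<forall>g\<in>G. \<phi> g = (\<rho> g *\<^sub>v v) \<bullet>c w))"

definition finite_type ::
  "(complex ^ 'n ^ 'n) set \<Rightarrow> (complex ^ 'n ^ 'n \<Rightarrow> complex) \<Rightarrow> bool" where
  "finite_type G f \<longleftrightarrow>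
     (\<exists>(n::nat) a \<phi>. (\<forall>i<n. matrix_coefficient G (\<phi> i)) \<and>
        (\<forall>g\<in>G. f g = (\<Sum>i<n. a i * \<phi> i g)))"

text \<open>
  The Haar measure, normalized to total mass 1. As \<open>G\<close> is compact and metrizable, a finite
  Borel measure is automatically regular, and a left-invariant one is unique up to scaling and
  also right-invariant.
\<close>

definition haar_measure :: "(complex ^ 'n ^ 'n) set \<Rightarrow> (complex ^ 'n ^ 'n) measure \<Rightarrow> bool" where
  "haar_measure G \<mu> \<longleftrightarrow>
     sets \<mu> = sets (restrict_space borel G) \<and>
     emeasure \<mu> G = 1 \<and>
     (\<forall>g\<in>G. distr \<mu> \<mu> (\<lambda>h. g ** h) = \<mu>)"

definition mathieu_conjecture :: "(complex ^ 'n ^ 'n) set \<Rightarrow> bool" where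
  "mathieu_conjecture G \<longleftrightarrow>
     (\<forall>\<mu> f h. haar_measure G \<mu> \<longrightarrow> finite_type G f \<longrightarrow> finite_type G h \<longrightarrow>
        (\<forall>P\<ge>1. (LINT g|\<mu>. f g ^ P) = 0) \<longrightarrow>
        (\<forall>\<^sub>F P in sequentially. (LINT g|\<mu>. f g ^ P * h g) = 0))"

end

theory Submission
  imports Defs
begin

text \<open>
  $SU(N)$ is parametrized by a product of explicit matrices, one for each step of the chain
  $SU(N) \supset SU(N-1) \supset \dots$, whose columns of interest are points on the spheres
  $S^{2k-1}$ in polar coordinates. The weight makes each of these points uniformly distributed: its
  moments in any direction \<open>a\<close> depend only on the norm of \<open>a\<close>, and by Stone--Weierstrass this
  determines its law. Since the average of a function over the coset $g\,SU(k)$ depends only on one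
  column of \<open>g\<close>, induction on \<open>k\<close> shows that the weighted integral over all parameters
  is invariant, so it is a positive multiple of the Haar integral.

  Convolving a representation with a polynomial bump at the identity shows that its entries are
  polynomials in the entries of the matrix and their conjugates, so that finite-type functions
  pull back to admissible functions. If 0 is not in the convex hull of the spectrum of the pull-back of
  \<open>f\<close>, then for large \<open>P\<close> it is not in the spectrum of the pull-back of $f^P h$,
  and the torus integral of the latter vanishes.
\<close>

text \<open>For the weighted integral only left invariance is proved, as for Haar measure by
  definition. To compare the two, \<open>F\<close> is evaluated at the adjoint of the Euler matrix
  times \<open>g\<close> and integrated over both variables: one order of integration absorbs the
  Euler matrix into \<open>g\<close>, the other absorbs \<open>g\<close> into the Euler matrix. This
  is why functions are pulled back along the adjoint of \<open>euler\<close>.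

  The exponent 2j - 1 in the weight is the Jacobian of the sphere of C^(j+1) as the join of the
  sphere of C^j with a circle. Uniformity is nevertheless obtained from moments and not from a
  change of variables: those of a linear form follow from beta integrals and the binomial theorem.
  The test functions are exponentials of real-linear forms, because a product of such functions is
  another one, while each still involves a single linear form.

  Moments see only the law of one column. The inductive step therefore needs the coset average as a
  continuous function on the sphere; its continuity comes from compactness of the group.\<close>

hide_const (open) Matrix.mat Determinant.det
hide_fact (open) Matrix.vec_eq_iff Matrix.mat_def
no_notation Matrix.vec_index (infixl "$" 100)
no_notation Matrix.scalar_prod (infix "\<bullet>" 70)

subsection \<open>Integration over the parameters\<close>

lemmas lebesgue_integral_cong = Bochner_Integration.integral_cong[OF refl]

abbreviation interval_measure :: "real \<Rightarrow> real measure" where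
  "interval_measure b \<equiv> restrict_space lborel {0..b}"

lemma finite_interval_measure: "finite_measure (interval_measure b)"
  by (rule finite_measureI) (auto simp: space_restrict_space emeasure_restrict_space emeasure_lborel_Icc_eq)

lemma product_sigma_finite_interval: "product_sigma_finite (\<lambda>_. interval_measure b)"
  by (rule product_sigma_finite.intro)
     (rule finite_measure.axioms(1)[OF finite_interval_measure])

lemma finite_measure_PiM_interval:
  assumes "finite I"
  shows "finite_measure (\<Pi>\<^sub>M i\<in>I. interval_measure b)"
proof (rule finite_measureI)
  interpret product_sigma_finite "\<lambda>_. interval_measure b"
    by (rule product_sigma_finite_interval)
  have "emeasure (\<Pi>\<^sub>M i\<in>I. interval_measure b) (space (\<Pi>\<^sub>M i\<in>I. interval_measure b))
      = (\<Prod>i\<in>I. emeasure (interval_measure b) (space (interval_measure b)))"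
    unfolding space_PiM by (rule emeasure_PiM[OF assms]) (rule sets.top)
  also have "\<dots> \<noteq> \<infinity>"
    using finite_measure.emeasure_finite[OF finite_interval_measure]
    by (simp add: ennreal_prod_eq_top power_eq_top_ennreal)
  finally show "emeasure (\<Pi>\<^sub>M i\<in>I. interval_measure b) (space (\<Pi>\<^sub>M i\<in>I. interval_measure b)) \<noteq> \<infinity>" .
qed

lemma finite_measure_pair:
  assumes "finite_measure M" "finite_measure N"
  shows "finite_measure (M \<Otimes>\<^sub>M N)"
  by (rule finite_measureI)
     (use assms in \<open>simp add: space_pair_measure sigma_finite_measure.emeasure_pair_measure_Times
       finite_measure_def finite_measure.emeasure_finite ennreal_mult_eq_top_iff\<close>)

lemma (in finite_measure) integrable_bounded:
  fixes f :: "_ \<Rightarrow> _::{banach, second_countable_topology}"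
  assumes "f \<in> borel_measurable M" "\<And>x. x \<in> space M \<Longrightarrow> norm (f x) \<le> C"
  shows "integrable M f"
  using assms by (intro integrable_const_bound[where B=C]) auto

lemma (in finite_measure) norm_integral_bounded:
  fixes f :: "_ \<Rightarrow> _::{banach, second_countable_topology}"
  assumes "f \<in> borel_measurable M" "\<And>x. x \<in> space M \<Longrightarrow> norm (f x) \<le> C"
  shows "norm (integral\<^sup>L M f) \<le> C * measure M (space M)"
proof -
  have int: "integrable M f" by (rule integrable_bounded[OF assms])
  have "norm (integral\<^sup>L M f) \<le> (LINT x|M. norm (f x))"
    by (rule integral_norm_bound)
  also have "\<dots> \<le> (LINT x|M. C)"
    using int assms(2) by (intro integral_mono) auto
  finally show ?thesis by (simp add: mult.commute)
qed

text \<open>The integrands below are bounded on spaces of finite measure, so measurability and one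
  bound give Fubini in both orders.\<close>

lemma integral_pair_bounded:
  fixes f :: "_ \<Rightarrow> _::{banach, second_countable_topology}"
  assumes "finite_measure M" "finite_measure N"
    and "f \<in> borel_measurable (M \<Otimes>\<^sub>M N)" "\<And>x. x \<in> space (M \<Otimes>\<^sub>M N) \<Longrightarrow> norm (f x) \<le> C"
  shows "integral\<^sup>L (M \<Otimes>\<^sub>M N) f = (LINT x|M. LINT y|N. f (x, y))"
    and "integral\<^sup>L (M \<Otimes>\<^sub>M N) f = (LINT y|N. LINT x|M. f (x, y))"
proof -
  interpret M: finite_measure M by fact
  interpret N: finite_measure N by fact
  interpret pair_sigma_finite M N ..
  have "integrable (M \<Otimes>\<^sub>M N) f"
    by (rule finite_measure.integrable_bounded[OF finite_measure_pair assms(3,4)]) fact+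
  then show "integral\<^sup>L (M \<Otimes>\<^sub>M N) f = (LINT x|M. LINT y|N. f (x, y))"
    and "integral\<^sup>L (M \<Otimes>\<^sub>M N) f = (LINT y|N. LINT x|M. f (x, y))"
    using integral_fst'[of f] integral_snd[of "\<lambda>x y. f (x, y)"] by auto
qed

type_synonym params = "(nat \<Rightarrow> real) \<times> (nat \<Rightarrow> real)"

text \<open>The index sets are arbitrary so that the parameters of a smaller group keep their
  positions in the full list: the recursion then splits the measure along a disjoint union and
  renumbers nothing.\<close>

definition param_measure :: "nat set \<Rightarrow> nat set \<Rightarrow> params measure" where
  "param_measure I J = (\<Pi>\<^sub>M i\<in>I. interval_measure 1) \<Otimes>\<^sub>M (\<Pi>\<^sub>M j\<in>J. interval_measure (2 * pi))"

lemma finite_param_measure: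
  "finite I \<Longrightarrow> finite J \<Longrightarrow> finite_measure (param_measure I J)"
  unfolding param_measure_def by (intro finite_measure_pair finite_measure_PiM_interval)

lemma space_param_measure:
  "space (param_measure I J) = (I \<rightarrow>\<^sub>E {0..1}) \<times> (J \<rightarrow>\<^sub>E {0..2 * pi})"
  by (simp add: param_measure_def space_pair_measure space_PiM space_restrict_space)


lemma measurable_param_coordinates [measurable]:
  "(\<lambda>\<omega>. fst \<omega> i) \<in> borel_measurable (param_measure I J)"
  "(\<lambda>\<omega>. snd \<omega> i) \<in> borel_measurable (param_measure I J)"
proof -
  have *: "(\<lambda>x. x i) \<in> borel_measurable (\<Pi>\<^sub>M i\<in>I. interval_measure b)" for I b
  proof (cases "i \<in> I")
    case True
    have "(\<lambda>x::real. x) \<in> measurable (interval_measure b) borel"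
      by (intro measurable_restrict_space1) simp
    from measurable_compose[OF measurable_component_singleton[OF True] this] show ?thesis .
  next
    \<comment> \<open>Off the index set all points of the space take the value
      \<open>undefined\<close>, so the coordinate is constant there.\<close>
    case False
    then have "(\<lambda>x. x i) \<in> borel_measurable (\<Pi>\<^sub>M i\<in>I. interval_measure b) \<longleftrightarrow>
       (\<lambda>x. undefined::real) \<in> borel_measurable (\<Pi>\<^sub>M i\<in>I. interval_measure b)"
      by (intro measurable_cong) (auto simp: space_PiM PiE_def extensional_def)
    then show ?thesis by simp
  qed
  show "(\<lambda>\<omega>. fst \<omega> i) \<in> borel_measurable (param_measure I J)"
    "(\<lambda>\<omega>. snd \<omega> i) \<in> borel_measurable (param_measure I J)"
    unfolding param_measure_def
    by (rule measurable_compose[OF measurable_fst *] measurable_compose[OF measurable_snd *])+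
qed

text \<open>Radii and phases are folded separately, each as a product over a disjoint union. This
  leaves the primed radii outside the unprimed phases; exchanging these two integrals brings the
  unprimed parameters together.\<close>

lemma integral_param_measure_split:
  fixes f :: "_ \<Rightarrow> _::{banach, second_countable_topology}"
  assumes fin: "finite I" "finite I'" "finite J" "finite J'"
    and disj: "I \<inter> I' = {}" "J \<inter> J' = {}"
    and meas: "f \<in> borel_measurable (param_measure (I \<union> I') (J \<union> J'))"
    and bdd: "\<And>\<omega>. \<omega> \<in> space (param_measure (I \<union> I') (J \<union> J')) \<Longrightarrow> norm (f \<omega>) \<le> C"
  shows "integral\<^sup>L (param_measure (I \<union> I') (J \<union> J')) f =
    (LINT \<omega>|param_measure I J. LINT \<omega>'|param_measure I' J'.
       f (merge I I' (fst \<omega>, fst \<omega>'), merge J J' (snd \<omega>, snd \<omega>')))"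
proof -
  let ?X = "\<lambda>I. \<Pi>\<^sub>M i\<in>I. interval_measure 1"
  let ?T = "\<lambda>J. \<Pi>\<^sub>M j\<in>J. interval_measure (2 * pi)"
  interpret X: product_sigma_finite "\<lambda>_::nat. interval_measure 1" by (rule product_sigma_finite_interval)
  interpret T: product_sigma_finite "\<lambda>_::nat. interval_measure (2 * pi)" by (rule product_sigma_finite_interval)
  have finX: "finite_measure (?X K)" if "finite K" for K by (rule finite_measure_PiM_interval[OF that])
  have finT: "finite_measure (?T K)" if "finite K" for K by (rule finite_measure_PiM_interval[OF that])
  note fm = finX[OF fin(1)] finX[OF fin(2)] finT[OF fin(3)] finT[OF fin(4)]
  have finU: "finite (I \<union> I')" "finite (J \<union> J')" using fin by auto
  have measf[measurable]: "f \<in> borel_measurable (?X (I \<union> I') \<Otimes>\<^sub>M ?T (J \<union> J'))"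
    using meas by (simp add: param_measure_def)
  have bf: "norm (f (x, t)) \<le> C" if "x \<in> space (?X (I \<union> I'))" "t \<in> space (?T (J \<union> J'))" for x t
    using bdd that by (auto simp: param_measure_def space_pair_measure)
  have mX: "merge I I' (a, b) \<in> space (?X (I \<union> I'))" if "a \<in> space (?X I)" "b \<in> space (?X I')" for a b
    using that by (auto simp: space_PiM space_restrict_space merge_def PiE_iff extensional_def)
  have mT: "merge J J' (a, b) \<in> space (?T (J \<union> J'))" if "a \<in> space (?T J)" "b \<in> space (?T J')" for a b
    using that by (auto simp: space_PiM space_restrict_space merge_def PiE_iff extensional_def)
  have comp: "(\<lambda>w. f (merge I I' (a w, b w), merge J J' (c w, d w))) \<in> borel_measurable N"
    if [measurable]: "a \<in> measurable N (?X I)" "b \<in> measurable N (?X I')"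
       "c \<in> measurable N (?T J)" "d \<in> measurable N (?T J')" for a b c d N
  proof -
    have "(\<lambda>w. merge I I' (a w, b w)) \<in> measurable N (?X (I \<union> I'))"
      by (rule measurable_compose[OF _ measurable_merge]) simp
    moreover have "(\<lambda>w. merge J J' (c w, d w)) \<in> measurable N (?T (J \<union> J'))"
      by (rule measurable_compose[OF _ measurable_merge]) simp
    ultimately show ?thesis by (intro measurable_compose[OF _ measf]) simp
  qed
  have sig: "sigma_finite_measure (?T J')" "sigma_finite_measure (?T (J \<union> J'))" "sigma_finite_measure (param_measure I' J')"
    using fm(4) finT[OF finU(2)] finite_param_measure fin by (auto simp: finite_measure_def)
  have "integral\<^sup>L (param_measure (I \<union> I') (J \<union> J')) f
      = (LINT x|?X (I \<union> I'). LINT t|?T (J \<union> J'). f (x, t))"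
    unfolding param_measure_def
    by (rule integral_pair_bounded(1)[OF finX[OF finU(1)] finT[OF finU(2)] measf, of C])
       (auto simp: space_pair_measure bf)
  also have "\<dots> = (LINT x|?X I. LINT x'|?X I'. LINT t|?T (J \<union> J'). f (merge I I' (x, x'), t))"
  proof (rule X.product_integral_fold[OF disj(1) fin(1,2)])
    show "integrable (?X (I \<union> I')) (\<lambda>x. LINT t|?T (J \<union> J'). f (x, t))"
    proof (rule finite_measure.integrable_bounded[OF finX[OF finU(1)]])
      show "(\<lambda>x. LINT t|?T (J \<union> J'). f (x, t)) \<in> borel_measurable (?X (I \<union> I'))"
        by (rule sigma_finite_measure.borel_measurable_lebesgue_integral[OF sig(2)]) simp
      fix x assume x: "x \<in> space (?X (I \<union> I'))"
      show "norm (LINT t|?T (J \<union> J'). f (x, t)) \<le> C * measure (?T (J \<union> J')) (space (?T (J \<union> J')))"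
        using x by (intro finite_measure.norm_integral_bounded[OF finT[OF finU(2)]] bf) simp_all
    qed
  qed
  also have "\<dots> = (LINT x|?X I. LINT x'|?X I'. LINT t|?T J. LINT t'|?T J'.
      f (merge I I' (x, x'), merge J J' (t, t')))"
  proof (intro lebesgue_integral_cong)
    fix x x' assume "x \<in> space (?X I)" "x' \<in> space (?X I')"
    then have x: "merge I I' (x, x') \<in> space (?X (I \<union> I'))" by (rule mX)
    have "integrable (?T (J \<union> J')) (\<lambda>t. f (merge I I' (x, x'), t))"
      using x by (intro finite_measure.integrable_bounded[OF finT[OF finU(2)], where C=C] bf) simp_all
    from T.product_integral_fold[OF disj(2) fin(3,4) this]
    show "(LINT t|?T (J \<union> J'). f (merge I I' (x, x'), t))
      = (LINT t|?T J. LINT t'|?T J'. f (merge I I' (x, x'), merge J J' (t, t')))" .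
  qed
  also have "\<dots> = (LINT x|?X I. LINT t|?T J. LINT x'|?X I'. LINT t'|?T J'.
      f (merge I I' (x, x'), merge J J' (t, t')))"
  proof (intro lebesgue_integral_cong)
    fix x assume x: "x \<in> space (?X I)"
    let ?h = "\<lambda>\<omega>. LINT t'|?T J'. f (merge I I' (x, fst \<omega>), merge J J' (snd \<omega>, t'))"
    have h: "?h \<in> borel_measurable (?X I' \<Otimes>\<^sub>M ?T J)"
      using x by (intro sigma_finite_measure.borel_measurable_lebesgue_integral[OF sig(1)])
        (unfold split_beta', rule comp, simp_all)
    have b: "norm (?h \<omega>) \<le> C * measure (?T J') (space (?T J'))"
      if "\<omega> \<in> space (?X I' \<Otimes>\<^sub>M ?T J)" for \<omega>
    proof (intro finite_measure.norm_integral_bounded[OF fm(4)] bf mX mT x)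
      show "(\<lambda>t'. f (merge I I' (x, fst \<omega>), merge J J' (snd \<omega>, t'))) \<in> borel_measurable (?T J')"
        using that x by (intro comp) (auto simp: space_pair_measure)
    qed (use that in \<open>auto simp: space_pair_measure\<close>)
    show "(LINT x'|?X I'. LINT t|?T J. LINT t'|?T J'. f (merge I I' (x, x'), merge J J' (t, t')))
      = (LINT t|?T J. LINT x'|?X I'. LINT t'|?T J'. f (merge I I' (x, x'), merge J J' (t, t')))"
      using integral_pair_bounded[OF fm(2,3) h b] by simp
  qed
  also have "\<dots> = (LINT x|?X I. LINT t|?T J. LINT \<omega>'|param_measure I' J'.
      f (merge I I' (x, fst \<omega>'), merge J J' (t, snd \<omega>')))"
  proof (intro lebesgue_integral_cong)
    fix x t assume xt: "x \<in> space (?X I)" "t \<in> space (?T J)"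
    let ?h = "\<lambda>\<omega>'. f (merge I I' (x, fst \<omega>'), merge J J' (t, snd \<omega>'))"
    have "?h \<in> borel_measurable (?X I' \<Otimes>\<^sub>M ?T J')" using xt by (intro comp) simp_all
    moreover have "norm (?h \<omega>') \<le> C" if "\<omega>' \<in> space (?X I' \<Otimes>\<^sub>M ?T J')" for \<omega>'
      using that xt by (intro bf mX mT) (auto simp: space_pair_measure)
    ultimately show "(LINT x'|?X I'. LINT t'|?T J'. f (merge I I' (x, x'), merge J J' (t, t')))
       = (LINT \<omega>'|param_measure I' J'. ?h \<omega>')"
      unfolding param_measure_def using integral_pair_bounded(1)[OF fm(2,4), of ?h C] by simp
  qed
  also have "\<dots> = (LINT \<omega>|param_measure I J. LINT \<omega>'|param_measure I' J'.
      f (merge I I' (fst \<omega>, fst \<omega>'), merge J J' (snd \<omega>, snd \<omega>')))"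
  proof -
    let ?h = "\<lambda>\<omega>. LINT \<omega>'|param_measure I' J'. f (merge I I' (fst \<omega>, fst \<omega>'), merge J J' (snd \<omega>, snd \<omega>'))"
    have m: "?h \<in> borel_measurable (?X I \<Otimes>\<^sub>M ?T J)"
      by (intro sigma_finite_measure.borel_measurable_lebesgue_integral[OF sig(3)])
        (unfold split_beta' param_measure_def, rule comp, simp_all)
    have b: "norm (?h \<omega>) \<le> C * measure (param_measure I' J') (space (param_measure I' J'))"
      if "\<omega> \<in> space (?X I \<Otimes>\<^sub>M ?T J)" for \<omega>
    proof (intro finite_measure.norm_integral_bounded[OF finite_param_measure[OF fin(2,4)]] bf mX mT)
      show "(\<lambda>\<omega>'. f (merge I I' (fst \<omega>, fst \<omega>'), merge J J' (snd \<omega>, snd \<omega>')))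
          \<in> borel_measurable (param_measure I' J')"
        unfolding param_measure_def using that by (intro comp) (auto simp: space_pair_measure)
    qed (use that in \<open>auto simp: space_pair_measure param_measure_def\<close>)
    show ?thesis
      unfolding param_measure_def[of I J] using integral_pair_bounded(1)[OF fm(1,3) m b] by simp
  qed
  finally show ?thesis .
qed

lemma integral_param_measure_singleton:
  fixes u v :: "real \<Rightarrow> complex"
  assumes u: "u \<in> borel_measurable (interval_measure 1)" "\<And>x. x \<in> {0..1} \<Longrightarrow> norm (u x) \<le> C"
    and v: "v \<in> borel_measurable (interval_measure (2*pi))" "\<And>x. x \<in> {0..2*pi} \<Longrightarrow> norm (v x) \<le> D"
  shows "(LINT \<omega>|param_measure {i} {j}. u (fst \<omega> i) * v (snd \<omega> j)) =
    integral\<^sup>L (interval_measure 1) u * integral\<^sup>L (interval_measure (2*pi)) v"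
proof -
  interpret X: product_sigma_finite "\<lambda>_::nat. interval_measure 1" by (rule product_sigma_finite_interval)
  interpret T: product_sigma_finite "\<lambda>_::nat. interval_measure (2 * pi)" by (rule product_sigma_finite_interval)
  let ?X = "\<Pi>\<^sub>M i\<in>{i}. interval_measure 1" and ?T = "\<Pi>\<^sub>M i\<in>{j}. interval_measure (2*pi)"
  have m1: "(\<lambda>x. u (x i)) \<in> borel_measurable ?X" 
    by (rule measurable_compose[OF measurable_component_singleton[of i] u(1)]) simp
  have m2: "(\<lambda>x. v (x j)) \<in> borel_measurable ?T" 
    by (rule measurable_compose[OF measurable_component_singleton[of j] v(1)]) simp
  have "(LINT \<omega>|param_measure {i} {j}. u (fst \<omega> i) * v (snd \<omega> j))
     = (LINT x|?X. LINT t|?T. u (x i) * v (t j))"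
    unfolding param_measure_def
  proof (subst integral_pair_bounded(1)[OF finite_measure_PiM_interval finite_measure_PiM_interval, where C="C * D"])
    show "(\<lambda>\<omega>. u (fst \<omega> i) * v (snd \<omega> j)) \<in> borel_measurable (?X \<Otimes>\<^sub>M ?T)"
      using m1 m2 by measurable
    fix \<omega> assume "\<omega> \<in> space (?X \<Otimes>\<^sub>M ?T)"
    then have "fst \<omega> i \<in> {0..1}" "snd \<omega> j \<in> {0..2*pi}"
      by (auto simp: space_pair_measure space_PiM space_restrict_space PiE_iff simp del: atLeastAtMost_iff)
    then show "norm (u (fst \<omega> i) * v (snd \<omega> j)) \<le> C * D"
      using u(2) v(2) norm_ge_zero order_trans by (simp add: norm_mult mult_mono')
  qed auto
  also have "\<dots> = (LINT x|?X. u (x i)) * (LINT t|?T. v (t j))" by simp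
  finally show ?thesis
    using X.product_integral_singleton[OF u(1)] T.product_integral_singleton[OF v(1)] by simp
qed

section \<open>Integrals over a single radius or phase\<close>

lemma measurable_interval_continuous:
  "continuous_on {0..b} f \<Longrightarrow> f \<in> borel_measurable (interval_measure b)"
  using borel_measurable_continuous_on_restrict[of "{0..b}" f]
  by (simp cong: measurable_cong_sets add: sets_restrict_space)

lemma integral_interval_FTC:
  fixes f F :: "real \<Rightarrow> 'a :: euclidean_space"
  assumes "0 \<le> b" "\<And>x. (F has_vector_derivative f x) (at x within {0..b})" "continuous_on {0..b} f"
  shows "integral\<^sup>L (interval_measure b) f = F b - F 0"
  using integral_FTC_atLeastAtMost[OF assms(1), of F f] assms
  by (simp add: integral_restrict_space)

text \<open>Half the beta integral B(p + 1, q + 1), in the variable x^2. Integration by parts trades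
  a factor 1 - x^2 for a factor x^2, so the induction on \<open>q\<close> keeps \<open>p\<close>
  arbitrary.\<close>

lemma integral_beta:
  "(LINT x|interval_measure 1. x ^ (2 * p + 1) * (1 - x\<^sup>2) ^ q) = fact p * fact q / (2 * fact (p + q + 1))"
proof (induction q arbitrary: p)
  case 0
  have "(LINT x|interval_measure 1. x ^ (2 * p + 1)) = 1 ^ (2 * p + 2) / (2 * p + 2) - 0 ^ (2 * p + 2) / (2 * p + 2)"
  proof (rule integral_interval_FTC[where F = "\<lambda>x::real. x ^ (2 * p + 2) / (2 * p + 2)"])
    show "((\<lambda>x. x ^ (2 * p + 2) / (2 * p + 2)) has_vector_derivative x ^ (2 * p + 1)) (at x within {0..1})" for x :: real
      using DERIV_cdivide[OF DERIV_pow[of "2 * p + 2" x "{0..1}"], of "2 * p + 2"]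
      by (simp add: has_real_derivative_iff_has_vector_derivative[symmetric])
  qed (auto intro!: continuous_intros)
  also have "\<dots> = 1 / (2 * (real p + 1))" by (simp add: field_simps)
  also have "\<dots> = fact p * fact 0 / (2 * fact (p + 0 + 1))"
  proof -
    have "real p + 1 \<noteq> 0" by linarith
    then show ?thesis by (simp add: add.commute[of 1])
  qed
  finally show ?case by simp
next
  case (Suc q)
  let ?I = "\<lambda>p q. LINT x|interval_measure 1. x ^ (2 * p + 1) * (1 - x\<^sup>2) ^ q"
  have int: "integrable (interval_measure 1) (\<lambda>x. x ^ (2 * p + 1) * (1 - x\<^sup>2) ^ q)" for p q
  proof (rule finite_measure.integrable_bounded[OF finite_interval_measure, where C=1])
    show "(\<lambda>x. x ^ (2 * p + 1) * (1 - x\<^sup>2) ^ q) \<in> borel_measurable (interval_measure 1)"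
      by (intro measurable_interval_continuous continuous_intros)
    show "norm (x ^ (2 * p + 1) * (1 - x\<^sup>2) ^ q) \<le> 1" if "x \<in> space (interval_measure 1)" for x
      using that by (auto simp: space_restrict_space abs_mult power_le_one abs_square_le_1 
           intro!: mult_le_one)
  qed
  have "(LINT x|interval_measure 1. (2 * p + 2) * (x ^ (2 * p + 1) * (1 - x\<^sup>2) ^ Suc q)
           - 2 * (q + 1) * (x ^ (2 * Suc p + 1) * (1 - x\<^sup>2) ^ q))
     = 1 ^ (2 * p + 2) * (1 - 1\<^sup>2) ^ Suc q - 0 ^ (2 * p + 2) * (1 - 0\<^sup>2) ^ Suc q"
  \<comment> \<open>The antiderivative vanishes at both ends: at 0 by the power of x, at 1 by the
    factor 1 - x^2.\<close>
  proof (rule integral_interval_FTC[where F = "\<lambda>x::real. x ^ (2 * p + 2) * (1 - x\<^sup>2) ^ Suc q"])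
    fix x :: real
    have "((\<lambda>x. x ^ (2 * p + 2)) has_real_derivative real (2 * p + 2) * x ^ (2 * p + 1)) (at x within {0..1})"
      using DERIV_pow[of "2 * p + 2" x "{0..1}"] by simp
    moreover have "((\<lambda>x. (1 - x\<^sup>2) ^ Suc q) has_real_derivative real (Suc q) * (1 - x\<^sup>2) ^ q * (- 2 * x)) (at x within {0..1})"
      by (rule derivative_eq_intros refl | simp)+
    ultimately have "((\<lambda>x. x ^ (2 * p + 2) * (1 - x\<^sup>2) ^ Suc q) has_real_derivative
       real (2 * p + 2) * x ^ (2 * p + 1) * (1 - x\<^sup>2) ^ Suc q
        + real (Suc q) * (1 - x\<^sup>2) ^ q * (- 2 * x) * x ^ (2 * p + 2)) (at x within {0..1})"
      by (rule DERIV_mult)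
    also have "real (2 * p + 2) * x ^ (2 * p + 1) * (1 - x\<^sup>2) ^ Suc q
        + real (Suc q) * (1 - x\<^sup>2) ^ q * (- 2 * x) * x ^ (2 * p + 2)
      = (2 * p + 2) * (x ^ (2 * p + 1) * (1 - x\<^sup>2) ^ Suc q)
           - 2 * (q + 1) * (x ^ (2 * Suc p + 1) * (1 - x\<^sup>2) ^ q)"
      by (simp add: algebra_simps)
    finally show "((\<lambda>x. x ^ (2 * p + 2) * (1 - x\<^sup>2) ^ Suc q) has_vector_derivative
       (2 * p + 2) * (x ^ (2 * p + 1) * (1 - x\<^sup>2) ^ Suc q)
           - 2 * (q + 1) * (x ^ (2 * Suc p + 1) * (1 - x\<^sup>2) ^ q)) (at x within {0..1})"
      by (simp only: has_real_derivative_iff_has_vector_derivative)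
  qed (simp, intro continuous_intros)
  then have "(2 * p + 2) * ?I p (Suc q) - 2 * (q + 1) * ?I (Suc p) q = 0"
    using int[of p "Suc q"] int[of "Suc p" q] by (simp add: integral_diff del: power_Suc)
  then have "?I p (Suc q) = (q + 1) / (p + 1) * ?I (Suc p) q"
    by (simp add: field_simps del: power_Suc)
  also have "\<dots> = (q + 1) / (p + 1) * (fact (Suc p) * fact q / (2 * fact (Suc p + q + 1)))"
    unfolding Suc.IH ..
  also have "\<dots> = fact p * fact (Suc q) / (2 * fact (p + Suc q + 1))"
  proof -
    have "real p + 1 \<noteq> 0" by linarith
    moreover have "fact (Suc p) = (real p + 1) * fact p" "fact (Suc q) = (real q + 1) * fact q"
      "Suc p + q + 1 = p + Suc q + 1"
      by (simp_all add: algebra_simps)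
    ultimately show ?thesis by (simp only: of_nat_add of_nat_1 times_divide_eq_left times_divide_eq_right) simp
  qed
  finally show ?case .
qed

lemma integral_cis_powi:
  "(LINT t|interval_measure (2 * pi). cis t powi n) = (if n = 0 then 2 * pi else 0)"
proof (cases "n = 0")
  case True
  have "measure (interval_measure (2*pi)) {0..2*pi} = 2 * pi"
    by (simp add: measure_restrict_space)
  then show ?thesis using True by (simp add: space_restrict_space scaleR_conv_of_real)
next
  case False
  have eq: "cis t powi n = cis (of_int n * t)" for t by (rule cis_power_int)
  have "(LINT t|interval_measure (2 * pi). cis (of_int n * t))
     = cis (of_int n * (2*pi)) / (\<i> * of_int n) - cis (of_int n * 0) / (\<i> * of_int n)"
  proof (rule integral_interval_FTC[where F = "\<lambda>t. cis (of_int n * t) / (\<i> * of_int n)"])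
    show "((\<lambda>t. cis (of_int n * t) / (\<i> * of_int n)) has_vector_derivative cis (of_int n * x))
          (at x within {0..2 * pi})" for x
    proof -
      have "((\<lambda>z. exp (\<i> * of_int n * z) / (\<i> * of_int n)) has_field_derivative exp (\<i> * of_int n * of_real x)) (at (of_real x))"
        using False by (auto intro!: derivative_eq_intros)
      from has_vector_derivative_real_field[OF this] show ?thesis
        by (simp add: cis_conv_exp mult.assoc)
    qed
  qed (auto intro!: continuous_intros)
  also have "cis (of_int n * (2*pi)) = 1"
    using cis_multiple_2pi[of "of_int n"] by (simp add: mult_ac)
  finally show ?thesis using False by (simp add: eq)
qed

lemma integral_cis_monomial:
  "(LINT t|interval_measure (2 * pi). cis t ^ p * cnj (cis t) ^ q) = (if p = q then 2 * pi else 0)"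
proof -
  have "cis t ^ p * cnj (cis t) ^ q = cis t powi (int p - int q)" for t
    by (simp add: power_int_diff cis_cnj power_inverse divide_inverse flip: cis_inverse)
  then show ?thesis by (simp add: integral_cis_powi)
qed

subsection \<open>Unitary matrices\<close>

definition adjoint_matrix :: "complex ^ 'n ^ 'n \<Rightarrow> complex ^ 'n ^ 'n" where
  "adjoint_matrix A = (\<chi> i j. cnj (A $ j $ i))"

lemma adjoint_matrix_nth [simp]: "adjoint_matrix A $ i $ j = cnj (A $ j $ i)"
  by (simp add: adjoint_matrix_def)

lemma adjoint_matrix_mult:
  "adjoint_matrix (A ** B) = adjoint_matrix B ** adjoint_matrix A"
  by (simp add: vec_eq_iff matrix_matrix_mult_def mult.commute)

lemma adjoint_matrix_adjoint_matrix [simp]: "adjoint_matrix (adjoint_matrix A) = A"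
  by (simp add: vec_eq_iff)

lemma adjoint_matrix_mat_1 [simp]:
  "adjoint_matrix (mat 1) = mat 1"
  by (simp add: vec_eq_iff mat_def)

lemma det_adjoint_matrix: "det (adjoint_matrix A) = cnj (det A)"
proof -
  have "adjoint_matrix A = Finite_Cartesian_Product.transpose (\<chi> i j. cnj (A $ i $ j))"
    by (simp add: vec_eq_iff Finite_Cartesian_Product.transpose_def)
  then have "det (adjoint_matrix A) = det (\<chi> i j. cnj (A $ i $ j))"
    by (simp only: Determinants.det_transpose)
  also have "\<dots> = cnj (det A)"
    by (simp add: Determinants.det_def)
  finally show ?thesis .
qed

definition unitary :: "(complex ^ 'n ^ 'n) set" where
  "unitary = {A. A ** adjoint_matrix A = mat 1}"

lemma unitary_mult_adjoint: "A \<in> unitary \<Longrightarrow> A ** adjoint_matrix A = mat 1"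
  by (simp add: unitary_def)

lemma unitary_adjoint_mult: "A \<in> unitary \<Longrightarrow> adjoint_matrix A ** A = mat 1"
  by (simp add: unitary_def matrix_left_right_inverse)

lemma unitary_adjoint: "A \<in> unitary \<Longrightarrow> adjoint_matrix A \<in> unitary"
  using unitary_adjoint_mult by (simp add: unitary_def)

lemma mat_1_unitary: "mat 1 \<in> unitary"
  by (simp add: unitary_def)

lemma unitary_mult: "A \<in> unitary \<Longrightarrow> B \<in> unitary \<Longrightarrow> A ** B \<in> unitary"
  unfolding unitary_def mem_Collect_eq adjoint_matrix_mult
  by (metis matrix_mul_assoc matrix_mul_rid)

lemma SU_eq: "SU = {A \<in> unitary. det A = 1}"
  by (auto simp: SU_def unitary_def adjoint_matrix_def)

lemma SU_unitary: "A \<in> SU \<Longrightarrow> A \<in> unitary"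
  by (simp add: SU_eq)

lemma SU_mult: "A \<in> SU \<Longrightarrow> B \<in> SU \<Longrightarrow> A ** B \<in> SU"
  by (simp add: SU_eq unitary_mult Determinants.det_mul)

lemma SU_adjoint: "A \<in> SU \<Longrightarrow> adjoint_matrix A \<in> SU"
  by (simp add: SU_eq unitary_adjoint det_adjoint_matrix)

lemma mat_1_SU: "mat 1 \<in> SU"
  by (simp add: SU_eq mat_1_unitary)

lemma norm_det_unitary:
  assumes "A \<in> unitary" shows "det A * cnj (det A) = 1"
  using arg_cong[OF unitary_mult_adjoint[OF assms], of det]
  by (simp add: Determinants.det_mul det_adjoint_matrix)

text \<open>The inner product of the matrix space is the real part of the Hilbert-Schmidt product.
  Multiplication by a unitary matrix is therefore an isometry, on which the bump functions rely
  later.\<close>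

lemma inner_matrix_eq_trace:
  fixes A B :: "complex ^ 'n ^ 'n"
  shows "A \<bullet> B = Re (trace (A ** adjoint_matrix B))"
  by (simp add: inner_vec_def Determinants.trace_def matrix_matrix_mult_def inner_complex_def)

lemma inner_unitary_mult:
  fixes A B :: "complex ^ 'n ^ 'n"
  assumes "U \<in> unitary" shows "(U ** A) \<bullet> (U ** B) = A \<bullet> B"
proof -
  have "(U ** A) \<bullet> (U ** B) = Re (trace (U ** (A ** adjoint_matrix B ** adjoint_matrix U)))"
    by (simp add: inner_matrix_eq_trace adjoint_matrix_mult matrix_mul_assoc)
  also have "\<dots> = Re (trace (A ** adjoint_matrix B ** (adjoint_matrix U ** U)))"
    by (subst Determinants.trace_mul_sym) (simp add: matrix_mul_assoc)
  finally show ?thesis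
    by (simp add: unitary_adjoint_mult[OF assms] inner_matrix_eq_trace)
qed

lemma norm_unitary_mult: "(U :: complex ^ 'n ^ 'n) \<in> unitary \<Longrightarrow> norm (U ** (A :: complex ^ 'n ^ 'n)) = norm A"
  by (simp add: norm_eq_sqrt_inner inner_unitary_mult)

lemma dist_unitary_mult:
  fixes A B :: "complex ^ 'n ^ 'n"
  assumes "U \<in> unitary" shows "dist (U ** A) (U ** B) = dist A B"
proof -
  have "U ** A - U ** B = U ** (A - B)"
    by (simp add: vec_eq_iff matrix_matrix_mult_def sum_subtractf algebra_simps)
  then show ?thesis by (simp add: dist_norm norm_unitary_mult[OF assms])
qed

lemma norm_mat_1_complex: "norm (mat 1 :: complex ^ 'n ^ 'n) = sqrt (real CARD('n))"
  by (simp add: norm_eq_sqrt_inner inner_matrix_eq_trace Determinants.trace_def) (simp add: mat_def)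

lemma norm_unitary:
  assumes "(U :: complex ^ 'n ^ 'n) \<in> unitary" shows "norm U = sqrt (real CARD('n))"
  using norm_unitary_mult[OF assms, of "mat 1"] norm_mat_1_complex by simp

lemma norm_unitary_vector_mult:
  fixes v :: "complex ^ 'n"
  assumes "U \<in> unitary" shows "norm (U *v v) = norm v"
proof -
  have eq: "(norm w)\<^sup>2 = Re (\<Sum>i\<in>UNIV. w $ i * cnj (w $ i))" for w :: "complex ^ 'n"
    by (simp add: power2_norm_eq_inner inner_vec_def inner_complex_def)
  have "(\<Sum>i\<in>UNIV. (U *v v) $ i * cnj ((U *v v) $ i))
     = (\<Sum>i\<in>UNIV. \<Sum>j\<in>UNIV. \<Sum>k\<in>UNIV. U $ i $ j * v $ j * (cnj (U $ i $ k) * cnj (v $ k)))"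
    by (simp add: matrix_vector_mult_def sum_product)
  also have "\<dots> = (\<Sum>j\<in>UNIV. \<Sum>k\<in>UNIV. \<Sum>i\<in>UNIV. U $ i $ j * v $ j * (cnj (U $ i $ k) * cnj (v $ k)))"
    by (subst sum.swap) (intro sum.cong refl sum.swap)
  also have "\<dots> = (\<Sum>j\<in>UNIV. \<Sum>k\<in>UNIV. v $ j * cnj (v $ k) * (adjoint_matrix U ** U) $ k $ j)"
    by (simp add: matrix_matrix_mult_def sum_distrib_left algebra_simps)
  also have "\<dots> = (\<Sum>j\<in>UNIV. v $ j * cnj (v $ j))"
    by (simp add: unitary_adjoint_mult[OF assms] mat_def if_distrib cong: if_cong)
  finally have "(norm (U *v v))\<^sup>2 = (norm v)\<^sup>2" by (simp only: eq)
  then show ?thesis by simp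
qed

lemma continuous_on_matrix_mult [continuous_intros]:
  fixes f g :: "'a::topological_space \<Rightarrow> complex ^ 'n ^ 'n"
  assumes "continuous_on S f" "continuous_on S g"
  shows "continuous_on S (\<lambda>x. f x ** g x)"
  unfolding matrix_matrix_mult_def
  by (intro continuous_on_vec_lambda continuous_on_sum continuous_on_mult continuous_on_component assms)

lemma continuous_on_adjoint_matrix [continuous_intros]:
  "continuous_on S f \<Longrightarrow> continuous_on S (\<lambda>x. adjoint_matrix (f x))"
  unfolding adjoint_matrix_def
  by (intro continuous_on_vec_lambda continuous_on_cnj continuous_on_component)

lemma continuous_on_det_complex [continuous_intros]:
  fixes f :: "'a::topological_space \<Rightarrow> complex ^ 'n ^ 'n"
  shows "continuous_on S f \<Longrightarrow> continuous_on S (\<lambda>x. det (f x))"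
  unfolding Determinants.det_def
  by (intro continuous_on_sum continuous_on_mult continuous_on_prod continuous_on_const continuous_on_component)

lemma continuous_on_matrix_vector_mult' [continuous_intros]:
  fixes f :: "'a::topological_space \<Rightarrow> complex ^ 'n ^ 'n"
  assumes "continuous_on S f" "continuous_on S g"
  shows "continuous_on S (\<lambda>x. f x *v g x)"
  unfolding matrix_vector_mult_def
  by (intro continuous_on_vec_lambda continuous_on_sum continuous_on_mult continuous_on_component assms)

lemma compact_SU: "compact (SU :: (complex ^ 'n ^ 'n) set)"
proof (rule compact_eq_bounded_closed[THEN iffD2], intro conjI)
  show "bounded (SU :: (complex ^ 'n ^ 'n) set)"
    by (rule boundedI[of _ "sqrt (real CARD('n))"]) (simp add: norm_unitary SU_unitary)
  have "SU = {A :: complex ^ 'n ^ 'n. A ** adjoint_matrix A = mat 1} \<inter> {A. det A = 1}"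
    by (auto simp: SU_eq unitary_def)
  also have "closed \<dots>"
    by (intro closed_Int closed_Collect_eq continuous_intros)
  finally show "closed (SU :: (complex ^ 'n ^ 'n) set)" .
qed

section \<open>Measurability and polynomials in the matrix entries\<close>

lemma borel_measurable_matrixI:
  fixes A :: "'a \<Rightarrow> complex ^ 'n ^ 'm"
  assumes "\<And>i j. (\<lambda>w. A w $ i $ j) \<in> borel_measurable M"
  shows "A \<in> borel_measurable M"
proof (subst borel_measurable_euclidean_space, safe)
  fix b :: "complex ^ 'n ^ 'm" assume "b \<in> Basis"
  then obtain i j c where b: "b = axis i (axis j c)"
    by (auto simp: Basis_vec_def)
  have "(\<lambda>w. A w \<bullet> b) = (\<lambda>w. A w $ i $ j \<bullet> c)"
    by (simp add: b inner_axis)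
  then show "(\<lambda>w. A w \<bullet> b) \<in> borel_measurable M"
    using assms[of i j] by simp
qed

text \<open>Measurability of the parametrization and admissibility of polynomials in its entries are both
  instances of closure under the operations of a *-algebra.\<close>

definition star_algebra :: "(('a \<Rightarrow> complex) \<Rightarrow> bool) \<Rightarrow> bool" where
  "star_algebra P \<longleftrightarrow> (\<forall>c. P (\<lambda>_. c)) \<and> (\<forall>f g. P f \<longrightarrow> P g \<longrightarrow> P (\<lambda>w. f w + g w)) \<and>
     (\<forall>f g. P f \<longrightarrow> P g \<longrightarrow> P (\<lambda>w. f w * g w)) \<and> (\<forall>f. P f \<longrightarrow> P (\<lambda>w. cnj (f w)))"

context
  fixes P :: "('a \<Rightarrow> complex) \<Rightarrow> bool"
  assumes P: "star_algebra P"
begin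

lemma star_algebra_const: "P (\<lambda>_. c)"
  and star_algebra_add: "P f \<Longrightarrow> P g \<Longrightarrow> P (\<lambda>w. f w + g w)"
  and star_algebra_mult: "P f \<Longrightarrow> P g \<Longrightarrow> P (\<lambda>w. f w * g w)"
  and star_algebra_cnj: "P f \<Longrightarrow> P (\<lambda>w. cnj (f w))"
  using P by (auto simp: star_algebra_def)

lemma star_algebra_sum: "(\<And>i. i \<in> I \<Longrightarrow> P (f i)) \<Longrightarrow> P (\<lambda>w. \<Sum>i\<in>I. f i w)"
  by (induction I rule: infinite_finite_induct) (simp_all add: star_algebra_const star_algebra_add)

lemma star_algebra_prod: "(\<And>i. i \<in> I \<Longrightarrow> P (f i)) \<Longrightarrow> P (\<lambda>w. \<Prod>i\<in>I. f i w)"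
  by (induction I rule: infinite_finite_induct) (simp_all add: star_algebra_const star_algebra_mult)

lemma star_algebra_matrix_mult:
  fixes A B :: "'a \<Rightarrow> complex ^ 'n ^ 'n"
  assumes "\<And>i j. P (\<lambda>w. A w $ i $ j)" "\<And>i j. P (\<lambda>w. B w $ i $ j)"
  shows "P (\<lambda>w. (A w ** B w) $ i $ j)"
  unfolding matrix_matrix_mult_def using assms
  by (simp add: star_algebra_sum star_algebra_mult)

lemma star_algebra_det:
  fixes A :: "'a \<Rightarrow> complex ^ 'n ^ 'n"
  assumes "\<And>i j. P (\<lambda>w. A w $ i $ j)"
  shows "P (\<lambda>w. det (A w))"
  unfolding Determinants.det_def
  by (intro star_algebra_sum star_algebra_mult star_algebra_const star_algebra_prod assms)

end

lemma star_algebra_borel_measurable: "star_algebra (\<lambda>f. f \<in> borel_measurable M)"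
proof -
  have "(\<lambda>w. cnj (f w)) \<in> borel_measurable M" if "f \<in> borel_measurable M" for f :: "'a \<Rightarrow> complex"
    by (rule measurable_compose[OF that]) (intro borel_measurable_continuous_onI continuous_intros)
  then show ?thesis by (auto simp: star_algebra_def)
qed

text \<open>With the conjugates among the generators these are the polynomials in the real and
  imaginary parts of the entries. They live on the whole matrix space, which makes them continuous
  everywhere.\<close>

inductive_set entry_poly :: "(complex ^ 'n ^ 'n \<Rightarrow> complex) set" where
  const: "(\<lambda>A. c) \<in> entry_poly"
| entry: "(\<lambda>A. A $ i $ j) \<in> entry_poly"
| cnj_entry: "(\<lambda>A. cnj (A $ i $ j)) \<in> entry_poly"
| add: "p \<in> entry_poly \<Longrightarrow> q \<in> entry_poly \<Longrightarrow> (\<lambda>A. p A + q A) \<in> entry_poly"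
| mult: "p \<in> entry_poly \<Longrightarrow> q \<in> entry_poly \<Longrightarrow> (\<lambda>A. p A * q A) \<in> entry_poly"

lemma star_algebra_entry_poly:
  assumes "star_algebra P" "p \<in> entry_poly" "\<And>i j. P (\<lambda>w. A w $ i $ j)"
  shows "P (\<lambda>w. p (A w))"
  using assms(2)
  by induction (auto intro: star_algebra_const[OF assms(1)] star_algebra_add[OF assms(1)]
      star_algebra_mult[OF assms(1)] star_algebra_cnj[OF assms(1)] assms(3))

lemma continuous_on_entry_poly: "p \<in> entry_poly \<Longrightarrow> continuous_on S p"
  by (induction rule: entry_poly.induct)
     (auto intro!: continuous_intros continuous_on_component)

lemma entry_poly_power: "p \<in> entry_poly \<Longrightarrow> (\<lambda>A. p A ^ n) \<in> entry_poly"
  by (induction n) (auto intro: entry_poly.intros)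

lemma entry_poly_sum:
  "(\<And>i. i \<in> I \<Longrightarrow> f i \<in> entry_poly) \<Longrightarrow> (\<lambda>A. \<Sum>i\<in>I. f i A) \<in> entry_poly"
  by (induction I rule: infinite_finite_induct) (auto intro: entry_poly.intros)

lemma matrix_vector_mult_axis_nth: "(A *v axis k c) $ i = A $ i $ k * (c :: complex)"
  by (simp add: matrix_vector_mult_def axis_def if_distrib cong: if_cong)

section \<open>Elementary unitary factors\<close>

definition plane_matrix ::
  "'n \<Rightarrow> 'n \<Rightarrow> complex \<Rightarrow> complex \<Rightarrow> complex \<Rightarrow> complex \<Rightarrow> complex ^ 'n ^ 'n" where
  "plane_matrix a b p q r s = (\<chi> i j.
     if i = a then (if j = a then p else if j = b then q else 0)
     else if i = b then (if j = a then r else if j = b then s else 0)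
     else if i = j then 1 else 0)"

lemma plane_matrix_unitary:
  assumes "a \<noteq> b" "p * cnj p + q * cnj q = 1" "r * cnj r + s * cnj s = 1" "p * cnj r + q * cnj s = 0"
  shows "plane_matrix a b p q r s \<in> unitary"
proof -
  have 4: "r * cnj p + s * cnj q = 0"
    using arg_cong[OF assms(4), of cnj] by (simp add: mult.commute)
  have *: "(\<Sum>l\<in>UNIV. plane_matrix a b p q r s $ i $ l * cnj (plane_matrix a b p q r s $ j $ l))
       = (if i = j then 1 else 0)" for i j
  proof (cases "i = a \<or> i = b")
    case True
    then have "(\<Sum>l\<in>UNIV. plane_matrix a b p q r s $ i $ l * cnj (plane_matrix a b p q r s $ j $ l))
      = (\<Sum>l\<in>{a,b}. plane_matrix a b p q r s $ i $ l * cnj (plane_matrix a b p q r s $ j $ l))"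
      by (intro sum.mono_neutral_right) (auto simp: plane_matrix_def)
    then show ?thesis using True assms 4 by (auto simp: plane_matrix_def)
  next
    case False
    then have "(\<Sum>l\<in>UNIV. plane_matrix a b p q r s $ i $ l * cnj (plane_matrix a b p q r s $ j $ l))
      = (\<Sum>l\<in>{i}. plane_matrix a b p q r s $ i $ l * cnj (plane_matrix a b p q r s $ j $ l))"
      by (intro sum.mono_neutral_right) (auto simp: plane_matrix_def)
    then show ?thesis using False assms by (auto simp: plane_matrix_def)
  qed
  show ?thesis
    by (simp add: unitary_def vec_eq_iff matrix_matrix_mult_def mat_def *)
qed

lemma plane_matrix_axis:
  assumes "a \<noteq> b"
  shows "plane_matrix a b p q r s *v axis a 1 = axis a p + axis b r"
    and "plane_matrix a b p q r s *v axis b 1 = axis a q + axis b s"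
    and "c \<noteq> a \<Longrightarrow> c \<noteq> b \<Longrightarrow> plane_matrix a b p q r s *v axis c 1 = axis c 1"
proof -
  have nth: "plane_matrix a b p q r s $ i $ j =
     (if i = a then (if j = a then p else if j = b then q else 0)
      else if i = b then (if j = a then r else if j = b then s else 0)
      else if i = j then 1 else 0)" for i j
    by (simp add: plane_matrix_def)
  show "plane_matrix a b p q r s *v axis a 1 = axis a p + axis b r"
    and "plane_matrix a b p q r s *v axis b 1 = axis a q + axis b s"
    using assms unfolding vec_eq_iff matrix_vector_mult_axis_nth nth
    by (simp_all add: axis_def)
  show "plane_matrix a b p q r s *v axis c 1 = axis c 1" if "c \<noteq> a" "c \<noteq> b"
    using assms that unfolding vec_eq_iff matrix_vector_mult_axis_nth nth
    by (simp add: axis_def)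
qed

definition scale_matrix :: "'n \<Rightarrow> complex \<Rightarrow> complex ^ 'n ^ 'n" where
  "scale_matrix a c = (\<chi> i j. if i = j then (if i = a then c else 1) else 0)"

lemma scale_matrix_unitary:
  assumes "c * cnj c = 1" shows "scale_matrix a c \<in> unitary"
proof -
  have "(\<Sum>l\<in>UNIV. scale_matrix a c $ i $ l * cnj (scale_matrix a c $ j $ l)) = (if i = j then 1 else 0)" for i j
  proof -
    have "(\<Sum>l\<in>UNIV. scale_matrix a c $ i $ l * cnj (scale_matrix a c $ j $ l))
      = (\<Sum>l\<in>{i}. scale_matrix a c $ i $ l * cnj (scale_matrix a c $ j $ l))"
      by (intro sum.mono_neutral_right) (auto simp: scale_matrix_def)
    then show ?thesis using assms by (auto simp: scale_matrix_def)
  qed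
  then show ?thesis
    by (simp add: unitary_def vec_eq_iff matrix_matrix_mult_def mat_def)
qed

lemma scale_matrix_axis:
  "scale_matrix a c *v axis a 1 = axis a c"
  "b \<noteq> a \<Longrightarrow> scale_matrix a c *v axis b 1 = axis b 1"
  unfolding vec_eq_iff matrix_vector_mult_axis_nth
  by (simp_all add: scale_matrix_def axis_def)

lemma det_scale_matrix: "det (scale_matrix a c) = c"
  by (subst Determinants.det_diagonal) (auto simp: scale_matrix_def prod.If_cases)

subsection \<open>Euler coordinates\<close>

text \<open>The numbers of radial and of phase parameters of $SU(k + 1)$.\<close>

primrec num_radial :: "nat \<Rightarrow> nat" where
  "num_radial 0 = 0"
| "num_radial (Suc k) = Suc k + num_radial k"

primrec num_phase :: "nat \<Rightarrow> nat" where
  "num_phase 0 = 0"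
| "num_phase (Suc k) = Suc (Suc k) + num_phase k"

text \<open>With N = k + 1 this is N(N - 1)/2, and \<open>num_phase k\<close> is N(N + 1)/2 - 1: the
  dimensions in the conjecture. The recursive definitions follow the recursion of the
  parametrization instead.\<close>

lemma num_radial_eq: "num_radial k = Suc k * k div 2"
proof -
  have "2 * num_radial k = Suc k * k" by (induction k) (simp_all add: algebra_simps)
  then show ?thesis by (metis nonzero_mult_div_cancel_left zero_neq_numeral)
qed

lemma num_phase_eq: "num_phase k = Suc k * (Suc k + 1) div 2 - 1"
proof -
  have "2 * (num_phase k + 1) = Suc k * (Suc k + 1)" by (induction k) (simp_all add: algebra_simps)
  then have "num_phase k + 1 = Suc k * (Suc k + 1) div 2" by (metis nonzero_mult_div_cancel_left zero_neq_numeral)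
  then show ?thesis by (metis diff_add_inverse2)
qed

text \<open>The index type of the matrices is an unordered finite type; the numbering
  \<open>e\<close> gives a meaning to the first \<open>k\<close> coordinates.\<close>

locale coordinate_enumeration =
  fixes e :: "nat \<Rightarrow> 'n::finite"
  assumes bij_e: "bij_betw e {1..CARD('n)} UNIV"
begin

lemma e_eq_iff: "i \<in> {1..CARD('n)} \<Longrightarrow> j \<in> {1..CARD('n)} \<Longrightarrow> e i = e j \<longleftrightarrow> i = j"
  by (rule inj_on_eq_iff[OF bij_betw_imp_inj_on[OF bij_e]])

lemma e_neq: "1 \<le> i \<Longrightarrow> 1 \<le> j \<Longrightarrow> i \<le> CARD('n) \<Longrightarrow> j \<le> CARD('n) \<Longrightarrow> i \<noteq> j \<Longrightarrow> e i \<noteq> e j"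
  by (subst e_eq_iff) simp_all

text \<open>The copy of $SU(k)$ acting on the first \<open>k\<close> coordinates.\<close>

definition SU_sub :: "nat \<Rightarrow> (complex ^ 'n ^ 'n) set" where
  "SU_sub k = {A \<in> SU. \<forall>j\<in>{k<..CARD('n)}. A *v axis (e j) 1 = axis (e j) 1}"

lemma SU_sub_SU: "A \<in> SU_sub k \<Longrightarrow> A \<in> SU"
  by (simp add: SU_sub_def)

lemma SU_sub_unitary: "A \<in> SU_sub k \<Longrightarrow> A \<in> unitary"
  by (simp add: SU_sub_def SU_unitary)

lemma SU_sub_CARD: "SU_sub CARD('n) = SU"
  by (simp add: SU_sub_def)

lemma SU_sub_mono: "k \<le> l \<Longrightarrow> SU_sub k \<subseteq> SU_sub l"
  by (auto simp: SU_sub_def)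

lemma mat_1_SU_sub: "mat 1 \<in> SU_sub k"
  by (simp add: SU_sub_def mat_1_SU)

lemma SU_sub_mult: "A \<in> SU_sub k \<Longrightarrow> B \<in> SU_sub k \<Longrightarrow> A ** B \<in> SU_sub k"
  by (simp add: SU_sub_def SU_mult flip: matrix_vector_mul_assoc)

lemma SU_sub_adjoint:
  assumes "A \<in> SU_sub k" shows "adjoint_matrix A \<in> SU_sub k"
proof -
  have "adjoint_matrix A *v axis (e j) 1 = axis (e j) 1" if "j \<in> {k<..CARD('n)}" for j
  proof -
    have "adjoint_matrix A *v axis (e j) 1 = adjoint_matrix A *v (A *v axis (e j) 1)"
      using assms that by (simp add: SU_sub_def)
    also have "\<dots> = axis (e j) 1"
      using unitary_adjoint_mult[OF SU_sub_unitary[OF assms]] by (simp add: matrix_vector_mul_assoc)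
    finally show ?thesis .
  qed
  then show ?thesis using assms by (simp add: SU_sub_def SU_adjoint)
qed

text \<open>The coset description: two elements of the larger group with the same last column differ
  by an element of the smaller one.\<close>

lemma SU_sub_stabilizer:
  assumes "1 \<le> k" "A \<in> SU_sub (Suc k)" "A *v axis (e (Suc k)) 1 = axis (e (Suc k)) 1"
  shows "A \<in> SU_sub k"
proof -
  have "A *v axis (e j) 1 = axis (e j) 1" if "k < j" "j \<le> CARD('n)" for j
    using assms that by (cases "j = Suc k") (auto simp: SU_sub_def)
  then show ?thesis using assms by (auto simp: SU_sub_def)
qed

text \<open>All columns but one are standard, and the adjoint gives the same for the rows. The
  matrix is thus diagonal with at most one entry different from 1, and the determinant settles that
  entry.\<close>

lemma SU_sub_1:
  assumes "A \<in> SU_sub 1" shows "A = mat 1"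
proof -
  have surj: "\<exists>m\<in>{1..CARD('n)}. j = e m" for j
    using bij_e unfolding bij_betw_def by (metis UNIV_I imageE)
  have col: "A *v axis j 1 = axis j 1" if "j \<noteq> e 1" for j
  proof -
    obtain m where m: "m \<in> {1..CARD('n)}" "j = e m" using surj by blast
    then have "m \<noteq> 1" using that by auto
    then show ?thesis using assms m by (auto simp: SU_sub_def)
  qed
  have "adjoint_matrix A \<in> SU_sub 1" using assms by (rule SU_sub_adjoint)
  then have col': "adjoint_matrix A *v axis j 1 = axis j 1" if "j \<noteq> e 1" for j
  proof -
    obtain m where m: "m \<in> {1..CARD('n)}" "j = e m" using surj by blast
    then have "m \<noteq> 1" using that by auto
    then show ?thesis using \<open>adjoint_matrix A \<in> SU_sub 1\<close> m by (auto simp: SU_sub_def)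
  qed
  have c: "A $ i $ j = (if i = j then 1 else 0)" if "j \<noteq> e 1" for i j
    using arg_cong[OF col[OF that], of "\<lambda>v. v $ i"] 
    unfolding matrix_vector_mult_axis_nth by (simp add: axis_def)
  have r: "A $ i $ j = (if i = j then 1 else 0)" if "i \<noteq> e 1" for i j
    using arg_cong[OF col'[OF that], of "\<lambda>v. cnj (v $ j)"]
    unfolding matrix_vector_mult_axis_nth by (auto simp: axis_def)
  have "1 = det A" using assms by (simp add: SU_sub_def SU_eq)
  also have "\<dots> = (\<Prod>i\<in>UNIV. A $ i $ i)"
  proof (rule Determinants.det_diagonal)
    fix i j :: 'n assume "i \<noteq> j"
    then show "A $ i $ j = 0" using c[of j i] r[of i j] by (cases "i = e 1") auto
  qed
  also have "\<dots> = A $ e 1 $ e 1"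
    using c by (subst prod.remove[of _ "e 1"]) (auto intro!: prod.neutral)
  finally have "A $ e 1 $ e 1 = 1" by simp
  then have "A $ i $ j = (if i = j then 1 else 0)" for i j
    using c[of j i] r[of i j] by (cases "j = e 1"; cases "i = e 1") simp_all
  then show ?thesis
    by (simp add: vec_eq_iff mat_def)
qed

lemma compact_SU_sub: "compact (SU_sub k)"
proof -
  have "SU_sub k = SU \<inter> (\<Inter>j\<in>{k<..CARD('n)}. {A. A *v axis (e j) 1 = axis (e j) 1})"
    by (auto simp: SU_sub_def)
  also have "compact \<dots>"
    by (intro compact_Int_closed compact_SU closed_INT closed_Collect_eq continuous_intros ballI)
  finally show ?thesis .
qed

text \<open>Each factor is unitary and maps $e_{k+2}$ to
  $x_{k+1} e_{k+1} + z_{k+2} \sqrt{1 - x_{k+1}^2}\, e_{k+2}$, so that the image of $e_{k+1}$ under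
  \<open>frame k\<close> is the point of the sphere with polar coordinates \<open>x\<close>, \<open>z\<close>.\<close>

primrec frame :: "nat \<Rightarrow> (nat \<Rightarrow> real) \<Rightarrow> (nat \<Rightarrow> complex) \<Rightarrow> complex ^ 'n ^ 'n" where
  "frame 0 x z = scale_matrix (e 1) (z 1)"
| "frame (Suc k) x z = frame k x z ** plane_matrix (e (Suc k)) (e (Suc (Suc k)))
     (complex_of_real (sqrt (1 - (x (Suc k))\<^sup>2))) (complex_of_real (x (Suc k)))
     (- z (Suc (Suc k)) * complex_of_real (x (Suc k)))
     (z (Suc (Suc k)) * complex_of_real (sqrt (1 - (x (Suc k))\<^sup>2)))"

text \<open>Each step is the join of the previous sphere with a circle: the radius weighs the old
  point and sqrt(1 - x^2) the new phase.\<close>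

primrec sphere_point :: "nat \<Rightarrow> (nat \<Rightarrow> real) \<Rightarrow> (nat \<Rightarrow> complex) \<Rightarrow> complex ^ 'n" where
  "sphere_point 0 x z = axis (e 1) (z 1)"
| "sphere_point (Suc k) x z = complex_of_real (x (Suc k)) *s sphere_point k x z
     + axis (e (Suc (Suc k))) (z (Suc (Suc k)) * complex_of_real (sqrt (1 - (x (Suc k))\<^sup>2)))"

lemma matrix_vector_mult_axis: "(A :: complex ^ 'n ^ 'n) *v axis i c = c *s (A *v axis i 1)"
proof -
  have "axis i c = c *s axis i 1" by (simp add: vec_eq_iff axis_def)
  then show ?thesis by (simp add: vector_scalar_commute)
qed

lemma frame_fixes:
  assumes "Suc k < j" "j \<le> CARD('n)"
  shows "frame k x z *v axis (e j) 1 = axis (e j) 1"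
  using assms
proof (induction k)
  case 0
  have "e j \<noteq> e 1" using 0 by (intro e_neq) auto
  then show ?case by (simp add: scale_matrix_axis)
next
  case (Suc k)
  have "e j \<noteq> e (Suc k)" "e j \<noteq> e (Suc (Suc k))" "e (Suc k) \<noteq> e (Suc (Suc k))"
    using Suc.prems by (intro e_neq; simp)+
  then show ?case using Suc by (simp add: plane_matrix_axis flip: matrix_vector_mul_assoc)
qed

lemma frame_column:
  assumes "Suc k \<le> CARD('n)"
  shows "frame k x z *v axis (e (Suc k)) 1 = sphere_point k x z"
  using assms
proof (induction k)
  case 0
  show ?case by (simp add: scale_matrix_axis)
next
  case (Suc k)
  have ne: "e (Suc k) \<noteq> e (Suc (Suc k))"
    using Suc.prems by (intro e_neq) auto
  have "frame k x z *v axis (e (Suc (Suc k))) c = axis (e (Suc (Suc k))) c" for c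
  proof -
    have "axis (e (Suc (Suc k))) c = c *s axis (e (Suc (Suc k))) (1::complex)"
      by (simp add: vec_eq_iff axis_def)
    then show ?thesis using Suc.prems by (subst matrix_vector_mult_axis) (simp add: frame_fixes)
  qed
  moreover have "frame k x z *v axis (e (Suc k)) c = c *s sphere_point k x z" for c
    using Suc by (subst matrix_vector_mult_axis) simp
  ultimately show ?case
    by (simp add: plane_matrix_axis(2)[OF ne] matrix_vector_right_distrib flip: matrix_vector_mul_assoc)
qed

lemma frame_unitary:
  assumes "Suc k \<le> CARD('n)" "\<forall>i\<in>{1..k}. x i \<in> {0..1}" "\<forall>j\<in>{1..Suc k}. norm (z j) = 1"
  shows "frame k x z \<in> unitary"
  using assms
proof (induction k)
  case 0
  then show ?case by (simp add: scale_matrix_unitary complex_norm_square[symmetric])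
next
  case (Suc k)
  have IH: "frame k x z \<in> unitary" using Suc by simp
  have ne: "e (Suc k) \<noteq> e (Suc (Suc k))"
    using Suc.prems by (intro e_neq) auto
  define u s w where "u = complex_of_real (x (Suc k))" and "s = complex_of_real (sqrt (1 - (x (Suc k))\<^sup>2))"
    and "w = z (Suc (Suc k))"
  have x: "0 \<le> x (Suc k)" "x (Suc k) \<le> 1" using Suc.prems by auto
  then have "1 - (x (Suc k))\<^sup>2 \<ge> 0" by (simp add: abs_square_le_1)
  then have su: "s * s + u * u = 1"
    unfolding s_def u_def of_real_mult[symmetric] of_real_add[symmetric]
    by (simp add: power2_eq_square)
  have w: "w * cnj w = 1" using Suc.prems by (simp add: w_def complex_norm_square[symmetric])
  have cnj: "cnj u = u" "cnj s = s" by (simp_all add: u_def s_def)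
  have "plane_matrix (e (Suc k)) (e (Suc (Suc k))) s u (- w * u) (w * s) \<in> unitary"
  proof (rule plane_matrix_unitary[OF ne])
    have "(- w * u) * cnj (- w * u) + (w * s) * cnj (w * s) = (w * cnj w) * (s * s + u * u)"
      by (simp add: cnj algebra_simps)
    then show "(- w * u) * cnj (- w * u) + (w * s) * cnj (w * s) = 1" using su w by simp
  qed (use su in \<open>simp_all add: cnj algebra_simps\<close>)
  then show ?case using IH unfolding u_def s_def w_def by (simp add: unitary_mult)
qed

text \<open>Rescaling the first column makes the determinant 1 and does not affect the column of
  interest, which is another one for \<open>k > 0\<close>.\<close>

definition special_frame :: "nat \<Rightarrow> (nat \<Rightarrow> real) \<Rightarrow> (nat \<Rightarrow> complex) \<Rightarrow> complex ^ 'n ^ 'n" where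
  "special_frame k x z = frame k x z ** scale_matrix (e 1) (cnj (det (frame k x z)))"

lemma special_frame_column:
  assumes "0 < k" "Suc k \<le> CARD('n)"
  shows "special_frame k x z *v axis (e (Suc k)) 1 = sphere_point k x z"
proof -
  have "e (Suc k) \<noteq> e 1" using assms by (intro e_neq) auto
  then show ?thesis
    using assms by (simp add: special_frame_def scale_matrix_axis frame_column flip: matrix_vector_mul_assoc)
qed

lemma special_frame_SU_sub:
  assumes "Suc k \<le> CARD('n)" "\<forall>i\<in>{1..k}. x i \<in> {0..1}" "\<forall>j\<in>{1..Suc k}. norm (z j) = 1"
  shows "special_frame k x z \<in> SU_sub (Suc k)"
proof -
  have U: "frame k x z \<in> unitary" by (rule frame_unitary[OF assms])
  have "scale_matrix (e 1) (cnj (det (frame k x z))) \<in> unitary"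
    using norm_det_unitary[OF U] by (intro scale_matrix_unitary) (simp add: mult.commute)
  then have "special_frame k x z \<in> SU"
    using U norm_det_unitary[OF U]
    by (simp add: SU_eq special_frame_def unitary_mult Determinants.det_mul det_scale_matrix)
  moreover have "special_frame k x z *v axis (e j) 1 = axis (e j) 1" if "Suc k < j" "j \<le> CARD('n)" for j
  proof -
    have "e j \<noteq> e 1" using that by (intro e_neq) auto
    then show ?thesis
      using that by (simp add: special_frame_def scale_matrix_axis frame_fixes flip: matrix_vector_mul_assoc)
  qed
  ultimately show ?thesis by (auto simp: SU_sub_def)
qed

text \<open>Indices are shifted by one: \<open>euler k\<close> takes values in the copy of $SU(k + 1)$, and the
  weight that goes with it is \<^term>\<open>J_SU C (Suc k)\<close>.\<close>

primrec euler :: "nat \<Rightarrow> (nat \<Rightarrow> real) \<Rightarrow> (nat \<Rightarrow> complex) \<Rightarrow> complex ^ 'n ^ 'n" where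
  "euler 0 x z = mat 1"
| "euler (Suc k) x z = special_frame (Suc k) x z **
     euler k (\<lambda>i. x (i + Suc k)) (\<lambda>j. z (j + Suc (Suc k)))"

lemma euler_SU_sub:
  assumes "Suc k \<le> CARD('n)" "\<forall>i\<in>{1..num_radial k}. x i \<in> {0..1}"
    "\<forall>j\<in>{1..num_phase k}. norm (z j) = 1"
  shows "euler k x z \<in> SU_sub (Suc k)"
  using assms
proof (induction k arbitrary: x z)
  case 0
  then show ?case by (simp add: mat_1_SU_sub)
next
  case (Suc k)
  have "special_frame (Suc k) x z \<in> SU_sub (Suc (Suc k))"
    using Suc.prems by (intro special_frame_SU_sub) auto
  moreover have "euler k (\<lambda>i. x (i + Suc k)) (\<lambda>j. z (j + Suc (Suc k))) \<in> SU_sub (Suc k)"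
    using Suc.prems by (intro Suc.IH) auto
  ultimately show ?case
    using SU_sub_mono[of "Suc k" "Suc (Suc k)"] by (auto intro: SU_sub_mult)
qed

section \<open>Dependence on the parameters\<close>

lemma frame_cong:
  assumes "\<forall>i\<in>{1..k}. x i = x' i" "\<forall>j\<in>{1..Suc k}. z j = z' j"
  shows "frame k x z = frame k x' z'"
  using assms by (induction k) auto

lemma special_frame_cong:
  assumes "\<forall>i\<in>{1..k}. x i = x' i" "\<forall>j\<in>{1..Suc k}. z j = z' j"
  shows "special_frame k x z = special_frame k x' z'"
  unfolding special_frame_def frame_cong[OF assms] ..

lemma sphere_point_cong:
  assumes "\<forall>i\<in>{1..k}. x i = x' i" "\<forall>j\<in>{1..Suc k}. z j = z' j"
  shows "sphere_point k x z = sphere_point k x' z'"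
  using assms by (induction k) auto

text \<open>Parameter lists are total functions. Merging two lists, or restricting one to its index
  set, changes values outside the range in use, and this must not affect the matrix.\<close>

lemma euler_cong:
  assumes "\<forall>i\<in>{1..num_radial k}. x i = x' i" "\<forall>j\<in>{1..num_phase k}. z j = z' j"
  shows "euler k x z = euler k x' z'"
  using assms
proof (induction k arbitrary: x x' z z')
  case (Suc k)
  have "special_frame (Suc k) x z = special_frame (Suc k) x' z'"
    using Suc.prems by (intro special_frame_cong) auto
  moreover have "euler k (\<lambda>i. x (i + Suc k)) (\<lambda>j. z (j + Suc (Suc k)))
    = euler k (\<lambda>i. x' (i + Suc k)) (\<lambda>j. z' (j + Suc (Suc k)))"
    using Suc.prems by (intro Suc.IH) auto
  ultimately show ?case by simp
qed simp

lemma star_algebra_frame: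
  assumes P: "star_algebra P"
    and "\<forall>i\<in>{1..k}. P (\<lambda>w. complex_of_real (x w i)) \<and> P (\<lambda>w. complex_of_real (sqrt (1 - (x w i)\<^sup>2)))"
    and "\<forall>j\<in>{1..Suc k}. P (\<lambda>w. z w j)"
  shows "P (\<lambda>w. frame k (x w) (z w) $ i $ j)"
  using assms(2,3)
proof (induction k arbitrary: i j)
  case 0
  moreover have "P (\<lambda>_. 0)" "P (\<lambda>_. 1)" by (rule star_algebra_const[OF P])+
  ultimately show ?case
    by (cases "i = j"; cases "i = e 1") (simp_all add: scale_matrix_def)
next
  case (Suc k)
  have IH: "P (\<lambda>w. frame k (x w) (z w) $ i $ j)" for i j using Suc by simp
  have "P (\<lambda>w. plane_matrix a b (complex_of_real (sqrt (1 - (x w (Suc k))\<^sup>2))) (complex_of_real (x w (Suc k)))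
     (- z w (Suc (Suc k)) * complex_of_real (x w (Suc k)))
     (z w (Suc (Suc k)) * complex_of_real (sqrt (1 - (x w (Suc k))\<^sup>2))) $ i $ j)" for a b i j
  proof -
    have z: "P (\<lambda>w. z w (Suc (Suc k)))" and x: "P (\<lambda>w. complex_of_real (x w (Suc k)))"
      and s: "P (\<lambda>w. complex_of_real (sqrt (1 - (x w (Suc k))\<^sup>2)))"
      using Suc.prems by simp_all
    have "P (\<lambda>w. - z w (Suc (Suc k)) * complex_of_real (x w (Suc k)))"
      using star_algebra_mult[OF P, OF star_algebra_const[OF P, of "-1"] star_algebra_mult[OF P, OF z x]] by simp
    moreover note x s star_algebra_mult[OF P, OF z s]
    moreover have "P (\<lambda>_. 0)" "P (\<lambda>_. 1)" by (rule star_algebra_const[OF P])+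
    ultimately show ?thesis
      by (cases "i = a"; cases "i = b"; cases "j = a"; cases "j = b"; cases "i = j")
         (simp_all add: plane_matrix_def)
  qed
  with IH show ?case unfolding frame.simps by (rule star_algebra_matrix_mult[OF P])
qed

text \<open>The correcting factor is the conjugate of the determinant, which equals its reciprocal
  for a unitary matrix but stays within the star-algebra.\<close>

lemma star_algebra_special_frame:
  assumes P: "star_algebra P"
    and "\<forall>i\<in>{1..k}. P (\<lambda>w. complex_of_real (x w i)) \<and> P (\<lambda>w. complex_of_real (sqrt (1 - (x w i)\<^sup>2)))"
    and "\<forall>j\<in>{1..Suc k}. P (\<lambda>w. z w j)"
  shows "P (\<lambda>w. special_frame k (x w) (z w) $ i $ j)"
proof -
  have *: "P (\<lambda>w. frame k (x w) (z w) $ i $ j)" for i j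
    by (rule star_algebra_frame[OF assms])
  have "P (\<lambda>w. cnj (det (frame k (x w) (z w))))"
    by (intro star_algebra_cnj[OF P] star_algebra_det[OF P] *)
  then have "P (\<lambda>w. scale_matrix a (cnj (det (frame k (x w) (z w)))) $ i $ j)" for a i j
    using star_algebra_const[OF P, of 0] star_algebra_const[OF P, of 1]
    by (cases "i = j"; cases "i = a") (simp_all add: scale_matrix_def)
  with * show ?thesis
    unfolding special_frame_def by (intro star_algebra_matrix_mult[OF P])
qed

lemma star_algebra_euler:
  assumes P: "star_algebra P"
    and "\<forall>i\<in>{1..num_radial k}. P (\<lambda>w. complex_of_real (x w i)) \<and> P (\<lambda>w. complex_of_real (sqrt (1 - (x w i)\<^sup>2)))"
    and "\<forall>j\<in>{1..num_phase k}. P (\<lambda>w. z w j)"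
  shows "P (\<lambda>w. euler k (x w) (z w) $ i $ j)"
  using assms(2,3)
proof (induction k arbitrary: x z i j)
  case 0
  show ?case unfolding euler.simps by (rule star_algebra_const[OF P])
next
  case (Suc k)
  have "P (\<lambda>w. special_frame (Suc k) (x w) (z w) $ i $ j)" for i j
    using Suc.prems by (intro star_algebra_special_frame[OF P]) auto
  moreover have "P (\<lambda>w. euler k (\<lambda>i. x w (i + Suc k)) (\<lambda>j. z w (j + Suc (Suc k))) $ i $ j)" for i j
    using Suc.prems by (intro Suc.IH) auto
  ultimately show ?case unfolding euler.simps by (rule star_algebra_matrix_mult[OF P])
qed

end

subsection \<open>Uniform distribution on spheres\<close>

lemma borel_measurable_vecI:
  fixes v :: "'a \<Rightarrow> complex ^ 'n"
  assumes "\<And>i. (\<lambda>w. v w $ i) \<in> borel_measurable M"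
  shows "v \<in> borel_measurable M"
proof (subst borel_measurable_euclidean_space, safe)
  fix b :: "complex ^ 'n" assume "b \<in> Basis"
  then obtain i c where b: "b = axis i c"
    by (auto simp: Basis_vec_def)
  have "(\<lambda>w. v w \<bullet> b) = (\<lambda>w. v w $ i \<bullet> c)"
    by (simp add: b inner_axis)
  then show "(\<lambda>w. v w \<bullet> b) \<in> borel_measurable M"
    using assms[of i] by simp
qed

lemma borel_measurable_cis [measurable]: "f \<in> borel_measurable M \<Longrightarrow> (\<lambda>w. cis (f w)) \<in> borel_measurable M"
  by (rule measurable_compose[of f M borel]) (auto intro!: borel_measurable_continuous_onI continuous_intros)

text \<open>Bilinear and not Hermitian: moving a matrix to the other side costs a transpose and no
  conjugation.\<close>

definition pairing :: "complex ^ 'n \<Rightarrow> complex ^ 'n \<Rightarrow> complex" where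
  "pairing a v = (\<Sum>i\<in>UNIV. a $ i * v $ i)"

lemma pairing_add: "pairing a (v + w) = pairing a v + pairing a w"
  by (simp add: pairing_def algebra_simps sum.distrib)

lemma pairing_add_left: "pairing (a + b) v = pairing a v + pairing b v"
  by (simp add: pairing_def algebra_simps sum.distrib)

lemma pairing_scale: "pairing a (c *s v) = c * pairing a v"
  by (simp add: pairing_def sum_distrib_left mult_ac)

lemma pairing_axis: "pairing a (axis i c) = a $ i * c"
  by (simp add: pairing_def axis_def if_distrib cong: if_cong)

lemma pairing_matrix:
  "pairing a (A *v v) = pairing (Finite_Cartesian_Product.transpose A *v a) v"
  unfolding pairing_def matrix_vector_mult_def Finite_Cartesian_Product.transpose_def
  by (simp add: sum_distrib_left sum_distrib_right mult_ac) (rule sum.swap)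

lemma continuous_on_pairing [continuous_intros]:
  "continuous_on S f \<Longrightarrow> continuous_on S (\<lambda>x. pairing a (f x))"
  unfolding pairing_def by (intro continuous_intros)

lemma unitary_transpose:
  assumes "U \<in> unitary" shows "Finite_Cartesian_Product.transpose U \<in> unitary"
proof -
  have "(\<Sum>l\<in>UNIV. U $ l $ i * cnj (U $ l $ j)) = (if i = j then 1 else 0)" for i j
  proof -
    have "(\<Sum>l\<in>UNIV. U $ l $ i * cnj (U $ l $ j)) = (adjoint_matrix U ** U) $ j $ i"
      by (simp add: matrix_matrix_mult_def mult.commute)
    then show ?thesis
      by (simp add: unitary_adjoint_mult[OF assms] mat_def)
  qed
  then show ?thesis
    by (simp add: unitary_def vec_eq_iff matrix_matrix_mult_def
        Finite_Cartesian_Product.transpose_def mat_def)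
qed

text \<open>Closed under products since exponents add, containing the constants through
  \<open>a = 0\<close>, and separating points: an algebra fit for Stone-Weierstrass. Each generator
  depends on one linear form only, so that the moments of linear forms determine its
  integral.\<close>

inductive_set exp_span :: "(complex ^ 'n \<Rightarrow> real) set" where
  exp: "(\<lambda>v. c * exp (Re (pairing a v))) \<in> exp_span"
| add: "f \<in> exp_span \<Longrightarrow> g \<in> exp_span \<Longrightarrow> (\<lambda>v. f v + g v) \<in> exp_span"

lemma exp_span_mult:
  assumes "f \<in> exp_span" "g \<in> exp_span"
  shows "(\<lambda>v. f v * g v) \<in> exp_span"
  using assms(1)
proof induction
  case (exp c a)
  show ?case
    using assms(2)
  proof induction
    case (exp d b)
    have "(\<lambda>v. c * exp (Re (pairing a v)) * (d * exp (Re (pairing b v))))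
       = (\<lambda>v. (c * d) * exp (Re (pairing (a + b) v)))"
      by (simp add: pairing_add_left exp_add mult_ac)
    then show ?case using exp_span.exp[of "c * d" "a + b"] by simp
  next
    case (add f g)
    then show ?case using exp_span.add by (simp add: distrib_left)
  qed
next
  case (add f g)
  then show ?case using exp_span.add by (simp add: distrib_right)
qed

lemma continuous_on_exp_span: "f \<in> exp_span \<Longrightarrow> continuous_on S f"
  by (induction rule: exp_span.induct) (auto intro!: continuous_intros)

lemma exp_span_separates:
  assumes "v \<noteq> w"
  shows "\<exists>f\<in>exp_span. f v \<noteq> f w"
proof -
  \<comment> \<open>The conjugate of the difference, so that pairing it with \<open>v - w\<close>
    gives the squared norm, which is positive.\<close>
  define a where "a = (\<chi> i. cnj (v $ i - w $ i))"
  have "Re (pairing a v) - Re (pairing a w) = (\<Sum>i\<in>UNIV. (norm (v $ i - w $ i))\<^sup>2)"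
  proof -
    have "pairing a v - pairing a w = (\<Sum>i\<in>UNIV. cnj (v $ i - w $ i) * (v $ i - w $ i))"
      by (simp add: pairing_def a_def sum_subtractf[symmetric] algebra_simps)
    also have "\<dots> = (\<Sum>i\<in>UNIV. complex_of_real ((norm (v $ i - w $ i))\<^sup>2))"
      by (intro sum.cong refl) (metis complex_norm_square mult.commute of_real_power)
    finally have "pairing a v - pairing a w = complex_of_real (\<Sum>i\<in>UNIV. (norm (v $ i - w $ i))\<^sup>2)"
      by simp
    from arg_cong[OF this, of Re] show ?thesis by simp
  qed
  also have "\<dots> > 0"
  proof -
    obtain i where "v $ i \<noteq> w $ i" using assms by (auto simp: vec_eq_iff)
    then show ?thesis by (intro sum_pos2[of _ i]) auto
  qed
  finally have "exp (Re (pairing a v)) \<noteq> exp (Re (pairing a w))" by simp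
  then show ?thesis using exp_span.exp[of 1 a] by force
qed

lemma exp_span_dense:
  fixes H :: "complex ^ 'n \<Rightarrow> real"
  assumes "compact S" "continuous_on S H" "0 < \<epsilon>"
  shows "\<exists>g\<in>exp_span. \<forall>v\<in>S. \<bar>H v - g v\<bar> < \<epsilon>"
proof -
  interpret function_ring_on exp_span S
  proof
    show "(\<lambda>_. c) \<in> exp_span" for c
      using exp_span.exp[of c 0] by (simp add: pairing_def)
  qed (use assms(1) continuous_on_exp_span exp_span_mult exp_span_separates in \<open>auto intro: exp_span.add\<close>)
  show ?thesis by (rule Stone_Weierstrass_basic[OF assms(2,3)])
qed

section \<open>Moments of the sphere in polar coordinates\<close>

context coordinate_enumeration
begin

definition sphere_weight :: "nat \<Rightarrow> (nat \<Rightarrow> real) \<Rightarrow> real" where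
  "sphere_weight k x = (\<Prod>j=1..k. x j ^ (2 * j - 1))"

text \<open>The offsets \<open>o'\<close> and \<open>p\<close> are the places where the radii and
  phases of this sphere start in the full list. There is one phase more than there are radii, since
  the first coordinate already carries a phase.\<close>

abbreviation sphere_params :: "nat \<Rightarrow> nat \<Rightarrow> nat \<Rightarrow> params measure" where
  "sphere_params k o' p \<equiv> param_measure {o' + 1..o' + k} {p + 1..p + Suc k}"

abbreviation radii :: "nat \<Rightarrow> params \<Rightarrow> nat \<Rightarrow> real" where
  "radii o' \<omega> \<equiv> \<lambda>i. fst \<omega> (i + o')"

abbreviation phases :: "nat \<Rightarrow> params \<Rightarrow> nat \<Rightarrow> complex" where
  "phases p \<omega> \<equiv> \<lambda>j. cis (snd \<omega> (j + p))"

abbreviation point_at :: "nat \<Rightarrow> nat \<Rightarrow> nat \<Rightarrow> params \<Rightarrow> complex ^ 'n" where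
  "point_at k o' p \<omega> \<equiv> sphere_point k (radii o' \<omega>) (phases p \<omega>)"

abbreviation weight_at :: "nat \<Rightarrow> nat \<Rightarrow> params \<Rightarrow> real" where
  "weight_at k o' \<omega> \<equiv> sphere_weight k (radii o' \<omega>)"

definition sphere_integral :: "nat \<Rightarrow> nat \<Rightarrow> nat \<Rightarrow> (complex ^ 'n \<Rightarrow> 'b::{banach, second_countable_topology}) \<Rightarrow> 'b" where
  "sphere_integral k o' p f = (LINT \<omega>|sphere_params k o' p.
     weight_at k o' \<omega> *\<^sub>R f (point_at k o' p \<omega>))"

lemma radii_mem:
  "\<omega> \<in> space (param_measure {o' + 1..o' + k} J) \<Longrightarrow> i \<in> {1..k} \<Longrightarrow> radii o' \<omega> i \<in> {0..1}"
  by (auto simp: space_param_measure PiE_iff simp del: atLeastAtMost_iff) auto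

lemma sphere_weight_bounds:
  assumes "\<And>i. i \<in> {1..k} \<Longrightarrow> x i \<in> {0..1}"
  shows "0 \<le> sphere_weight k x" "sphere_weight k x \<le> 1"
proof -
  have x: "0 \<le> x i" "x i \<le> 1" if "i \<in> {1..k}" for i using assms[OF that] by auto
  show "0 \<le> sphere_weight k x" unfolding sphere_weight_def
    using x by (intro prod_nonneg) simp
  show "sphere_weight k x \<le> 1" unfolding sphere_weight_def
    using x by (intro prod_le_1) (simp add: power_le_one)
qed

lemma measurable_radii [measurable]:
  "(\<lambda>\<omega>. radii o' \<omega> i) \<in> borel_measurable (param_measure I J)"
  by simp

lemma measurable_phases [measurable]:
  "(\<lambda>\<omega>. phases p \<omega> i) \<in> borel_measurable (param_measure I J)"
  by measurable

lemma measurable_sphere_weight [measurable]: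
  "(\<lambda>\<omega>. weight_at k o' \<omega>) \<in> borel_measurable (param_measure I J)"
  unfolding sphere_weight_def by measurable

lemma measurable_radii_phases:
  "\<forall>i\<in>I'. (\<lambda>\<omega>. complex_of_real (radii o' \<omega> i)) \<in> borel_measurable (param_measure I J) \<and>
     (\<lambda>\<omega>. complex_of_real (sqrt (1 - (radii o' \<omega> i)\<^sup>2))) \<in> borel_measurable (param_measure I J)"
  "\<forall>j\<in>J'. (\<lambda>\<omega>. phases p \<omega> j) \<in> borel_measurable (param_measure I J)"
  by (auto intro!: borel_measurable_of_real)

lemma measurable_sphere_point:
  assumes "Suc k \<le> CARD('n)"
  shows "(\<lambda>\<omega>. point_at k o' p \<omega>) \<in> borel_measurable (param_measure I J)"
proof (rule borel_measurable_vecI)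
  fix i
  have "(\<lambda>\<omega>. frame k (radii o' \<omega>) (phases p \<omega>) $ i $ e (Suc k)) \<in> borel_measurable (param_measure I J)"
    by (rule star_algebra_frame[OF star_algebra_borel_measurable measurable_radii_phases])
  then show "(\<lambda>\<omega>. point_at k o' p \<omega> $ i) \<in> borel_measurable (param_measure I J)"
    unfolding frame_column[OF assms, symmetric] matrix_vector_mult_axis_nth by simp
qed

lemma norm_sphere_point:
  assumes "Suc k \<le> CARD('n)" "\<forall>i\<in>{1..k}. x i \<in> {0..1}" "\<forall>j\<in>{1..Suc k}. norm (z j) = 1"
  shows "norm (sphere_point k x z) = 1"
  unfolding frame_column[OF assms(1), symmetric] norm_unitary_vector_mult[OF frame_unitary[OF assms]]
  by (simp add: norm_axis_1)

lemma bounded_sphere_integrand: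
  fixes f :: "complex ^ 'n \<Rightarrow> 'b::{banach, second_countable_topology}"
  assumes "Suc k \<le> CARD('n)" "continuous_on UNIV f"
  obtains C where "\<And>\<omega>. \<omega> \<in> space (sphere_params k o' p) \<Longrightarrow>
    norm (weight_at k o' \<omega> *\<^sub>R f (point_at k o' p \<omega>)) \<le> C"
proof -
  have "compact (f ` cball 0 1)"
    by (intro compact_continuous_image continuous_on_subset[OF assms(2)]) auto
  then obtain C where "\<forall>y\<in>f ` cball 0 1. norm y \<le> C"
    using compact_imp_bounded bounded_iff by blast
  then have C: "norm (f v) \<le> C" if "v \<in> cball 0 1" for v
    using that by blast
  have "norm (weight_at k o' \<omega> *\<^sub>R f (point_at k o' p \<omega>)) \<le> C"
    if w: "\<omega> \<in> space (sphere_params k o' p)" for \<omega>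
  proof -
    have x: "\<forall>i\<in>{1..k}. radii o' \<omega> i \<in> {0..1}" using radii_mem[OF w] by blast
    have v: "norm (f (point_at k o' p \<omega>)) \<le> C"
      using x by (intro C) (simp add: norm_sphere_point[OF assms(1)])
    have "0 \<le> weight_at k o' \<omega>" "weight_at k o' \<omega> \<le> 1"
      using sphere_weight_bounds[of k "radii o' \<omega>"] x by blast+
    then have "norm (weight_at k o' \<omega> *\<^sub>R f (point_at k o' p \<omega>))
      \<le> 1 * norm (f (point_at k o' p \<omega>))"
      by (simp add: mult_left_le_one_le)
    with v show ?thesis by simp
  qed
  then show ?thesis by (rule that)
qed

lemma measurable_sphere_integrand:
  fixes f :: "complex ^ 'n \<Rightarrow> 'b::{banach, second_countable_topology}"
  assumes "Suc k \<le> CARD('n)" "continuous_on UNIV f"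
  shows "(\<lambda>\<omega>. weight_at k o' \<omega> *\<^sub>R f (point_at k o' p \<omega>))
    \<in> borel_measurable (param_measure I J)"
  by (intro borel_measurable_scaleR measurable_sphere_weight
      measurable_compose[OF measurable_sphere_point[OF assms(1)] borel_measurable_continuous_onI[OF assms(2)]])

lemma integrable_sphere_integrand:
  fixes f :: "complex ^ 'n \<Rightarrow> 'b::{banach, second_countable_topology}"
  assumes "Suc k \<le> CARD('n)" "continuous_on UNIV f"
  shows "integrable (sphere_params k o' p)
    (\<lambda>\<omega>. weight_at k o' \<omega> *\<^sub>R f (point_at k o' p \<omega>))"
proof -
  obtain C where "\<And>\<omega>. \<omega> \<in> space (sphere_params k o' p) \<Longrightarrow>
    norm (weight_at k o' \<omega> *\<^sub>R f (point_at k o' p \<omega>)) \<le> C"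
    using bounded_sphere_integrand[OF assms, where o' = o' and p = p] by blast
  then show ?thesis
    by (intro finite_measure.integrable_bounded[OF finite_param_measure] measurable_sphere_integrand assms) auto
qed

lemma sphere_integral_add:
  fixes f g :: "complex ^ 'n \<Rightarrow> 'b::{banach, second_countable_topology}"
  assumes "Suc k \<le> CARD('n)" "continuous_on UNIV f" "continuous_on UNIV g"
  shows "sphere_integral k o' p (\<lambda>v. f v + g v) = sphere_integral k o' p f + sphere_integral k o' p g"
  unfolding sphere_integral_def scaleR_add_right
  by (intro Bochner_Integration.integral_add integrable_sphere_integrand assms)

lemma sphere_integral_sum:
  fixes f :: "'i \<Rightarrow> complex ^ 'n \<Rightarrow> 'b::{banach, second_countable_topology}"
  assumes "Suc k \<le> CARD('n)" "\<And>i. i \<in> S \<Longrightarrow> continuous_on UNIV (f i)"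
  shows "sphere_integral k o' p (\<lambda>v. \<Sum>i\<in>S. f i v) = (\<Sum>i\<in>S. sphere_integral k o' p (f i))"
  unfolding sphere_integral_def scaleR_sum_right
  by (intro Bochner_Integration.integral_sum integrable_sphere_integrand assms)

lemma sphere_integral_mult:
  fixes f :: "complex ^ 'n \<Rightarrow> 'b::{real_normed_field, banach, second_countable_topology}"
  shows "sphere_integral k o' p (\<lambda>v. c * f v) = c * sphere_integral k o' p f"
  unfolding sphere_integral_def by (simp flip: mult_scaleR_right)

text \<open>The part of \<open>a\<close> that vectors in the span of the first \<open>k\<close>
  coordinates can detect through \<open>pairing\<close>.\<close>

definition partial_norm_sq :: "nat \<Rightarrow> complex ^ 'n \<Rightarrow> real" where
  "partial_norm_sq k a = (\<Sum>i=1..k. (norm (a $ e i))\<^sup>2)"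

lemma integral_radial_moment:
  "(LINT x|interval_measure 1. complex_of_real (x ^ (2 * p + 1) * sqrt (1 - x\<^sup>2) ^ (2 * q)))
    = fact p * fact q / (2 * fact (p + q + 1))"
proof -
  have "(LINT x|interval_measure 1. complex_of_real (x ^ (2 * p + 1) * sqrt (1 - x\<^sup>2) ^ (2 * q)))
     = (LINT x|interval_measure 1. complex_of_real (x ^ (2 * p + 1) * (1 - x\<^sup>2) ^ q))"
    by (rule Bochner_Integration.integral_cong)
       (auto simp: space_restrict_space power_mult abs_square_le_1)
  also have "\<dots> = complex_of_real (fact p * fact q / (2 * fact (p + q + 1)))"
    unfolding integral_complex_of_real integral_beta ..
  finally show ?thesis by simp
qed

text \<open>At \<open>n = 0\<close> this is 2 pi^(k+1) / k!, the area of the unit sphere of C^(k+1).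
  Divided by that area it is n! k! / (n + k)!, the mean of |v_1|^(2n) over uniformly distributed
  unit vectors v.\<close>

definition sphere_moment :: "nat \<Rightarrow> nat \<Rightarrow> real" where
  "sphere_moment k n = (2 * pi) ^ Suc k * fact n / (2 ^ k * fact (n + k))"

text \<open>The contribution of one term in the inductive step: the squared binomial coefficient
  comes from expanding a form and its conjugate, the quotient of factorials from the radius, 2 pi
  from the phase. One binomial coefficient cancels against factorials; the other is kept for the
  binomial theorem.\<close>

lemma sphere_moment_Suc:
  assumes "i \<le> n"
  shows "(real (n choose i))\<^sup>2 * (fact (i + k) * fact (n - i) / (2 * fact (n + k + 1))) * (2 * pi) * sphere_moment k i
    = sphere_moment (Suc k) n * real (n choose i)"
proof -
  have f: "real (n choose i) * (fact i * fact (n - i)) = fact n"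
    using binomial_fact_lemma[OF assms] by (metis mult.commute of_nat_fact of_nat_mult)
  have "(real (n choose i))\<^sup>2 * (fact (i + k) * fact (n - i) / (2 * fact (n + k + 1))) * (2 * pi) * sphere_moment k i
    = (real (n choose i) * (fact i * fact (n - i))) * real (n choose i) * (2 * pi) ^ Suc (Suc k) / (2 ^ Suc k * fact (n + k + 1))"
  proof -
    define F G where "F = (fact (n + k + 1) :: real)" and "G = (fact (i + k) :: real)"
    have "F \<noteq> 0" "G \<noteq> 0" by (simp_all add: F_def G_def)
    then show ?thesis
      unfolding sphere_moment_def F_def[symmetric] G_def[symmetric]
      by (simp add: power2_eq_square field_simps)
  qed
  also have "\<dots> = sphere_moment (Suc k) n * real (n choose i)"
    unfolding f by (simp add: sphere_moment_def)
  finally show ?thesis .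
qed

lemma integral_param_measure_empty_singleton:
  fixes v :: "real \<Rightarrow> complex"
  assumes "v \<in> borel_measurable (interval_measure (2*pi))" "\<And>x. norm (v x) \<le> D"
  shows "(LINT \<omega>|param_measure {} {j}. v (snd \<omega> j)) = integral\<^sup>L (interval_measure (2*pi)) v"
proof -
  interpret T: product_sigma_finite "\<lambda>_::nat. interval_measure (2 * pi)" by (rule product_sigma_finite_interval)
  let ?T = "\<Pi>\<^sub>M i\<in>{j}. interval_measure (2*pi)"
  have m: "(\<lambda>x. v (x j)) \<in> borel_measurable ?T" 
    by (rule measurable_compose[OF measurable_component_singleton[of j] assms(1)]) simp
  have "(LINT \<omega>|param_measure {} {j}. v (snd \<omega> j))
      = (LINT x|(\<Pi>\<^sub>M i\<in>({}::nat set). interval_measure 1). LINT t|?T. v (t j))"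
    unfolding param_measure_def
    by (subst integral_pair_bounded(1)[OF finite_measure_PiM_interval finite_measure_PiM_interval, where C=D])
       (use m assms(2) in \<open>auto intro: measurable_compose[OF measurable_snd]\<close>)
  also have "\<dots> = (LINT t|?T. v (t j))"
    by (simp add: PiM_empty)
  finally show ?thesis using T.product_integral_singleton[OF assms(1)] by simp
qed

lemma power_mult_cnj_power: "x ^ n * cnj x ^ n = complex_of_real (((norm x)\<^sup>2) ^ n)"
  by (simp only: power_mult_distrib[symmetric] complex_norm_square[symmetric] of_real_power)

text \<open>At a point of the larger sphere the form is x d + b z s, with d its value at the smaller
  sphere, b a coordinate of \<open>a\<close>, z the new phase and s = sqrt(1 - x^2). Expanding
  powers of it and of its conjugate separates the new parameters from the old. The phase integral
  and the inductive hypothesis leave only the diagonal terms, which the binomial theorem sums to a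
  power of the enlarged partial norm.\<close>

lemma sphere_integral_moment:
  assumes "Suc k \<le> CARD('n)"
  shows "sphere_integral k o' p (\<lambda>v. pairing a v ^ n * cnj (pairing a v) ^ m)
    = (if n = m then complex_of_real (sphere_moment k n * partial_norm_sq (Suc k) a ^ n) else 0)"
  using assms
proof (induction k arbitrary: n m)
  case 0
  let ?v = "\<lambda>t. cis t ^ n * cnj (cis t) ^ m"
  have "sphere_integral 0 o' p (\<lambda>v. pairing a v ^ n * cnj (pairing a v) ^ m)
     = (LINT \<omega>|param_measure {} {Suc p}. (a $ e 1) ^ n * cnj (a $ e 1) ^ m * ?v (snd \<omega> (Suc p)))"
    by (simp add: sphere_integral_def sphere_weight_def pairing_axis power_mult_distrib mult_ac)
  also have "\<dots> = (a $ e 1) ^ n * cnj (a $ e 1) ^ m * integral\<^sup>L (interval_measure (2*pi)) ?v"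
    by (subst integral_mult_right_zero, subst integral_param_measure_empty_singleton[where D=1])
       (auto intro!: measurable_interval_continuous continuous_intros simp: norm_mult norm_power)
  also have "integral\<^sup>L (interval_measure (2*pi)) ?v = (if n = m then 2 * pi else 0)"
    by (rule integral_cis_monomial)
  also have "(a $ e 1) ^ n * cnj (a $ e 1) ^ m * complex_of_real (if n = m then 2 * pi else 0)
     = (if n = m then complex_of_real (sphere_moment 0 n * partial_norm_sq (Suc 0) a ^ n) else 0)"
    by (simp add: sphere_moment_def partial_norm_sq_def power_mult_cnj_power)
  finally show ?case .
next
  case (Suc k)
  let ?f = "\<lambda>n m v. pairing a v ^ n * cnj (pairing a v) ^ m"
  let ?i = "o' + Suc k" and ?j = "p + Suc (Suc k)" and ?b = "a $ e (Suc (Suc k))"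
  let ?F = "\<lambda>\<omega>. weight_at (Suc k) o' \<omega> *\<^sub>R
     ?f n m (point_at (Suc k) o' p \<omega>)"
  have k: "Suc k \<le> CARD('n)" using Suc.prems by simp
  have cont: "continuous_on UNIV (?f n m)" for n m by (intro continuous_intros)
  have sets: "{o' + 1..o' + Suc k} = {o' + 1..o' + k} \<union> {?i}"
    "{p + 1..p + Suc (Suc k)} = {p + 1..p + Suc k} \<union> {?j}" by auto
  let ?M = "param_measure {?i} {?j}"
  let ?mg = "\<lambda>\<omega> \<omega>'. (merge {o' + 1..o' + k} {?i} (fst \<omega>, fst \<omega>'), merge {p + 1..p + Suc k} {?j} (snd \<omega>, snd \<omega>'))"
  obtain C where C: "\<And>\<omega>. \<omega> \<in> space (sphere_params (Suc k) o' p) \<Longrightarrow> norm (?F \<omega>) \<le> C"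
    using bounded_sphere_integrand[OF Suc.prems cont[of n m], where o' = o' and p = p] by blast
  define coef where "coef = (\<lambda>i j. of_nat (n choose i) * of_nat (m choose j) * ?b ^ (n - i) * cnj ?b ^ (m - j))"
  \<comment> \<open>The exponent of x collects \<open>i + j\<close> from the two expansions and
    \<open>2 * k + 1\<close> from the new factor of the weight.\<close>
  define u where "u = (\<lambda>i j x. complex_of_real (x ^ (i + j + 2 * k + 1) * sqrt (1 - x\<^sup>2) ^ (n - i + (m - j))))"
  define v where "v = (\<lambda>i j t. cis t ^ (n - i) * cnj (cis t) ^ (m - j))"
  define G where "G = (\<lambda>i j \<omega>. weight_at k o' \<omega> *\<^sub>R
     ?f i j (point_at k o' p \<omega>))"
  define K where "K = (\<lambda>i j. LINT \<omega>'|?M. u i j (fst \<omega>' ?i) * v i j (snd \<omega>' ?j))"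
  have mu: "u i j \<in> borel_measurable borel" and mv: "v i j \<in> borel_measurable borel" for i j
    unfolding u_def v_def by (auto intro!: borel_measurable_continuous_onI continuous_intros)
  have bu: "norm (u i j x) \<le> 1" if "x \<in> {0..1}" for i j x
  proof -
    have "\<bar>sqrt (1 - x\<^sup>2)\<bar> \<le> 1" using that by (simp add: abs_square_le_1)
    then show ?thesis
      using that by (auto simp: u_def norm_mult norm_power abs_mult power_abs intro!: mult_le_one power_le_one)
  qed
  have bv: "norm (v i j t) \<le> 1" for i j t
    by (simp add: v_def norm_mult norm_power)
  have K: "K i j = integral\<^sup>L (interval_measure 1) (u i j) * (if n - i = m - j then 2 * pi else 0)" for i j
  proof -
    have "K i j = integral\<^sup>L (interval_measure 1) (u i j) * integral\<^sup>L (interval_measure (2*pi)) (v i j)"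
      unfolding K_def
      by (rule integral_param_measure_singleton[where C=1 and D=1])
         (use bu bv mu mv in \<open>auto intro: measurable_restrict_space1\<close>)
    also have "integral\<^sup>L (interval_measure (2*pi)) (v i j) = (if n - i = m - j then 2 * pi else 0)"
      unfolding v_def by (rule integral_cis_monomial)
    finally show ?thesis .
  qed
  have "sphere_integral (Suc k) o' p (?f n m)
     = (LINT \<omega>|sphere_params k o' p. LINT \<omega>'|?M. ?F (?mg \<omega> \<omega>'))"
  proof -
    have m: "?F \<in> borel_measurable (param_measure ({o' + 1..o' + k} \<union> {?i}) ({p + 1..p + Suc k} \<union> {?j}))"
      by (rule measurable_sphere_integrand[OF Suc.prems cont])
    show ?thesis
      unfolding sphere_integral_def sets
      by (rule integral_param_measure_split[OF _ _ _ _ _ _ m C[unfolded sets]]) simp_all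
  qed
  also have "\<dots> = (LINT \<omega>|sphere_params k o' p. (\<Sum>i\<le>n. \<Sum>j\<le>m. coef i j * K i j * G i j \<omega>))"
  proof (rule lebesgue_integral_cong)
    fix \<omega> assume w: "\<omega> \<in> space (sphere_params k o' p)"
    have "?F (?mg \<omega> \<omega>') = (\<Sum>i\<le>n. \<Sum>j\<le>m. (coef i j * G i j \<omega>) * (u i j (fst \<omega>' ?i) * v i j (snd \<omega>' ?j)))" for \<omega>'
    proof -
      let ?X = "radii o' (?mg \<omega> \<omega>')" and ?Z = "phases p (?mg \<omega> \<omega>')"
      let ?d = "pairing a (point_at k o' p \<omega>)"
      let ?s = "complex_of_real (sqrt (1 - (fst \<omega>' ?i)\<^sup>2))" and ?x = "complex_of_real (fst \<omega>' ?i)" and ?z = "cis (snd \<omega>' ?j)"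
      have X: "?X i = radii o' \<omega> i" if "i \<in> {1..k}" for i using that by (simp add: merge_def)
      have X': "?X (Suc k) = fst \<omega>' ?i" by (simp add: merge_def add.commute)
      have Z: "?Z i = phases p \<omega> i" if "i \<in> {1..Suc k}" for i using that by (simp add: merge_def)
      have Z': "?Z (Suc (Suc k)) = ?z" by (simp add: merge_def add.commute)
      have "sphere_point k ?X ?Z = point_at k o' p \<omega>"
        using X Z by (intro sphere_point_cong) blast+
      then have d: "pairing a (sphere_point (Suc k) ?X ?Z) = ?x * ?d + ?b * (?z * ?s)"
        by (simp only: sphere_point.simps X' Z' pairing_add pairing_scale pairing_axis)
      have "sphere_weight k ?X = weight_at k o' \<omega>"
        unfolding sphere_weight_def using X by (intro prod.cong) simp_all
      then have w: "sphere_weight (Suc k) ?X = weight_at k o' \<omega> * fst \<omega>' ?i ^ (2 * k + 1)"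
        using X' by (simp add: sphere_weight_def)
      have "?f n m (sphere_point (Suc k) ?X ?Z) = (\<Sum>i\<le>n. of_nat (n choose i) * (?x * ?d) ^ i * (?b * (?z * ?s)) ^ (n - i)) *
         (\<Sum>j\<le>m. of_nat (m choose j) * (?x * cnj ?d) ^ j * (cnj ?b * (cnj ?z * ?s)) ^ (m - j))"
        unfolding d complex_cnj_add complex_cnj_mult complex_cnj_complex_of_real binomial_ring ..
      also have "\<dots> = (\<Sum>i\<le>n. \<Sum>j\<le>m. coef i j * (?d ^ i * cnj ?d ^ j) * (?x ^ (i + j) * ?s ^ (n - i + (m - j)) * v i j (snd \<omega>' ?j)))"
      proof -
        have "(A * (x * d) ^ i * (b * (z * s)) ^ q) * (B * (x * d') ^ j * (b' * (z' * s)) ^ r)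
          = (A * B * b ^ q * b' ^ r) * (d ^ i * d' ^ j) * (x ^ (i + j) * s ^ (q + r) * (z ^ q * z' ^ r))"
          for A B x d d' b b' z z' s :: complex and i j q r :: nat
          by (simp add: power_mult_distrib power_add mult_ac)
        then show ?thesis unfolding sum_product coef_def v_def by (intro sum.cong refl)
      qed
      finally have f: "?f n m (sphere_point (Suc k) ?X ?Z) = (\<Sum>i\<le>n. \<Sum>j\<le>m. coef i j * (?d ^ i * cnj ?d ^ j) *
        (?x ^ (i + j) * ?s ^ (n - i + (m - j)) * v i j (snd \<omega>' ?j)))" .
      show ?thesis
        unfolding w f G_def u_def scaleR_conv_of_real sum_distrib_left
        by (intro sum.cong refl) (simp add: power_add mult_ac)
    qed
    then have "(LINT \<omega>'|?M. ?F (?mg \<omega> \<omega>'))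
       = (LINT \<omega>'|?M. (\<Sum>i\<le>n. \<Sum>j\<le>m. (coef i j * G i j \<omega>) * (u i j (fst \<omega>' ?i) * v i j (snd \<omega>' ?j))))"
      by simp
    also have "\<dots> = (\<Sum>i\<le>n. \<Sum>j\<le>m. (coef i j * G i j \<omega>) * K i j)"
    proof -
      have "integrable ?M (\<lambda>\<omega>'. u i j (fst \<omega>' ?i) * v i j (snd \<omega>' ?j))" for i j
      proof (rule finite_measure.integrable_bounded[OF finite_param_measure, where C=1])
        show "(\<lambda>\<omega>'. u i j (fst \<omega>' ?i) * v i j (snd \<omega>' ?j)) \<in> borel_measurable ?M"
          by (intro borel_measurable_times measurable_compose[OF measurable_param_coordinates(1) mu]
              measurable_compose[OF measurable_param_coordinates(2) mv])
        fix \<omega>' assume "\<omega>' \<in> space ?M"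
        then have "fst \<omega>' ?i \<in> {0..1}" by (auto simp: space_param_measure PiE_iff)
        then show "norm (u i j (fst \<omega>' ?i) * v i j (snd \<omega>' ?j)) \<le> 1"
          using bu bv unfolding norm_mult by (intro mult_le_one) auto
      qed auto
      then show ?thesis
        unfolding K_def by (simp add: Bochner_Integration.integral_sum)
    qed
    finally show "(LINT \<omega>'|?M. ?F (?mg \<omega> \<omega>')) = (\<Sum>i\<le>n. \<Sum>j\<le>m. coef i j * K i j * G i j \<omega>)"
      by (simp add: mult_ac)
  qed
  also have "\<dots> = (\<Sum>i\<le>n. \<Sum>j\<le>m. coef i j * K i j * sphere_integral k o' p (?f i j))"
  proof -
    have iG: "integrable (sphere_params k o' p) (G i j)" for i j
      unfolding G_def by (rule integrable_sphere_integrand[OF k cont])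
    have "sphere_integral k o' p (?f i j) = integral\<^sup>L (sphere_params k o' p) (G i j)" for i j
      by (simp only: sphere_integral_def G_def)
    then show ?thesis
      using iG by (simp only: Bochner_Integration.integral_sum Bochner_Integration.integrable_sum
          integrable_mult_right integral_mult_right_zero)
  qed
  also have "\<dots> = (\<Sum>i\<le>n. \<Sum>j\<le>m. if i = j \<and> n = m then coef i i * K i i * (sphere_moment k i * partial_norm_sq (Suc k) a ^ i) else 0)"
  proof (intro sum.cong refl)
    fix i j assume ij: "i \<in> {..n}" "j \<in> {..m}"
    show "coef i j * K i j * sphere_integral k o' p (?f i j)
       = (if i = j \<and> n = m then coef i i * K i i * (sphere_moment k i * partial_norm_sq (Suc k) a ^ i) else 0)"
    \<comment> \<open>For \<open>i \<noteq> j\<close> the moment on the smaller sphere vanishes. For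
      \<open>i = j\<close> the phase integral survives only when \<open>n - i = m - i\<close>, that
      is, when \<open>n = m\<close>.\<close>
    proof (cases "i = j")
      case True
      have "K i j = 0" if "n \<noteq> m"
      proof -
        have "n - i \<noteq> m - j" using ij that True by auto
        then show ?thesis unfolding K by simp
      qed
      then show ?thesis using True by (auto simp: Suc.IH[OF k])
    qed (simp add: Suc.IH[OF k])
  qed
  also have "\<dots> = (if n = m then complex_of_real (sphere_moment (Suc k) n * partial_norm_sq (Suc (Suc k)) a ^ n) else 0)"
  proof (cases "n = m")
    case True
    have t: "coef i i * K i i * complex_of_real (sphere_moment k i * partial_norm_sq (Suc k) a ^ i)
       = complex_of_real (sphere_moment (Suc k) n * (of_nat (n choose i) * partial_norm_sq (Suc k) a ^ i * ((norm ?b)\<^sup>2) ^ (n - i)))"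
      if i: "i \<le> n" for i
    proof -
      \<comment> \<open>On the diagonal the exponents become \<open>2 * (i + k) + 1\<close> and
        \<open>2 * (n - i)\<close>, so the radial integral is a beta integral with parameters
        \<open>i + k\<close> and \<open>n - i\<close>.\<close>
      have u: "u i i = (\<lambda>x. complex_of_real (x ^ (2 * (i + k) + 1) * sqrt (1 - x\<^sup>2) ^ (2 * (n - i))))"
        using True unfolding u_def by (intro ext) (simp add: mult_2 add_ac)
      have s: "i + k + (n - i) + 1 = n + k + 1" using i by simp
      have "integral\<^sup>L (interval_measure 1) (u i i) = fact (i + k) * fact (n - i) / (2 * fact (n + k + 1))"
        unfolding u integral_radial_moment s ..
      then have Kii: "K i i = complex_of_real ((fact (i + k) * fact (n - i) / (2 * fact (n + k + 1))) * (2 * pi))"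
        unfolding K using True by simp
      have "coef i i = complex_of_real ((real (n choose i))\<^sup>2 * ((norm ?b)\<^sup>2) ^ (n - i))"
        using True power_mult_cnj_power[of ?b "n - i"] by (simp add: coef_def power2_eq_square mult_ac)
      then have "coef i i * K i i * complex_of_real (sphere_moment k i * partial_norm_sq (Suc k) a ^ i)
        = complex_of_real (((real (n choose i))\<^sup>2 * (fact (i + k) * fact (n - i) / (2 * fact (n + k + 1))) * (2 * pi) * sphere_moment k i)
            * ((norm ?b)\<^sup>2) ^ (n - i) * partial_norm_sq (Suc k) a ^ i)"
        unfolding Kii by (simp only: of_real_mult[symmetric] mult_ac)
      then show ?thesis unfolding sphere_moment_Suc[OF i] by (simp only: mult_ac)
    qed
    have "(\<Sum>i\<le>n. coef i i * K i i * complex_of_real (sphere_moment k i * partial_norm_sq (Suc k) a ^ i))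
      = complex_of_real (sphere_moment (Suc k) n * (\<Sum>i\<le>n. of_nat (n choose i) * partial_norm_sq (Suc k) a ^ i * ((norm ?b)\<^sup>2) ^ (n - i)))"
      unfolding sum_distrib_left of_real_sum by (intro sum.cong refl t) simp
    also have "\<dots> = complex_of_real (sphere_moment (Suc k) n * partial_norm_sq (Suc (Suc k)) a ^ n)"
      unfolding binomial_ring[symmetric] by (simp add: partial_norm_sq_def)
    finally show ?thesis using True by simp
  qed simp
  finally show ?case .
qed

lemma sphere_integral_of_real:
  "sphere_integral k o' p (\<lambda>v. complex_of_real (f v)) = complex_of_real (sphere_integral k o' p f)"
  unfolding sphere_integral_def
  by (simp add: scaleR_conv_of_real flip: of_real_mult integral_complex_of_real)

text \<open>Write the real part as half the sum of the form and its conjugate. In the binomial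
  expansion only a middle term has a nonzero moment, and it involves \<open>a\<close> through the
  partial norm alone.\<close>

lemma sphere_integral_Re_power_cong:
  assumes "Suc k \<le> CARD('n)" "partial_norm_sq (Suc k) a = partial_norm_sq (Suc k) b"
  shows "sphere_integral k o' p (\<lambda>v. Re (pairing a v) ^ n)
    = sphere_integral k o' p (\<lambda>v. Re (pairing b v) ^ n)"
proof -
  have eq: "complex_of_real (sphere_integral k o' p (\<lambda>v. Re (pairing a v) ^ n)) =
     (\<Sum>i\<le>n. (1 / 2) ^ n * of_nat (n choose i) *
        (if i = n - i then complex_of_real (sphere_moment k i * partial_norm_sq (Suc k) a ^ i) else 0))" for a
  proof -
    have "complex_of_real (Re d ^ n) = (\<Sum>i\<le>n. (1 / 2) ^ n * of_nat (n choose i) * (d ^ i * cnj d ^ (n - i)))" for d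
    proof -
      have "complex_of_real (Re d) = (1 / 2) * (d + cnj d)" by (simp add: complex_add_cnj)
      then have "complex_of_real (Re d ^ n) = (1 / 2) ^ n * (d + cnj d) ^ n" by (metis of_real_power power_mult_distrib)
      then show ?thesis by (simp add: binomial_ring sum_distrib_left mult_ac)
    qed
    then have "complex_of_real (sphere_integral k o' p (\<lambda>v. Re (pairing a v) ^ n))
       = sphere_integral k o' p (\<lambda>v. \<Sum>i\<le>n. (1 / 2) ^ n * of_nat (n choose i) * (pairing a v ^ i * cnj (pairing a v) ^ (n - i)))"
      by (simp flip: sphere_integral_of_real)
    also have "\<dots> = (\<Sum>i\<le>n. (1 / 2) ^ n * of_nat (n choose i) *
        sphere_integral k o' p (\<lambda>v. pairing a v ^ i * cnj (pairing a v) ^ (n - i)))"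
      by (subst sphere_integral_sum[OF assms(1)]) (auto intro!: continuous_intros simp: sphere_integral_mult)
    finally show ?thesis by (simp only: sphere_integral_moment[OF assms(1)])
  qed
  have "complex_of_real (sphere_integral k o' p (\<lambda>v. Re (pairing a v) ^ n))
    = complex_of_real (sphere_integral k o' p (\<lambda>v. Re (pairing b v) ^ n))"
    unfolding eq assms(2) ..
  then show ?thesis by simp
qed

text \<open>The exponential series is integrated term by term. The partial sums are dominated by the
  exponential of the absolute value, a continuous function on the sphere and hence integrable
  against the weight.\<close>

lemma sphere_integral_exp_cong:
  assumes "Suc k \<le> CARD('n)" "partial_norm_sq (Suc k) a = partial_norm_sq (Suc k) b"
  shows "sphere_integral k o' p (\<lambda>v. exp (Re (pairing a v)))
    = sphere_integral k o' p (\<lambda>v. exp (Re (pairing b v)))"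
proof -
  have lim: "(\<lambda>N. \<Sum>n<N. sphere_integral k o' p (\<lambda>v. Re (pairing a v) ^ n) / fact n)
     \<longlonglongrightarrow> sphere_integral k o' p (\<lambda>v. exp (Re (pairing a v)))" for a
  proof -
    have partial: "(\<Sum>n<N. sphere_integral k o' p (\<lambda>v. Re (pairing a v) ^ n) / fact n)
       = sphere_integral k o' p (\<lambda>v. \<Sum>n<N. inverse (fact n) * Re (pairing a v) ^ n)" for N
      by (subst sphere_integral_sum[OF assms(1)])
         (auto intro!: continuous_intros simp: sphere_integral_mult divide_inverse mult.commute)
    have bound: "\<bar>\<Sum>n<N. inverse (fact n) * t ^ n\<bar> \<le> exp \<bar>t\<bar>" for N and t :: real
    proof -
      have s: "summable (\<lambda>n. inverse (fact n) * \<bar>t\<bar> ^ n)"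
        using summable_exp[of "\<bar>t\<bar>"] by simp
      have "\<bar>\<Sum>n<N. inverse (fact n) * t ^ n\<bar> \<le> (\<Sum>n<N. inverse (fact n) * \<bar>t\<bar> ^ n)"
        by (rule order_trans[OF sum_abs]) (simp add: abs_mult power_abs)
      also have "\<dots> \<le> suminf (\<lambda>n. inverse (fact n) * \<bar>t\<bar> ^ n)"
        by (rule sum_le_suminf[OF s]) auto
      finally show ?thesis by (simp add: exp_def)
    qed
    let ?v = "\<lambda>\<omega>. point_at k o' p \<omega>"
    show ?thesis
      unfolding partial unfolding sphere_integral_def
    proof (rule integral_dominated_convergence[where w = "\<lambda>\<omega>. norm (weight_at k o' \<omega> *\<^sub>R exp \<bar>Re (pairing a (?v \<omega>))\<bar>)"])
      show "integrable (sphere_params k o' p) (\<lambda>\<omega>. norm (weight_at k o' \<omega> *\<^sub>R exp \<bar>Re (pairing a (?v \<omega>))\<bar>))"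
        by (intro integrable_norm integrable_sphere_integrand assms(1) continuous_intros)
      show "(\<lambda>\<omega>. weight_at k o' \<omega> *\<^sub>R exp (Re (pairing a (?v \<omega>)))) \<in> borel_measurable (sphere_params k o' p)"
        by (intro measurable_sphere_integrand[where f = "\<lambda>v. exp (Re (pairing a v))"] assms(1) continuous_intros)
      show "(\<lambda>\<omega>. weight_at k o' \<omega> *\<^sub>R (\<Sum>n<N. inverse (fact n) * Re (pairing a (?v \<omega>)) ^ n)) \<in> borel_measurable (sphere_params k o' p)" for N
        by (intro measurable_sphere_integrand[where f = "\<lambda>v. \<Sum>n<N. inverse (fact n) * Re (pairing a v) ^ n"] assms(1) continuous_intros)
      show "AE \<omega> in sphere_params k o' p. (\<lambda>N. weight_at k o' \<omega> *\<^sub>R (\<Sum>n<N. inverse (fact n) * Re (pairing a (?v \<omega>)) ^ n))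
         \<longlonglongrightarrow> weight_at k o' \<omega> *\<^sub>R exp (Re (pairing a (?v \<omega>)))"
      proof (intro AE_I2 tendsto_scaleR tendsto_const)
        fix \<omega>
        show "(\<lambda>N. \<Sum>n<N. inverse (fact n) * Re (pairing a (?v \<omega>)) ^ n) \<longlonglongrightarrow> exp (Re (pairing a (?v \<omega>)))"
          using exp_converges[of "Re (pairing a (?v \<omega>))"] by (simp add: sums_def)
      qed
      show "AE \<omega> in sphere_params k o' p. norm (weight_at k o' \<omega> *\<^sub>R (\<Sum>n<N. inverse (fact n) * Re (pairing a (?v \<omega>)) ^ n))
         \<le> norm (weight_at k o' \<omega> *\<^sub>R exp \<bar>Re (pairing a (?v \<omega>))\<bar>)" for N
        using bound by (intro AE_I2) (simp add: abs_mult mult_left_mono)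
    qed
  qed
  have eq: "(\<lambda>N. \<Sum>n<N. sphere_integral k o' p (\<lambda>v. Re (pairing a v) ^ n) / fact n)
    = (\<lambda>N. \<Sum>n<N. sphere_integral k o' p (\<lambda>v. Re (pairing b v) ^ n) / fact n)"
    by (simp only: sphere_integral_Re_power_cong[OF assms])
  show ?thesis
    by (rule LIMSEQ_unique[OF lim[of a]]) (unfold eq, rule lim)
qed

text \<open>The transpose is unitary and preserves the full norm. As \<open>h\<close> fixes the
  basis vectors beyond \<open>k\<close>, the transpose leaves the coordinates of \<open>a\<close>
  beyond \<open>k\<close> unchanged, and the rest of the norm is preserved too.\<close>

lemma partial_norm_sq_transpose:
  assumes "h \<in> SU_sub k" "k \<le> CARD('n)"
  shows "partial_norm_sq k (Finite_Cartesian_Product.transpose h *v a) = partial_norm_sq k a"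
proof -
  let ?b = "Finite_Cartesian_Product.transpose h *v a"
  have split: "(norm w)\<^sup>2 = partial_norm_sq k w + (\<Sum>i=Suc k..CARD('n). (norm (w $ e i))\<^sup>2)" for w :: "complex ^ 'n"
  proof -
    have "(norm w)\<^sup>2 = (\<Sum>i\<in>UNIV. (norm (w $ i))\<^sup>2)"
      by (simp add: power2_norm_eq_inner inner_vec_def)
    also have "\<dots> = (\<Sum>i=1..CARD('n). (norm (w $ e i))\<^sup>2)"
      by (rule sum.reindex_bij_betw[OF bij_e, symmetric])
    also have "{1..CARD('n)} = {1..k} \<union> {Suc k..CARD('n)}" using assms(2) by auto
    finally show ?thesis by (subst (asm) sum.union_disjoint) (auto simp: partial_norm_sq_def)
  qed
  have "?b $ e i = a $ e i" if "i \<in> {Suc k..CARD('n)}" for i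
  proof -
    have "h *v axis (e i) 1 = axis (e i) 1" using assms that by (simp add: SU_sub_def)
    then have "h $ j $ e i = (if j = e i then 1 else 0)" for j
      unfolding vec_eq_iff matrix_vector_mult_axis_nth
      by (simp add: axis_def)
    then have "h $ j $ e i * a $ j = (if j = e i then a $ j else 0)" for j
      by (cases "j = e i") auto
    then show ?thesis
      by (simp add: matrix_vector_mult_def Finite_Cartesian_Product.transpose_def)
  qed
  then have "(\<Sum>i=Suc k..CARD('n). (norm (?b $ e i))\<^sup>2) = (\<Sum>i=Suc k..CARD('n). (norm (a $ e i))\<^sup>2)"
    by simp
  moreover have "norm ?b = norm a"
    by (rule norm_unitary_vector_mult[OF unitary_transpose[OF SU_sub_unitary[OF assms(1)]]])
  ultimately show ?thesis using split[of ?b] split[of a] by simp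
qed

lemma sphere_integral_exp_span_invariant:
  assumes "Suc k \<le> CARD('n)" "h \<in> SU_sub (Suc k)" "g \<in> exp_span"
  shows "sphere_integral k o' p (\<lambda>v. g (h *v v)) = sphere_integral k o' p g"
  using assms(3)
proof induction
  case (exp c a)
  show ?case
    unfolding sphere_integral_mult pairing_matrix
    by (subst sphere_integral_exp_cong[OF assms(1) partial_norm_sq_transpose[OF assms(2,1)]]) simp
next
  case (add f g)
  have "continuous_on UNIV (\<lambda>v. f (h *v v))" if "f \<in> exp_span" for f
    by (rule continuous_on_compose2[OF continuous_on_exp_span[OF that]]) (auto intro!: continuous_intros)
  then have "sphere_integral k o' p (\<lambda>v. f (h *v v) + g (h *v v))
     = sphere_integral k o' p (\<lambda>v. f (h *v v)) + sphere_integral k o' p (\<lambda>v. g (h *v v))"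
    by (intro sphere_integral_add[OF assms(1)]) (use add in blast)+
  also have "\<dots> = sphere_integral k o' p f + sphere_integral k o' p g"
    unfolding add.IH ..
  also have "\<dots> = sphere_integral k o' p (\<lambda>v. f v + g v)"
    by (intro sphere_integral_add[OF assms(1), symmetric] continuous_on_exp_span add.hyps)
  finally show ?case .
qed

end

subsection \<open>Invariance of the weighted integral\<close>

text \<open>For descending from a compact group to an orbit: \<open>H\<close> is the function
  through which \<open>G\<close> factors. Its graph is a continuous image of \<open>T\<close>, hence
  compact, and a closed graph with values in a compact set gives continuity.\<close>

lemma continuous_on_compact_image:
  fixes q :: "'a::metric_space \<Rightarrow> 'b::euclidean_space" and G :: "'a \<Rightarrow> 'c::euclidean_space"
  assumes "compact T" "continuous_on T q" "continuous_on T G" "\<And>A. A \<in> T \<Longrightarrow> H (q A) = G A"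
  shows "continuous_on (q ` T) H"
proof (rule continuous_from_closed_graph)
  show "compact (G ` T)" by (rule compact_continuous_image[OF assms(3,1)])
  show "H \<in> q ` T \<rightarrow> G ` T" using assms(4) by auto
  have "(\<lambda>x. (x, H x)) ` (q ` T) = (\<lambda>A. (q A, G A)) ` T"
    using assms(4) by (auto simp: image_image)
  also have "compact \<dots>"
    by (intro compact_continuous_image continuous_on_Pair assms)
  finally show "closed ((\<lambda>x. (x, H x)) ` (q ` T))" by (rule compact_imp_closed)
qed

lemma continuous_on_left_mult:
  fixes F :: "complex ^ 'n ^ 'n \<Rightarrow> 'b::topological_space" and A :: "complex ^ 'n ^ 'n"
  assumes "continuous_on UNIV F"
  shows "continuous_on UNIV (\<lambda>K. F (A ** K))"
proof -
  have "continuous_on UNIV (\<lambda>K :: complex ^ 'n ^ 'n. A ** K)"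
    using continuous_on_matrix_mult[of UNIV "\<lambda>_. A" "\<lambda>K. K"] by (simp add: continuous_on_id)
  then show ?thesis by (intro continuous_on_compose2[OF assms]) auto
qed

lemma integral_param_measure_empty:
  fixes c :: "'b::{banach, second_countable_topology}"
  shows "(LINT \<omega>|param_measure {} {}. c) = c"
proof -
  have "(LINT \<omega>|param_measure {} {}. c) = (LINT x|(\<Pi>\<^sub>M i\<in>({}::nat set). interval_measure 1). LINT t|(\<Pi>\<^sub>M i\<in>({}::nat set). interval_measure (2*pi)). c)"
    unfolding param_measure_def
    by (rule integral_pair_bounded(1)[OF finite_measure_PiM_interval finite_measure_PiM_interval, where C="norm c"]) auto
  then show ?thesis by (simp add: PiM_empty)
qed

section \<open>Averages over cosets and the induction along the chain\<close>

context coordinate_enumeration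
begin

abbreviation group_params :: "nat \<Rightarrow> nat \<Rightarrow> nat \<Rightarrow> params measure" where
  "group_params k o' p \<equiv> param_measure {o' + 1..o' + num_radial k} {p + 1..p + num_phase k}"

abbreviation euler_at :: "nat \<Rightarrow> nat \<Rightarrow> nat \<Rightarrow> params \<Rightarrow> complex ^ 'n ^ 'n" where
  "euler_at k o' p \<omega> \<equiv> euler k (radii o' \<omega>) (phases p \<omega>)"

abbreviation special_frame_at :: "nat \<Rightarrow> nat \<Rightarrow> nat \<Rightarrow> params \<Rightarrow> complex ^ 'n ^ 'n" where
  "special_frame_at k o' p \<omega> \<equiv> special_frame k (radii o' \<omega>) (phases p \<omega>)"

definition euler_integral ::
  "(nat \<Rightarrow> real) \<Rightarrow> nat \<Rightarrow> nat \<Rightarrow> nat \<Rightarrow> (complex ^ 'n ^ 'n \<Rightarrow> 'b::{banach, second_countable_topology}) \<Rightarrow> 'b" where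
  "euler_integral C k o' p F = (LINT \<omega>|group_params k o' p.
     J_SU C (Suc k) (radii o' \<omega>) *\<^sub>R F (euler_at k o' p \<omega>))"

lemma J_SU_Suc:
  "J_SU C (Suc (Suc k)) x =
    2 ^ Suc k * C (Suc (Suc k)) * sphere_weight (Suc k) x * J_SU C (Suc k) (\<lambda>i. x (i + Suc k))"
  by (simp add: sphere_weight_def)

lemma J_SU_cong:
  assumes "\<And>i. i \<in> {1..num_radial k} \<Longrightarrow> x i = y i"
  shows "J_SU C (Suc k) x = J_SU C (Suc k) y"
  using assms
proof (induction k arbitrary: x y)
  case (Suc k)
  have "sphere_weight (Suc k) x = sphere_weight (Suc k) y"
    unfolding sphere_weight_def by (intro prod.cong refl arg_cong2[where f = power] Suc.prems) auto
  moreover have "J_SU C (Suc k) (\<lambda>i. x (i + Suc k)) = J_SU C (Suc k) (\<lambda>i. y (i + Suc k))"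
    by (intro Suc.IH Suc.prems) auto
  ultimately show ?case by (simp only: J_SU_Suc)
qed simp

lemma J_SU_bounded:
  "\<exists>B. \<forall>x. (\<forall>i\<in>{1..num_radial k}. x i \<in> {0..1}) \<longrightarrow> \<bar>J_SU C (Suc k) x\<bar> \<le> B"
proof (induction k)
  case 0
  then show ?case by (intro exI[of _ 1]) simp
next
  case (Suc k)
  then obtain B where B: "\<And>x. \<forall>i\<in>{1..num_radial k}. x i \<in> {0..1} \<Longrightarrow> \<bar>J_SU C (Suc k) x\<bar> \<le> B" by blast
  have "\<bar>J_SU C (Suc (Suc k)) x\<bar> \<le> \<bar>2 ^ Suc k * C (Suc (Suc k))\<bar> * B"
    if x: "\<forall>i\<in>{1..num_radial (Suc k)}. x i \<in> {0..1}" for x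
  proof -
    have "\<forall>i\<in>{1..num_radial k}. x (i + Suc k) \<in> {0..1}" using x by auto
    then have J: "\<bar>J_SU C (Suc k) (\<lambda>i. x (i + Suc k))\<bar> \<le> B" by (rule B)
    have w: "0 \<le> sphere_weight (Suc k) x" "sphere_weight (Suc k) x \<le> 1"
      using sphere_weight_bounds[of "Suc k" x] x by auto
    have "\<bar>sphere_weight (Suc k) x * J_SU C (Suc k) (\<lambda>i. x (i + Suc k))\<bar> \<le> 1 * B"
      unfolding abs_mult using w J by (intro mult_mono) auto
    then show ?thesis unfolding J_SU_Suc mult.assoc[of "2 ^ Suc k * C (Suc (Suc k))"] abs_mult[of "2 ^ Suc k * C (Suc (Suc k))"]
      by (intro mult_left_mono) auto
  qed
  then show ?case by blast
qed

lemma measurable_J_SU [measurable]: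
  "(\<lambda>\<omega>. J_SU C (Suc k) (radii o' \<omega>)) \<in> borel_measurable (param_measure I J)"
proof (induction k arbitrary: o')
  case (Suc k)
  have "(\<lambda>\<omega>. J_SU C (Suc k) (radii (Suc k + o') \<omega>)) \<in> borel_measurable (param_measure I J)"
    by (rule Suc.IH)
  then have "(\<lambda>\<omega>. J_SU C (Suc k) (\<lambda>i. radii o' \<omega> (i + Suc k))) \<in> borel_measurable (param_measure I J)"
    by (simp only: add.assoc)
  then show ?case unfolding J_SU_Suc by measurable
qed simp

lemma measurable_euler:
  "euler_at k o' p \<in> borel_measurable (param_measure I J)"
  by (rule borel_measurable_matrixI)
     (rule star_algebra_euler[OF star_algebra_borel_measurable measurable_radii_phases])

lemma measurable_special_frame:
  "special_frame_at k o' p \<in> borel_measurable (param_measure I J)"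
  by (rule borel_measurable_matrixI)
     (rule star_algebra_special_frame[OF star_algebra_borel_measurable measurable_radii_phases])

lemma euler_at_SU_sub:
  assumes "Suc k \<le> CARD('n)" "\<omega> \<in> space (group_params k o' p)"
  shows "euler_at k o' p \<omega> \<in> SU_sub (Suc k)"
  using radii_mem[OF assms(2)] by (intro euler_SU_sub[OF assms(1)] ballI) auto

lemma special_frame_at_SU_sub:
  assumes "Suc k \<le> CARD('n)" "\<omega> \<in> space (sphere_params k o' p)"
  shows "special_frame_at k o' p \<omega> \<in> SU_sub (Suc k)"
  using radii_mem[OF assms(2)] by (intro special_frame_SU_sub[OF assms(1)] ballI) auto

lemma measurable_euler_integrand:
  fixes F :: "complex ^ 'n ^ 'n \<Rightarrow> 'b::{banach, second_countable_topology}"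
  assumes "continuous_on UNIV F"
  shows "(\<lambda>\<omega>. J_SU C (Suc k) (radii o' \<omega>) *\<^sub>R F (euler_at k o' p \<omega>)) \<in> borel_measurable (param_measure I J)"
  by (intro borel_measurable_scaleR measurable_J_SU
      measurable_compose[OF measurable_euler borel_measurable_continuous_onI[OF assms]])

text \<open>The bound is uniform over a compact set of left factors so that a convergent sequence
  together with its limit has a common majorant. The set \<open>{mat 1}\<close> gives the bound for
  the plain integrand.\<close>

lemma bounded_euler_integrand:
  fixes T :: "(complex ^ 'n ^ 'n) set"
  assumes "Suc k \<le> CARD('n)" "compact T" "continuous_on UNIV F"
  obtains B where "\<And>A \<omega>. A \<in> T \<Longrightarrow> \<omega> \<in> space (group_params k o' p) \<Longrightarrow>
    norm (J_SU C (Suc k) (radii o' \<omega>) *\<^sub>R F (A ** euler_at k o' p \<omega>)) \<le> B"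
proof -
  have "compact ((\<lambda>(A, K). F (A ** K)) ` (T \<times> SU))"
    unfolding case_prod_unfold
    by (intro compact_continuous_image compact_Times assms(2) compact_SU
        continuous_on_compose2[OF assms(3)] continuous_intros) auto
  from compact_imp_bounded[OF this]
  obtain B1 where B1: "\<forall>y\<in>(\<lambda>(A, K). F (A ** K)) ` (T \<times> SU). norm y \<le> B1"
    unfolding bounded_iff ..
  obtain B2 where B2: "\<forall>x. (\<forall>i\<in>{1..num_radial k}. x i \<in> {0..1}) \<longrightarrow> \<bar>J_SU C (Suc k) x\<bar> \<le> B2"
    using J_SU_bounded[of k C] ..
  have "norm (J_SU C (Suc k) (radii o' \<omega>) *\<^sub>R F (A ** euler_at k o' p \<omega>)) \<le> B2 * B1"
    if "A \<in> T" "\<omega> \<in> space (group_params k o' p)" for A \<omega>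
  proof -
    have "\<bar>J_SU C (Suc k) (radii o' \<omega>)\<bar> \<le> B2"
      by (intro B2[rule_format] radii_mem[OF that(2)])
    moreover have "norm (F (A ** euler_at k o' p \<omega>)) \<le> B1"
    proof -
      have "(\<lambda>(A, K). F (A ** K)) (A, euler_at k o' p \<omega>) \<in> (\<lambda>(A, K). F (A ** K)) ` (T \<times> SU)"
        using that(1) SU_sub_SU[OF euler_at_SU_sub[OF assms(1) that(2)]] by (intro imageI SigmaI)
      then show ?thesis using B1 by (simp only: prod.case)
    qed
    moreover from calculation(1) have "0 \<le> B2" by linarith
    ultimately show ?thesis unfolding norm_scaleR
      by (intro mult_mono) simp_all
  qed
  then show ?thesis by (rule that)
qed

lemma integrable_euler_integrand:
  fixes F :: "complex ^ 'n ^ 'n \<Rightarrow> 'b::{banach, second_countable_topology}"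
  assumes "Suc k \<le> CARD('n)" "continuous_on UNIV F"
  shows "integrable (group_params k o' p) (\<lambda>\<omega>. J_SU C (Suc k) (radii o' \<omega>) *\<^sub>R F (euler_at k o' p \<omega>))"
proof -
  obtain B where *: "\<And>A \<omega>. A \<in> {mat 1} \<Longrightarrow> \<omega> \<in> space (group_params k o' p) \<Longrightarrow>
    norm (J_SU C (Suc k) (radii o' \<omega>) *\<^sub>R F (A ** euler_at k o' p \<omega>)) \<le> B"
    using bounded_euler_integrand[OF assms(1) _ assms(2), of "{mat 1}" o' p C] by auto
  have B: "norm (J_SU C (Suc k) (radii o' \<omega>) *\<^sub>R F (euler_at k o' p \<omega>)) \<le> B"
    if "\<omega> \<in> space (group_params k o' p)" for \<omega>
    using *[OF insertI1 that] unfolding matrix_mul_lid .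
  have "finite_measure (group_params k o' p)" by (rule finite_param_measure) auto
  from finite_measure.integrable_bounded[OF this measurable_euler_integrand[OF assms(2)] B]
  show ?thesis .
qed

text \<open>Supplies the continuity of the coset average as a function on the matrix space, before
  it is passed on to the sphere.\<close>

lemma continuous_on_euler_integral:
  fixes F :: "complex ^ 'n ^ 'n \<Rightarrow> real"
  assumes "Suc k \<le> CARD('n)" "continuous_on UNIV F"
  shows "continuous_on UNIV (\<lambda>A. euler_integral C k o' p (\<lambda>K. F (A ** K)))"
  unfolding continuous_on_sequentially o_def
proof (intro allI ballI impI)
  fix A :: "nat \<Rightarrow> complex ^ 'n ^ 'n" and A0 assume "(\<forall>n. A n \<in> UNIV) \<and> A \<longlonglongrightarrow> A0"
  then have lim: "A \<longlonglongrightarrow> A0" by simp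
  have cont: "continuous_on UNIV (\<lambda>K. F (A ** K))" for A :: "complex ^ 'n ^ 'n"
    by (rule continuous_on_left_mult[OF assms(2)])
  obtain B where B: "\<And>A' \<omega>. A' \<in> insert A0 (range A) \<Longrightarrow> \<omega> \<in> space (group_params k o' p) \<Longrightarrow>
    norm (J_SU C (Suc k) (radii o' \<omega>) *\<^sub>R F (A' ** euler_at k o' p \<omega>)) \<le> B"
    using bounded_euler_integrand[OF assms(1) compact_sequence_with_limit[OF lim] assms(2), of o' p C] by blast
  show "(\<lambda>n. euler_integral C k o' p (\<lambda>K. F (A n ** K))) \<longlonglongrightarrow> euler_integral C k o' p (\<lambda>K. F (A0 ** K))"
    unfolding euler_integral_def
  proof (rule integral_dominated_convergence[where w = "\<lambda>_. B"])
    show "integrable (group_params k o' p) (\<lambda>_. B)"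
      by (rule finite_measure.integrable_const[OF finite_param_measure]) auto
    show "AE \<omega> in group_params k o' p.
        (\<lambda>n. J_SU C (Suc k) (radii o' \<omega>) *\<^sub>R F (A n ** euler_at k o' p \<omega>))
        \<longlonglongrightarrow> J_SU C (Suc k) (radii o' \<omega>) *\<^sub>R F (A0 ** euler_at k o' p \<omega>)"
    proof (intro AE_I2 tendsto_scaleR tendsto_const)
      fix \<omega>
      have "continuous_on UNIV (\<lambda>A. F (A ** euler_at k o' p \<omega>))"
        by (intro continuous_on_compose2[OF assms(2)] continuous_intros) auto
      then show "(\<lambda>n. F (A n ** euler_at k o' p \<omega>)) \<longlonglongrightarrow> F (A0 ** euler_at k o' p \<omega>)"
        using continuous_on_tendsto_compose[OF _ lim, of UNIV] by auto
    qed
    show "AE \<omega> in group_params k o' p.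
        norm (J_SU C (Suc k) (radii o' \<omega>) *\<^sub>R F (A n ** euler_at k o' p \<omega>)) \<le> B" for n
      by (intro AE_I2 B) auto
    show "(\<lambda>\<omega>. J_SU C (Suc k) (radii o' \<omega>) *\<^sub>R F (A0 ** euler_at k o' p \<omega>)) \<in> borel_measurable (group_params k o' p)"
      by (rule measurable_euler_integrand[OF cont[of A0]])
    show "(\<lambda>\<omega>. J_SU C (Suc k) (radii o' \<omega>) *\<^sub>R F (A n ** euler_at k o' p \<omega>)) \<in> borel_measurable (group_params k o' p)" for n
      by (rule measurable_euler_integrand[OF cont[of "A n"]])
  qed
qed

text \<open>Fubini along the first factor of \<open>euler\<close>: the inner integral averages
  \<open>F\<close> over the coset of the special frame, and the weight of the new sphere with its
  constant stays outside.\<close>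

lemma euler_integral_Suc:
  fixes F :: "complex ^ 'n ^ 'n \<Rightarrow> 'b::{banach, second_countable_topology}"
  assumes k: "Suc (Suc k) \<le> CARD('n)" and F: "continuous_on UNIV F"
  shows "euler_integral C (Suc k) o' p F = (LINT \<omega>|sphere_params (Suc k) o' p.
    (2 ^ Suc k * C (Suc (Suc k)) * weight_at (Suc k) o' \<omega>) *\<^sub>R
      euler_integral C k (o' + Suc k) (p + Suc (Suc k)) (\<lambda>K. F (special_frame_at (Suc k) o' p \<omega> ** K)))"
proof -
  let ?I = "{o' + 1..o' + Suc k}" and ?I' = "{o' + Suc k + 1..o' + Suc k + num_radial k}"
  let ?J = "{p + 1..p + Suc (Suc k)}" and ?J' = "{p + Suc (Suc k) + 1..p + Suc (Suc k) + num_phase k}"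
  have sets: "{o' + 1..o' + num_radial (Suc k)} = ?I \<union> ?I'" "{p + 1..p + num_phase (Suc k)} = ?J \<union> ?J'"
    by auto
  let ?F = "\<lambda>\<omega>. J_SU C (Suc (Suc k)) (radii o' \<omega>) *\<^sub>R F (euler_at (Suc k) o' p \<omega>)"
  let ?mg = "\<lambda>\<omega> \<omega>'. (merge ?I ?I' (fst \<omega>, fst \<omega>'), merge ?J ?J' (snd \<omega>, snd \<omega>'))"
  obtain B where *: "\<And>A \<omega>. A \<in> {mat 1} \<Longrightarrow> \<omega> \<in> space (group_params (Suc k) o' p) \<Longrightarrow>
    norm (J_SU C (Suc (Suc k)) (radii o' \<omega>) *\<^sub>R F (A ** euler_at (Suc k) o' p \<omega>)) \<le> B"
    using bounded_euler_integrand[OF k _ F, of "{mat 1}" o' p C] by auto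
  have B: "norm (?F \<omega>) \<le> B" if "\<omega> \<in> space (param_measure (?I \<union> ?I') (?J \<union> ?J'))" for \<omega>
    using *[OF insertI1, unfolded sets, OF that] unfolding matrix_mul_lid .
  have "euler_integral C (Suc k) o' p F
     = (LINT \<omega>|sphere_params (Suc k) o' p. LINT \<omega>'|param_measure ?I' ?J'. ?F (?mg \<omega> \<omega>'))"
    unfolding euler_integral_def sets
    by (rule integral_param_measure_split[OF _ _ _ _ _ _ measurable_euler_integrand[OF F] B]) auto
  also have "\<dots> = (LINT \<omega>|sphere_params (Suc k) o' p. LINT \<omega>'|param_measure ?I' ?J'.
     (2 ^ Suc k * C (Suc (Suc k)) * weight_at (Suc k) o' \<omega>) *\<^sub>R
     (J_SU C (Suc k) (radii (o' + Suc k) \<omega>') *\<^sub>R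
       F (special_frame_at (Suc k) o' p \<omega> ** euler_at k (o' + Suc k) (p + Suc (Suc k)) \<omega>')))"
  proof (intro lebesgue_integral_cong)
    fix \<omega> \<omega>'
    let ?X = "radii o' (?mg \<omega> \<omega>')" and ?Z = "phases p (?mg \<omega> \<omega>')"
    have X: "?X i = radii o' \<omega> i" if "i \<in> {1..Suc k}" for i using that by (simp add: merge_def)
    have X': "?X (i + Suc k) = radii (o' + Suc k) \<omega>' i" if "i \<in> {1..num_radial k}" for i
      using that by (auto simp: merge_def add_ac)
    have Z: "?Z i = phases p \<omega> i" if "i \<in> {1..Suc (Suc k)}" for i using that by (simp add: merge_def)
    have Z': "?Z (i + Suc (Suc k)) = phases (p + Suc (Suc k)) \<omega>' i" if "i \<in> {1..num_phase k}" for i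
      using that by (auto simp: merge_def add_ac)
    have "sphere_weight (Suc k) ?X = weight_at (Suc k) o' \<omega>"
      unfolding sphere_weight_def using X by (intro prod.cong refl) (simp only:)
    moreover have "J_SU C (Suc k) (\<lambda>i. ?X (i + Suc k)) = J_SU C (Suc k) (radii (o' + Suc k) \<omega>')"
      by (rule J_SU_cong) (rule X')
    moreover have "special_frame (Suc k) ?X ?Z = special_frame_at (Suc k) o' p \<omega>"
      by (rule special_frame_cong) (use X Z in blast)+
    moreover have "euler k (\<lambda>i. ?X (i + Suc k)) (\<lambda>j. ?Z (j + Suc (Suc k))) = euler_at k (o' + Suc k) (p + Suc (Suc k)) \<omega>'"
      by (rule euler_cong) (use X' Z' in blast)+
    ultimately show "?F (?mg \<omega> \<omega>') = (2 ^ Suc k * C (Suc (Suc k)) * weight_at (Suc k) o' \<omega>) *\<^sub>R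
     (J_SU C (Suc k) (radii (o' + Suc k) \<omega>') *\<^sub>R
       F (special_frame_at (Suc k) o' p \<omega> ** euler_at k (o' + Suc k) (p + Suc (Suc k)) \<omega>'))"
      by (simp only: J_SU_Suc euler.simps scaleR_scaleR)
  qed
  also have "\<dots> = (LINT \<omega>|sphere_params (Suc k) o' p.
    (2 ^ Suc k * C (Suc (Suc k)) * weight_at (Suc k) o' \<omega>) *\<^sub>R
      euler_integral C k (o' + Suc k) (p + Suc (Suc k)) (\<lambda>K. F (special_frame_at (Suc k) o' p \<omega> ** K)))"
    unfolding euler_integral_def by (simp only: integral_scaleR_right)
  finally show ?thesis .
qed

text \<open>\<open>G A\<close> is the average of \<open>F\<close> over the coset of
  \<open>A\<close>. The inductive hypothesis makes it a function \<open>H\<close> of the last column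
  of \<open>A\<close>, and the outer integral then runs over a uniformly distributed column, where
  \<open>h\<close> can be removed once \<open>H\<close> is approximated by exponentials.\<close>

lemma euler_integral_left_invariant:
  fixes F :: "complex ^ 'n ^ 'n \<Rightarrow> real"
  assumes "Suc k \<le> CARD('n)" "h \<in> SU_sub (Suc k)" "continuous_on UNIV F"
  shows "euler_integral C k o' p (\<lambda>A. F (h ** A)) = euler_integral C k o' p F"
  using assms
proof (induction k arbitrary: o' p h F)
  case 0
  have "h = mat 1"
    using "0.prems"(2) SU_sub_1 unfolding One_nat_def by blast
  then show ?case by (simp only: matrix_mul_lid)
next
  case (Suc k)
  have k: "Suc k \<le> CARD('n)" using Suc.prems by simp
  define c where "c = 2 ^ Suc k * C (Suc (Suc k))"
  define T where "T = SU_sub (Suc (Suc k))"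
  define ax :: "complex ^ 'n" where "ax = axis (e (Suc (Suc k))) 1"
  define G where "G = (\<lambda>A. euler_integral C k (o' + Suc k) (p + Suc (Suc k)) (\<lambda>K. F (A ** K)))"
  let ?M = "sphere_params (Suc k) o' p"
  let ?w = "\<lambda>\<omega>. weight_at (Suc k) o' \<omega>"
  let ?B = "special_frame_at (Suc k) o' p"
  let ?v = "\<lambda>\<omega>. point_at (Suc k) o' p \<omega>"
  have contFA: "continuous_on UNIV (\<lambda>K. F (A ** K))" for A :: "complex ^ 'n ^ 'n"
    by (rule continuous_on_left_mult[OF Suc.prems(3)])
  have contG: "continuous_on UNIV G"
    unfolding G_def by (rule continuous_on_euler_integral[OF k Suc.prems(3)])
  \<comment> \<open>The quotient of two matrices with the same last column lies in the smaller
    group; the inductive hypothesis, applied to \<open>F\<close> after left multiplication by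
    \<open>A\<close>, absorbs it.\<close>
  have wd: "G A = G A'" if "A \<in> T" "A' \<in> T" "A *v ax = A' *v ax" for A A'
  proof -
    let ?D = "adjoint_matrix A ** A'"
    have "?D *v ax = adjoint_matrix A *v (A *v ax)"
      unfolding that(3) by (simp add: matrix_vector_mul_assoc)
    also have "\<dots> = ax"
      using unitary_adjoint_mult[of A] that(1) SU_sub_unitary by (simp add: matrix_vector_mul_assoc T_def)
    finally have Dax: "?D *v ax = ax" .
    have "?D \<in> SU_sub (Suc (Suc k))"
      using that(1,2) unfolding T_def by (intro SU_sub_mult SU_sub_adjoint)
    with Dax have "?D \<in> SU_sub (Suc k)"
      unfolding ax_def by (intro SU_sub_stabilizer[of "Suc k" ?D]) simp_all
    from Suc.IH[OF k this contFA[of A]]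
    have "euler_integral C k (o' + Suc k) (p + Suc (Suc k)) (\<lambda>K. F (A ** (?D ** K))) = G A"
      unfolding G_def .
    moreover have "A ** (?D ** K) = A' ** K" for K :: "complex ^ 'n ^ 'n"
      using unitary_mult_adjoint[of A] that(1) SU_sub_unitary[of A]
      by (simp add: T_def matrix_mul_assoc)
    ultimately show ?thesis unfolding G_def by (simp only:)
  qed
  \<comment> \<open>Any matrix in the group with last column \<open>v\<close> may be chosen, since
    by \<open>wd\<close> the value depends on the column alone.\<close>
  define H where "H = (\<lambda>v. G (SOME A. A \<in> T \<and> A *v ax = v))"
  have H: "H (A *v ax) = G A" if "A \<in> T" for A
  proof -
    have "(SOME A'. A' \<in> T \<and> A' *v ax = A *v ax) \<in> T \<and> (SOME A'. A' \<in> T \<and> A' *v ax = A *v ax) *v ax = A *v ax"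
      by (rule someI[of _ A]) (use that in simp)
    then show ?thesis unfolding H_def by (intro wd that) auto
  qed
  let ?S = "(\<lambda>A. A *v ax) ` T"
  have compT: "compact T" unfolding T_def by (rule compact_SU_sub)
  have contq: "continuous_on T (\<lambda>A. A *v ax)"
    by (intro continuous_on_matrix_vector_mult' continuous_on_id continuous_on_const)
  have contH: "continuous_on ?S H"
    by (rule continuous_on_compact_image[of T "\<lambda>A. A *v ax" G H])
       (use compT contq continuous_on_subset[OF contG subset_UNIV] H in blast)+
  have compS: "compact ?S" by (rule compact_continuous_image[OF contq compT])
  have B: "?B \<omega> \<in> T" if "\<omega> \<in> space ?M" for \<omega>
    unfolding T_def by (rule special_frame_at_SU_sub[OF Suc.prems(1) that])
  have Bv: "?B \<omega> *v ax = ?v \<omega>" for \<omega>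
    unfolding ax_def using Suc.prems(1) by (intro special_frame_column) auto
  have fin: "finite_measure ?M" by (rule finite_param_measure) auto
  define m where "m = measure ?M (space ?M)"
  \<comment> \<open>Used twice, with \<open>U\<close> equal to \<open>h\<close> and to the identity.
    The weight lies between 0 and 1, so the error is at most \<open>\<epsilon>\<close> times the
    total mass \<open>m\<close> of the parameter space.\<close>
  have approx: "\<bar>(LINT \<omega>|?M. ?w \<omega> *\<^sub>R G (U ** ?B \<omega>)) - sphere_integral (Suc k) o' p (\<lambda>v. g (U *v v))\<bar> \<le> \<epsilon> * m"
    if U: "U \<in> T" and g: "g \<in> exp_span" "\<forall>v\<in>?S. \<bar>H v - g v\<bar> < \<epsilon>" for U g \<epsilon>
  proof -
    have gc: "continuous_on UNIV (\<lambda>v. g (U *v v))"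
      by (rule continuous_on_compose2[OF continuous_on_exp_span[OF g(1)]]) (auto intro!: continuous_intros)
    have meas: "(\<lambda>\<omega>. ?w \<omega> *\<^sub>R G (U ** ?B \<omega>)) \<in> borel_measurable ?M"
    proof (intro borel_measurable_scaleR measurable_sphere_weight measurable_compose[OF measurable_special_frame, of "\<lambda>A. G (U ** A)"])
      show "(\<lambda>A. G (U ** A)) \<in> borel_measurable borel"
        by (intro borel_measurable_continuous_onI continuous_on_left_mult[OF contG])
    qed
    have close: "norm (?w \<omega> *\<^sub>R G (U ** ?B \<omega>) - ?w \<omega> *\<^sub>R g (U *v ?v \<omega>)) \<le> \<epsilon>" if w: "\<omega> \<in> space ?M" for \<omega>
    proof -
      have UB: "U ** ?B \<omega> \<in> T" using U B[OF w] unfolding T_def by (rule SU_sub_mult)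
      have UBv: "(U ** ?B \<omega>) *v ax = U *v ?v \<omega>" unfolding Bv[symmetric] by (rule matrix_vector_mul_assoc[symmetric])
      have GH: "G (U ** ?B \<omega>) = H (U *v ?v \<omega>)" using H[OF UB] unfolding UBv by (rule sym)
      have "U *v ?v \<omega> \<in> ?S" using imageI[OF UB, of "\<lambda>A. A *v ax"] unfolding UBv .
      then have 1: "\<bar>G (U ** ?B \<omega>) - g (U *v ?v \<omega>)\<bar> < \<epsilon>" unfolding GH using g(2) by blast
      have 2: "0 \<le> ?w \<omega>" "?w \<omega> \<le> 1"
        using sphere_weight_bounds[of "Suc k" "radii o' \<omega>"] radii_mem[OF w] by blast+
      have "\<bar>?w \<omega>\<bar> * \<bar>G (U ** ?B \<omega>) - g (U *v ?v \<omega>)\<bar> \<le> 1 * \<epsilon>"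
        using 1 2 by (intro mult_mono) auto
      then show ?thesis by (simp add: abs_mult flip: right_diff_distrib)
    qed
    have ig: "integrable ?M (\<lambda>\<omega>. ?w \<omega> *\<^sub>R g (U *v ?v \<omega>))"
      by (rule integrable_sphere_integrand[OF Suc.prems(1) gc])
    have id: "integrable ?M (\<lambda>\<omega>. ?w \<omega> *\<^sub>R G (U ** ?B \<omega>) - ?w \<omega> *\<^sub>R g (U *v ?v \<omega>))"
      using meas ig by (intro finite_measure.integrable_bounded[OF fin _ close]) auto
    have iG: "integrable ?M (\<lambda>\<omega>. ?w \<omega> *\<^sub>R G (U ** ?B \<omega>))"
      using Bochner_Integration.integrable_add[OF id ig] by simp
    have "norm (LINT \<omega>|?M. ?w \<omega> *\<^sub>R G (U ** ?B \<omega>) - ?w \<omega> *\<^sub>R g (U *v ?v \<omega>)) \<le> \<epsilon> * m"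
      unfolding m_def using id by (intro finite_measure.norm_integral_bounded[OF fin _ close]) auto
    then show ?thesis
      using Bochner_Integration.integral_diff[OF iG ig] by (simp only: sphere_integral_def real_norm_def)
  qed
  have hT: "h \<in> T" and oneT: "mat 1 \<in> T"
    using Suc.prems(2) mat_1_SU_sub unfolding T_def by auto
  have eq: "(LINT \<omega>|?M. ?w \<omega> *\<^sub>R G (h ** ?B \<omega>)) = (LINT \<omega>|?M. ?w \<omega> *\<^sub>R G (?B \<omega>))" (is "?L = ?R")
  proof (rule ccontr)
    assume "?L \<noteq> ?R"
    then have pos: "0 < \<bar>?L - ?R\<bar>" by simp
    have m: "0 \<le> m" unfolding m_def by simp
    \<comment> \<open>Two approximation errors cost \<open>2 * (\<epsilon> * m)\<close>, less than
      half of the assumed gap. Adding 1 to \<open>m\<close> keeps the denominator positive.\<close>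
    define \<epsilon> where "\<epsilon> = \<bar>?L - ?R\<bar> / (4 * (m + 1))"
    have \<epsilon>: "0 < \<epsilon>" unfolding \<epsilon>_def using pos m by (intro divide_pos_pos) auto
    obtain g where g: "g \<in> exp_span" "\<forall>v\<in>?S. \<bar>H v - g v\<bar> < \<epsilon>"
      using exp_span_dense[OF compS contH \<epsilon>] by blast
    have "sphere_integral (Suc k) o' p (\<lambda>v. g (h *v v)) = sphere_integral (Suc k) o' p g"
      by (rule sphere_integral_exp_span_invariant[OF Suc.prems(1,2) g(1)])
    then have "\<bar>?L - ?R\<bar> \<le> 2 * (\<epsilon> * m)"
      using approx[OF hT g] approx[OF oneT g] by simp
    also have "\<dots> \<le> 2 * (\<epsilon> * (m + 1))" using \<epsilon> by simp
    also have "\<dots> = \<bar>?L - ?R\<bar> / 2"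
      unfolding \<epsilon>_def using m by (simp add: field_simps)
    finally show False using pos by simp
  qed
  have "euler_integral C (Suc k) o' p (\<lambda>A. F (h ** A)) = c * ?L"
    unfolding euler_integral_Suc[OF Suc.prems(1) contFA[of h]] c_def G_def
    by (simp add: matrix_mul_assoc mult.assoc)
  also have "\<dots> = c * ?R" unfolding eq ..
  also have "\<dots> = euler_integral C (Suc k) o' p F"
    unfolding euler_integral_Suc[OF Suc.prems(1,3)] c_def G_def by (simp add: mult.assoc)
  finally show ?case .
qed

text \<open>The total mass is a product of sphere areas, which are the moments of order 0, and of
  the constants of the weight. Being nonzero, it can be cancelled when vanishing is carried back to
  the Haar integral.\<close>

lemma euler_integral_one_pos:
  assumes "Suc k \<le> CARD('n)" "\<And>M. 2 \<le> M \<Longrightarrow> 0 < C M"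
  shows "0 < euler_integral C k o' p (\<lambda>_. 1 :: real)"
  using assms(1)
proof (induction k arbitrary: o' p)
  case 0
  show ?case using integral_param_measure_empty[of "1 :: real"] by (simp add: euler_integral_def)
next
  case (Suc k)
  have "complex_of_real (sphere_integral (Suc k) o' p (\<lambda>_. 1)) = complex_of_real (sphere_moment (Suc k) 0)"
    using sphere_integral_moment[OF Suc.prems, of o' p 0 0 0] by (simp flip: sphere_integral_of_real)
  then have s: "sphere_integral (Suc k) o' p (\<lambda>_. 1) = sphere_moment (Suc k) 0" by (simp only: of_real_eq_iff)
  have "euler_integral C (Suc k) o' p (\<lambda>_. 1 :: real) = 2 ^ Suc k * C (Suc (Suc k)) *
     sphere_integral (Suc k) o' p (\<lambda>_. 1) * euler_integral C k (o' + Suc k) (p + Suc (Suc k)) (\<lambda>_. 1)"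
    unfolding euler_integral_Suc[OF Suc.prems continuous_on_const] sphere_integral_def
    by (simp add: mult_ac)
  also have "\<dots> > 0"
    using Suc assms(2)[of "Suc (Suc k)"] unfolding s by (simp add: sphere_moment_def)
  finally show ?case .
qed

end

subsection \<open>Entries of representations are polynomial\<close>

text \<open>Unitary matrices of size N have squared norm N, so on the group this is 4N minus the
  squared distance: nonnegative, since distances are at most 2 sqrt(N), and largest exactly at
  \<open>h = g\<close>. Unlike a cut-off function it is polynomial.\<close>

definition bump :: "complex ^ 'n ^ 'n \<Rightarrow> complex ^ 'n ^ 'n \<Rightarrow> real" where
  "bump g h = 2 * real CARD('n) + 2 * (g \<bullet> h)"

lemma bump_eq:
  fixes g h :: "complex ^ 'n ^ 'n"
  assumes "g \<in> SU" "h \<in> SU" shows "bump g h = 4 * real CARD('n) - (dist g h)\<^sup>2"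
proof -
  have "g \<bullet> g = real CARD('n)" "h \<bullet> h = real CARD('n)"
    using norm_unitary[OF SU_unitary[OF assms(1)]] norm_unitary[OF SU_unitary[OF assms(2)]]
    by (simp_all flip: power2_norm_eq_inner)
  then show ?thesis
    by (simp add: bump_def dist_norm power2_norm_eq_inner inner_diff inner_commute algebra_simps)
qed

lemma bump_nonneg:
  fixes g h :: "complex ^ 'n ^ 'n"
  assumes "g \<in> SU" "h \<in> SU" shows "0 \<le> bump g h"
proof -
  have "dist g h \<le> norm g + norm h" by norm
  then have "dist g h \<le> 2 * sqrt (real CARD('n))"
    using norm_unitary[OF SU_unitary[OF assms(1)]] norm_unitary[OF SU_unitary[OF assms(2)]] by simp
  then have "(dist g h)\<^sup>2 \<le> (2 * sqrt (real CARD('n)))\<^sup>2" by (intro power_mono) auto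
  then show ?thesis by (simp add: bump_eq[OF assms] power_mult_distrib)
qed

lemma continuous_on_bump: "continuous_on S (bump g)"
  unfolding bump_def by (intro continuous_intros)

lemma bump_mult: "g \<in> SU \<Longrightarrow> bump g (g ** h) = bump (mat 1) h"
  using inner_unitary_mult[OF SU_unitary, of g "mat 1" h]
  by (simp add: bump_def)

section \<open>Haar measure and the concentration of powers of the bump\<close>

context
  fixes \<mu> :: "(complex ^ 'n ^ 'n) measure"
  assumes haar: "haar_measure SU \<mu>"
begin

lemma sets_haar: "sets \<mu> = sets (restrict_space borel SU)"
  using haar by (simp add: haar_measure_def)

lemma space_haar: "space \<mu> = SU"
  using sets_eq_imp_space_eq[OF sets_haar] by (simp add: space_restrict_space)

lemma finite_haar: "finite_measure \<mu>"
  using haar by (intro finite_measureI) (simp add: space_haar haar_measure_def)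

lemma measure_haar: "measure \<mu> SU = 1"
  using haar by (simp add: haar_measure_def measure_def)

lemma measurable_haar_continuous:
  fixes f :: "complex ^ 'n ^ 'n \<Rightarrow> 'b::topological_space"
  assumes "continuous_on SU f" shows "f \<in> borel_measurable \<mu>"
  using borel_measurable_continuous_on_restrict[OF assms]
  by (simp cong: measurable_cong_sets add: measurable_cong_sets[OF sets_haar refl])

lemma integrable_haar_continuous:
  fixes f :: "complex ^ 'n ^ 'n \<Rightarrow> 'b::{banach, second_countable_topology}"
  assumes "continuous_on SU f" shows "integrable \<mu> f"
proof -
  from compact_imp_bounded[OF compact_continuous_image[OF assms compact_SU]]
  obtain B where "\<forall>y\<in>f ` SU. norm y \<le> B" unfolding bounded_iff ..
  then show ?thesis
    by (intro finite_measure.integrable_bounded[OF finite_haar measurable_haar_continuous[OF assms], of B])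
       (simp add: space_haar)
qed

lemma measurable_haar_mult:
  assumes "g \<in> SU" shows "(\<lambda>h. g ** h) \<in> measurable \<mu> \<mu>"
proof -
  have "(\<lambda>h :: complex ^ 'n ^ 'n. g ** h) \<in> borel_measurable \<mu>"
    by (intro measurable_haar_continuous continuous_on_matrix_mult continuous_on_const continuous_on_id)
  then have "(\<lambda>h. g ** h) \<in> measurable \<mu> (restrict_space borel SU)"
    using assms by (intro measurable_restrict_space2) (auto simp: space_haar SU_mult)
  then show ?thesis by (simp add: measurable_cong_sets[OF refl sets_haar])
qed

lemma integral_haar_mult:
  fixes f :: "complex ^ 'n ^ 'n \<Rightarrow> 'b::{banach, second_countable_topology}"
  assumes "g \<in> SU" "continuous_on SU f"
  shows "(LINT h|\<mu>. f (g ** h)) = integral\<^sup>L \<mu> f"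
proof -
  have "distr \<mu> \<mu> (\<lambda>h. g ** h) = \<mu>" using haar assms(1) by (simp add: haar_measure_def)
  then show ?thesis
    using integral_distr[OF measurable_haar_mult[OF assms(1)] measurable_haar_continuous[OF assms(2)]] by simp
qed

text \<open>By compactness finitely many translates of the ball cover the group, and invariance
  gives them all the same measure, which cannot be 0.\<close>

lemma measure_haar_ball:
  assumes "0 < r" shows "0 < measure \<mu> (SU \<inter> ball (mat 1) r)"
proof -
  interpret finite_measure \<mu> by (rule finite_haar)
  have ball: "SU \<inter> ball g r \<in> sets \<mu>" for g
    unfolding sets_haar sets_restrict_space by auto
  have eq: "measure \<mu> (SU \<inter> ball g r) = measure \<mu> (SU \<inter> ball (mat 1) r)" if g: "g \<in> SU" for g
  proof -
    have "distr \<mu> \<mu> (\<lambda>h. g ** h) = \<mu>" using haar g by (simp add: haar_measure_def)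
    then have "measure \<mu> (SU \<inter> ball g r) = measure (distr \<mu> \<mu> (\<lambda>h. g ** h)) (SU \<inter> ball g r)" by simp
    also have "\<dots> = measure \<mu> ((\<lambda>h. g ** h) -` (SU \<inter> ball g r) \<inter> space \<mu>)"
      by (rule measure_distr[OF measurable_haar_mult[OF g] ball])
    also have "(\<lambda>h. g ** h) -` (SU \<inter> ball g r) \<inter> space \<mu> = SU \<inter> ball (mat 1) r"
      using g dist_unitary_mult[OF SU_unitary[OF g], of "mat 1"]
      by (auto simp: space_haar SU_mult)
    finally show ?thesis .
  qed
  have "(SU :: (complex ^ 'n ^ 'n) set) \<subseteq> (\<Union>g\<in>SU. ball g r)" using assms by auto
  then obtain D :: "(complex ^ 'n ^ 'n) set" where D: "D \<subseteq> SU" "finite D" "SU \<subseteq> (\<Union>g\<in>D. ball g r)"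
    using compactE_image[OF compact_SU, of SU "\<lambda>g. ball g r"] by auto
  have "1 = measure \<mu> SU" by (simp add: measure_haar)
  also have "\<dots> \<le> measure \<mu> (\<Union>g\<in>D. SU \<inter> ball g r)"
    using D ball by (intro finite_measure_mono sets.finite_UN) blast+
  also have "\<dots> \<le> (\<Sum>g\<in>D. measure \<mu> (SU \<inter> ball g r))"
    using D ball by (intro finite_measure_subadditive_finite) auto
  also have "\<dots> = (\<Sum>g\<in>D. measure \<mu> (SU \<inter> ball (mat 1) r))"
    using D eq by (intro sum.cong) auto
  finally have "measure \<mu> (SU \<inter> ball (mat 1) r) \<noteq> 0" by auto
  then show ?thesis by (simp add: zero_less_measure_iff)
qed

text \<open>A Laplace argument. Outside the \<open>\<delta>\<close>-ball the bump is at most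
  \<open>s\<close>; on the ball of half the radius, which has positive measure, it is at least
  \<open>t > s\<close>. Relative to the total mass of the n-th power, the outer part is therefore of
  order (s / t)^n.\<close>

lemma bump_concentrates:
  fixes \<phi> :: "complex ^ 'n ^ 'n \<Rightarrow> complex"
  assumes "continuous_on SU \<phi>"
  shows "(\<lambda>n. (LINT h|\<mu>. \<phi> h * complex_of_real (bump (mat 1) h ^ n))
      / complex_of_real (LINT h|\<mu>. bump (mat 1) h ^ n))
    \<longlonglongrightarrow> \<phi> (mat 1)"
proof (rule metric_LIMSEQ_I)
  let ?E = "mat 1 :: complex ^ 'n ^ 'n"
  let ?N = "real CARD('n)"
  let ?b = "bump ?E"
  define c where "c n = (LINT h|\<mu>. ?b h ^ n)" for n
  interpret finite_measure \<mu> by (rule finite_haar)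
  fix \<epsilon> :: real assume \<epsilon>: "0 < \<epsilon>"
  from compact_imp_bounded[OF compact_continuous_image[OF assms compact_SU]]
  obtain B where "\<forall>y\<in>\<phi> ` SU. norm y \<le> B" unfolding bounded_iff ..
  then have B: "norm (\<phi> h) \<le> B" if "h \<in> SU" for h using that by blast
  have B0: "0 \<le> B" using B[OF mat_1_SU] norm_ge_zero order_trans by blast
  obtain \<delta>0 where \<delta>0: "0 < \<delta>0" "\<And>h. h \<in> SU \<Longrightarrow> dist h ?E < \<delta>0 \<Longrightarrow> dist (\<phi> h) (\<phi> ?E) < \<epsilon> / 2"
    using assms mat_1_SU \<epsilon> unfolding continuous_on_iff by (metis half_gt_zero)
  \<comment> \<open>Capping the radius at 1 makes \<open>s\<close> positive, since 4N exceeds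
    1.\<close>
  define \<delta> where "\<delta> = min \<delta>0 1"
  have \<delta>: "0 < \<delta>" "\<delta> \<le> 1" "\<And>h. h \<in> SU \<Longrightarrow> dist h ?E < \<delta> \<Longrightarrow> dist (\<phi> h) (\<phi> ?E) < \<epsilon> / 2"
    using \<delta>0 by (auto simp: \<delta>_def)
  define s t where "s = 4 * ?N - \<delta>\<^sup>2" and "t = 4 * ?N - (\<delta> / 2)\<^sup>2"
  have N1: "1 \<le> ?N" by (simp add: Suc_le_eq)
  have d2: "\<delta>\<^sup>2 \<le> 1" using \<delta> by (simp add: power_le_one)
  have s0: "0 < s" unfolding s_def using N1 d2 by linarith
  have st: "s < t" using \<delta> by (simp add: s_def t_def power_divide)
  define m where "m = measure \<mu> (SU \<inter> ball ?E (\<delta> / 2))"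
  have m: "0 < m" unfolding m_def using \<delta> by (intro measure_haar_ball) simp
  have ball: "SU \<inter> ball ?E r \<in> sets \<mu>" for r
    unfolding sets_haar sets_restrict_space by auto
  have ib: "integrable \<mu> (\<lambda>h. ?b h ^ n)" for n
    by (intro integrable_haar_continuous continuous_on_power continuous_on_bump)
  have i\<phi>: "integrable \<mu> (\<lambda>h. \<phi> h * complex_of_real (?b h ^ n))" for n
    by (intro integrable_haar_continuous continuous_on_mult assms continuous_on_of_real continuous_on_power continuous_on_bump)
  have cpos: "t ^ n * m \<le> c n" for n
  proof -
    have "t ^ n * m = (LINT h|\<mu>. t ^ n * indicator (SU \<inter> ball ?E (\<delta> / 2)) h)"
      using ball by (simp add: m_def)
    also have "\<dots> \<le> c n" unfolding c_def
    proof (rule integral_mono)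
      show "integrable \<mu> (\<lambda>h. t ^ n * indicator (SU \<inter> ball ?E (\<delta> / 2)) h)"
        using ball by (intro integrable_mult_right integrable_real_indicator) (auto simp: less_top[symmetric])
      fix h assume "h \<in> space \<mu>"
      then have h: "h \<in> SU" by (simp add: space_haar)
      show "t ^ n * indicator (SU \<inter> ball ?E (\<delta> / 2)) h \<le> ?b h ^ n"
      proof (cases "h \<in> ball ?E (\<delta> / 2)")
        case True
        then have "(dist ?E h)\<^sup>2 \<le> (\<delta> / 2)\<^sup>2" by (intro power_mono) auto
        then have "t \<le> ?b h" by (simp add: bump_eq[OF mat_1_SU h] t_def)
        then show ?thesis using True h s0 st by (simp add: power_mono)
      next
        case False
        then show ?thesis using bump_nonneg[OF mat_1_SU h] by simp
      qed
    qed (rule ib)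
    finally show ?thesis .
  qed
  have t0: "0 < t" using s0 st by simp
  have c0: "0 < c n" for n using cpos[of n] t0 m by (meson less_le_trans mult_pos_pos zero_less_power)
  have main: "dist ((LINT h|\<mu>. \<phi> h * complex_of_real (?b h ^ n)) / complex_of_real (c n)) (\<phi> ?E)
     \<le> \<epsilon> / 2 + (2 * B / m) * (s / t) ^ n" for n
  proof -
    have "(LINT h|\<mu>. (\<phi> h - \<phi> ?E) * complex_of_real (?b h ^ n))
       = (LINT h|\<mu>. \<phi> h * complex_of_real (?b h ^ n)) - \<phi> ?E * complex_of_real (c n)"
    proof -
      have "integrable \<mu> (\<lambda>h. \<phi> ?E * complex_of_real (?b h ^ n))"
        by (intro integrable_haar_continuous continuous_on_mult continuous_on_const continuous_on_of_real
            continuous_on_power continuous_on_bump)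
      then have "(LINT h|\<mu>. \<phi> h * complex_of_real (?b h ^ n) - \<phi> ?E * complex_of_real (?b h ^ n))
        = (LINT h|\<mu>. \<phi> h * complex_of_real (?b h ^ n)) - (LINT h|\<mu>. \<phi> ?E * complex_of_real (?b h ^ n))"
        by (rule Bochner_Integration.integral_diff[OF i\<phi>])
      also have "(LINT h|\<mu>. \<phi> ?E * complex_of_real (?b h ^ n)) = \<phi> ?E * complex_of_real (c n)"
        unfolding integral_mult_right_zero c_def integral_complex_of_real ..
      finally show ?thesis by (simp only: left_diff_distrib)
    qed
    then have "(LINT h|\<mu>. \<phi> h * complex_of_real (?b h ^ n)) / complex_of_real (c n) - \<phi> ?E
       = (LINT h|\<mu>. (\<phi> h - \<phi> ?E) * complex_of_real (?b h ^ n)) / complex_of_real (c n)"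
      using c0[of n] by (simp add: field_simps)
    then have "dist ((LINT h|\<mu>. \<phi> h * complex_of_real (?b h ^ n)) / complex_of_real (c n)) (\<phi> ?E)
      = norm (LINT h|\<mu>. (\<phi> h - \<phi> ?E) * complex_of_real (?b h ^ n)) / c n"
      using c0[of n] by (simp add: dist_norm norm_divide)
    also have "\<dots> \<le> (\<epsilon> / 2 * c n + 2 * B * s ^ n) / c n"
    proof (rule divide_right_mono)
      have "norm (LINT h|\<mu>. (\<phi> h - \<phi> ?E) * complex_of_real (?b h ^ n))
         \<le> (LINT h|\<mu>. norm ((\<phi> h - \<phi> ?E) * complex_of_real (?b h ^ n)))"
        by (rule integral_norm_bound)
      also have "\<dots> \<le> (LINT h|\<mu>. \<epsilon> / 2 * ?b h ^ n + 2 * B * s ^ n)"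
      proof (rule integral_mono)
        show "integrable \<mu> (\<lambda>h. norm ((\<phi> h - \<phi> ?E) * complex_of_real (?b h ^ n)))"
          by (intro integrable_norm integrable_haar_continuous continuous_on_mult continuous_on_diff assms
             continuous_on_of_real continuous_on_power continuous_on_bump continuous_on_const)
        show "integrable \<mu> (\<lambda>h. \<epsilon> / 2 * ?b h ^ n + 2 * B * s ^ n)"
          using ib by simp
        fix h assume "h \<in> space \<mu>"
        then have h: "h \<in> SU" by (simp add: space_haar)
        have b0: "0 \<le> ?b h" by (rule bump_nonneg[OF mat_1_SU h])
        have n: "norm ((\<phi> h - \<phi> ?E) * complex_of_real (?b h ^ n)) = dist (\<phi> h) (\<phi> ?E) * ?b h ^ n"
          using b0 by (simp add: norm_mult dist_norm norm_power)
        show "norm ((\<phi> h - \<phi> ?E) * complex_of_real (?b h ^ n)) \<le> \<epsilon> / 2 * ?b h ^ n + 2 * B * s ^ n"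
        proof (cases "dist h ?E < \<delta>")
          case True
          have "dist (\<phi> h) (\<phi> ?E) * ?b h ^ n \<le> \<epsilon> / 2 * ?b h ^ n"
            using \<delta>(3)[OF h True] b0 by (intro mult_right_mono) auto
          moreover have "0 \<le> 2 * B * s ^ n" using B0 s0 by simp
          ultimately show ?thesis unfolding n by linarith
        next
          case False
          then have "\<delta>\<^sup>2 \<le> (dist ?E h)\<^sup>2" using \<delta> by (intro power_mono) (auto simp: dist_commute)
          then have "?b h \<le> s" by (simp add: bump_eq[OF mat_1_SU h] s_def)
          moreover have "dist (\<phi> h) (\<phi> ?E) \<le> 2 * B"
            using B[OF h] B[OF mat_1_SU] norm_triangle_ineq4[of "\<phi> h" "\<phi> ?E"] by (simp add: dist_norm)
          ultimately have "dist (\<phi> h) (\<phi> ?E) * ?b h ^ n \<le> 2 * B * s ^ n"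
            using b0 B0 by (intro mult_mono power_mono) auto
          moreover have "0 \<le> \<epsilon> / 2 * ?b h ^ n" using \<epsilon> b0 by simp
          ultimately show ?thesis unfolding n by linarith
        qed
      qed
      also have "\<dots> = \<epsilon> / 2 * c n + 2 * B * s ^ n"
      proof -
        have "(LINT h|\<mu>. \<epsilon> / 2 * ?b h ^ n + 2 * B * s ^ n) = (LINT h|\<mu>. \<epsilon> / 2 * ?b h ^ n) + (LINT h|\<mu>. 2 * B * s ^ n)"
          by (rule Bochner_Integration.integral_add) (use ib in simp_all)
        then show ?thesis by (simp add: c_def space_haar measure_haar)
      qed
      finally show "norm (LINT h|\<mu>. (\<phi> h - \<phi> ?E) * complex_of_real (?b h ^ n)) \<le> \<epsilon> / 2 * c n + 2 * B * s ^ n" .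
    qed (use c0[of n] in simp)
    also have "\<dots> = \<epsilon> / 2 + 2 * B * s ^ n / c n" using c0[of n] by (simp add: field_simps)
    also have "2 * B * s ^ n / c n \<le> 2 * B * s ^ n / (t ^ n * m)"
      using cpos[of n] B0 s0 t0 m c0[of n] by (intro divide_left_mono mult_pos_pos) auto
    also have "2 * B * s ^ n / (t ^ n * m) = (2 * B / m) * (s / t) ^ n"
      by (simp add: power_divide)
    finally show ?thesis by simp
  qed
  have "(\<lambda>n. (2 * B / m) * (s / t) ^ n) \<longlonglongrightarrow> (2 * B / m) * 0"
    using s0 st t0 by (intro tendsto_mult tendsto_const LIMSEQ_power_zero) (simp add: abs_divide)
  then have "\<forall>\<^sub>F n in sequentially. (2 * B / m) * (s / t) ^ n < \<epsilon> / 2"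
    using \<epsilon> by (intro order_tendstoD(2)) auto
  then obtain n0 where n0: "\<And>n. n \<ge> n0 \<Longrightarrow> (2 * B / m) * (s / t) ^ n < \<epsilon> / 2"
    unfolding eventually_sequentially by blast
  show "\<exists>n0. \<forall>n\<ge>n0. dist ((LINT h|\<mu>. \<phi> h * complex_of_real (?b h ^ n)) / complex_of_real (LINT h|\<mu>. ?b h ^ n)) (\<phi> ?E) < \<epsilon>"
  proof (intro exI[of _ n0] allI impI)
    fix n assume "n0 \<le> n"
    from main[of n] n0[OF this]
    show "dist ((LINT h|\<mu>. \<phi> h * complex_of_real (?b h ^ n)) / complex_of_real (LINT h|\<mu>. ?b h ^ n)) (\<phi> ?E) < \<epsilon>"
      unfolding c_def by linarith
  qed
qed

end

text \<open>Kernels of finite rank: integrating out \<open>h\<close> replaces each continuous factor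
  by a constant and leaves a polynomial in \<open>g\<close>. Powers of the bump are of this
  kind.\<close>

inductive_set separable :: "(complex ^ 'n ^ 'n \<Rightarrow> complex ^ 'n ^ 'n \<Rightarrow> complex) set" where
  prod: "p \<in> entry_poly \<Longrightarrow> continuous_on UNIV a \<Longrightarrow> (\<lambda>g h. p g * a h) \<in> separable"
| add: "u \<in> separable \<Longrightarrow> v \<in> separable \<Longrightarrow> (\<lambda>g h. u g h + v g h) \<in> separable"

lemma separable_mult:
  assumes "u \<in> separable" "v \<in> separable"
  shows "(\<lambda>g h. u g h * v g h) \<in> separable"
  using assms(1)
proof induction
  case (prod p a)
  show ?case
    using assms(2)
  proof induction
    case (prod q b)
    then have "(\<lambda>g h. (p g * q g) * (a h * b h)) \<in> separable"
      using \<open>p \<in> entry_poly\<close> \<open>continuous_on UNIV a\<close>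
      by (intro separable.prod entry_poly.mult continuous_on_mult)
    then show ?case by (simp add: mult_ac)
  next
    case (add u v)
    then show ?case using separable.add[OF add.IH] by (simp add: distrib_left)
  qed
next
  case (add u v)
  then show ?case using separable.add[OF add.IH] by (simp add: distrib_right)
qed

lemma separable_power: "u \<in> separable \<Longrightarrow> (\<lambda>g h. u g h ^ n) \<in> separable"
proof (induction n)
  case 0
  show ?case using separable.prod[OF entry_poly.const[of 1] continuous_on_const[of UNIV 1]] by simp
next
  case (Suc n)
  then show ?case using separable_mult[of u "\<lambda>g h. u g h ^ n"] by simp
qed

lemma separable_sum:
  "(\<And>i. i \<in> I \<Longrightarrow> u i \<in> separable) \<Longrightarrow> (\<lambda>g h. \<Sum>i\<in>I. u i g h) \<in> separable"
proof (induction I rule: infinite_finite_induct)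
  case (insert x F)
  then have "(\<lambda>g h. u x g h + (\<Sum>i\<in>F. u i g h)) \<in> separable"
    by (intro separable.add) auto
  then show ?case using insert by simp
qed (use separable.prod[OF entry_poly.const[of 0] continuous_on_const[of UNIV 0]] in simp_all)

lemma continuous_on_separable: "u \<in> separable \<Longrightarrow> continuous_on S (u g)"
proof (induction rule: separable.induct)
  case (prod p a)
  then show ?case by (intro continuous_intros continuous_on_subset[OF prod(2)]) auto
qed (auto intro: continuous_on_add)

lemma bump_separable: "(\<lambda>g h. complex_of_real (bump g h)) \<in> (separable :: (complex ^ 'n ^ 'n \<Rightarrow> _) set)"
proof -
  have e1: "(\<lambda>g h. g $ i $ j * cnj (h $ i $ j)) \<in> separable" for i j :: 'n
    by (intro separable.prod entry_poly.entry continuous_intros)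
  have e2: "(\<lambda>g h. cnj (g $ i $ j) * h $ i $ j) \<in> separable" for i j :: 'n
    by (intro separable.prod entry_poly.cnj_entry continuous_intros)
  have "(\<lambda>g h. 2 * of_nat CARD('n) * 1 + (\<Sum>i\<in>UNIV. \<Sum>j\<in>UNIV. g $ i $ j * cnj (h $ i $ j) + cnj (g $ i $ j) * h $ i $ j))
     \<in> (separable :: (complex ^ 'n ^ 'n \<Rightarrow> _) set)"
    by (intro separable.add[OF separable.prod[OF entry_poly.const continuous_on_const]] separable_sum separable.add e1 e2)
  moreover have "complex_of_real (bump g h) = 2 * of_nat CARD('n) * 1 +
     (\<Sum>i\<in>UNIV. \<Sum>j\<in>UNIV. g $ i $ j * cnj (h $ i $ j) + cnj (g $ i $ j) * h $ i $ j)" for g h :: "complex ^ 'n ^ 'n"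
  proof -
    have "z * cnj w + cnj z * w = complex_of_real (2 * (z \<bullet> w))" for z w
      by (simp add: complex_eq_iff inner_complex_def)
    then show ?thesis by (simp add: bump_def inner_vec_def sum_distrib_left)
  qed
  ultimately show ?thesis by simp
qed

lemma integral_separable_entry_poly:
  assumes "haar_measure SU \<mu>" "u \<in> separable" "continuous_on SU \<phi>"
  shows "(\<lambda>g. LINT h|\<mu>. \<phi> h * u g h) \<in> entry_poly"
  using assms(2)
proof induction
  case (prod p a)
  have "(\<lambda>g. p g * (LINT h|\<mu>. \<phi> h * a h)) \<in> entry_poly"
    by (intro entry_poly.mult entry_poly.const prod)
  moreover have "(LINT h|\<mu>. \<phi> h * (p g * a h)) = p g * (LINT h|\<mu>. \<phi> h * a h)" for g
    by (subst integral_mult_right_zero[symmetric]) (simp add: mult_ac)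
  ultimately show ?case by simp
next
  case (add u v)
  have int: "integrable \<mu> (\<lambda>h. \<phi> h * u g h)" if "u \<in> separable" for u g
    by (intro integrable_haar_continuous[OF assms(1)] continuous_on_mult assms(3) continuous_on_separable[OF that])
  have "(LINT h|\<mu>. \<phi> h * (u g h + v g h)) = (LINT h|\<mu>. \<phi> h * u g h) + (LINT h|\<mu>. \<phi> h * v g h)" for g
    unfolding distrib_left by (rule Bochner_Integration.integral_add[OF int[OF add.hyps(1)] int[OF add.hyps(2)]])
  then show ?case using entry_poly.add[OF add.IH] by simp
qed

text \<open>By the Leibniz formula the determinant is a polynomial in the entries. This turns
  entrywise convergence to the identity matrix into invertibility of a late member of the
  sequence.\<close>

lemma det_mat_tendsto:
  fixes a :: "nat \<Rightarrow> nat \<Rightarrow> nat \<Rightarrow> complex"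
  assumes "\<And>i j. i < d \<Longrightarrow> j < d \<Longrightarrow> (\<lambda>n. a n i j) \<longlonglongrightarrow> b i j"
  shows "(\<lambda>n. Determinant.det (Matrix.mat d d (\<lambda>(i, j). a n i j))) \<longlonglongrightarrow> Determinant.det (Matrix.mat d d (\<lambda>(i, j). b i j))"
proof -
  have det: "Determinant.det (Matrix.mat d d (\<lambda>(i, j). c i j))
     = (\<Sum>p | p permutes {0..<d}. signof p * (\<Prod>i = 0..<d. c i (p i)))" for c :: "nat \<Rightarrow> nat \<Rightarrow> complex"
  proof -
    have "Matrix.mat d d (\<lambda>(i, j). c i j) $$ (i, p i) = c i (p i)" if "p permutes {0..<d}" "i \<in> {0..<d}" for p i
      using that permutes_in_image[OF that(1), of i] by simp
    then show ?thesis
      by (subst Determinant.det_def'[of _ d]) (auto intro!: sum.cong prod.cong)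
  qed
  show ?thesis
    unfolding det
  proof (intro tendsto_sum tendsto_mult tendsto_const tendsto_prod assms)
    fix p i assume "p \<in> {p. p permutes {0..<d}}" "i \<in> {0..<d}"
    then show "i < d" "p i < d" using permutes_in_image[of p "{0..<d}" i] by auto
  qed
qed

text \<open>The matrix \<open>A\<close> of integrals of the representation against a polynomial bump at the identity
  is invertible, and invariance makes the entries of \<open>\<rho>(g) A\<close> polynomial in those of \<open>g\<close>.\<close>

lemma representation_entry_poly:
  fixes \<rho> :: "complex ^ 'n ^ 'n \<Rightarrow> complex mat"
  assumes \<mu>: "haar_measure (SU :: (complex ^ 'n ^ 'n) set) \<mu>" and \<rho>: "matrix_representation SU d \<rho>" and ij: "i < d" "j < d"
  obtains p where "p \<in> entry_poly" "\<And>g. g \<in> SU \<Longrightarrow> \<rho> g $$ (i, j) = p g"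
proof -
  let ?E = "mat 1 :: complex ^ 'n ^ 'n"
  have car: "\<rho> g \<in> carrier_mat d d" if "g \<in> SU" for g
    using \<rho> that by (simp add: matrix_representation_def)
  have one: "\<rho> ?E = 1\<^sub>m d" using \<rho> by (simp add: matrix_representation_def)
  have mult: "\<rho> (g ** h) = \<rho> g * \<rho> h" if "g \<in> SU" "h \<in> SU" for g h
    using \<rho> that by (simp add: matrix_representation_def)
  have cont: "continuous_on SU (\<lambda>g. \<rho> g $$ (k, l))" if "k < d" "l < d" for k l
    using \<rho> that by (simp add: matrix_representation_def)
  define b where "b g h n = complex_of_real (bump g h ^ n)" for g h :: "complex ^ 'n ^ 'n" and n
  define c where "c n = complex_of_real (LINT h|\<mu>. bump ?E h ^ n)" for n
  define A where "A n k l = (LINT h|\<mu>. \<rho> h $$ (k, l) * b ?E h n) / c n" for n k l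
  have contb: "continuous_on S (\<lambda>h. b g h n)" for S g n
    unfolding b_def by (intro continuous_on_of_real continuous_on_power continuous_on_bump)
  have "(\<lambda>n. A n k l) \<longlonglongrightarrow> (if k = l then 1 else 0)" if "k < d" "l < d" for k l
  proof -
    have "(\<lambda>n. A n k l) \<longlonglongrightarrow> \<rho> ?E $$ (k, l)"
      unfolding A_def b_def c_def by (rule bump_concentrates[OF \<mu> cont[OF that]])
    then show ?thesis using that by (simp add: one)
  qed
  \<comment> \<open>The averages tend to the representation at the identity element, so their
    determinants tend to 1. One exponent \<open>n\<close> with a nonzero determinant is enough and
    is fixed afterwards.\<close>
  then have "(\<lambda>n. Determinant.det (Matrix.mat d d (\<lambda>(i, j). A n i j))) \<longlonglongrightarrow> Determinant.det (Matrix.mat d d (\<lambda>(i, j). if i = j then 1 else 0))"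
    by (rule det_mat_tendsto)
  moreover have "Matrix.mat d d (\<lambda>(i, j). if i = j then 1 else 0) = (1\<^sub>m d :: complex mat)"
    by (rule eq_matI) auto
  ultimately have "(\<lambda>n. Determinant.det (Matrix.mat d d (\<lambda>(i, j). A n i j))) \<longlonglongrightarrow> 1" by simp
  then have "\<forall>\<^sub>F n in sequentially. Determinant.det (Matrix.mat d d (\<lambda>(i, j). A n i j)) \<noteq> 0"
    by (rule tendsto_imp_eventually_ne) simp
  then obtain n where n: "Determinant.det (Matrix.mat d d (\<lambda>(i, j). A n i j)) \<noteq> 0"
    unfolding eventually_sequentially by blast
  define AA where "AA = Matrix.mat d d (\<lambda>(i, j). A n i j)"
  have AA: "AA \<in> carrier_mat d d" by (simp add: AA_def)
  from det_non_zero_imp_unit[OF AA n[folded AA_def], of "()"]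
  obtain D where D: "D \<in> carrier_mat d d" "AA * D = 1\<^sub>m d"
    by (auto simp: Units_def ring_mat_def)
  define Q where "Q l g = (LINT h|\<mu>. \<rho> h $$ (i, l) * b g h n)" for l g
  have Q: "Q l \<in> entry_poly" if "l < d" for l
    unfolding Q_def b_def of_real_power
    by (rule integral_separable_entry_poly[OF \<mu> separable_power[OF bump_separable] cont[OF ij(1) that]])
  have QA: "Q l g / c n = (\<rho> g * AA) $$ (i, l)" if g: "g \<in> SU" and l: "l < d" for g l
  proof -
    \<comment> \<open>Substituting \<open>g ** h\<close> for \<open>h\<close> moves the centre of
      the bump from \<open>g\<close> to the identity, and multiplicativity takes
      \<open>\<rho> g\<close> out of the integral.\<close>
    have "Q l g = (LINT h|\<mu>. \<rho> (g ** h) $$ (i, l) * b g (g ** h) n)"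
      unfolding Q_def
      by (rule integral_haar_mult[OF \<mu> g, symmetric, where f = "\<lambda>h. \<rho> h $$ (i, l) * b g h n"])
         (intro continuous_on_mult cont ij l contb)
    also have "\<dots> = (LINT h|\<mu>. (\<Sum>k = 0..<d. \<rho> g $$ (i, k) * (\<rho> h $$ (k, l) * b ?E h n)))"
    proof (rule lebesgue_integral_cong)
      fix h assume "h \<in> space \<mu>"
      then have h: "h \<in> SU" by (simp add: space_haar[OF \<mu>])
      have "\<rho> (g ** h) $$ (i, l) = (\<Sum>k = 0..<d. \<rho> g $$ (i, k) * \<rho> h $$ (k, l))"
        using car[OF g] car[OF h] ij l by (simp add: mult[OF g h] scalar_prod_def)
      then show "\<rho> (g ** h) $$ (i, l) * b g (g ** h) n = (\<Sum>k = 0..<d. \<rho> g $$ (i, k) * (\<rho> h $$ (k, l) * b ?E h n))"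
        unfolding b_def bump_mult[OF g] by (simp only: sum_distrib_right mult.assoc)
    qed
    also have "\<dots> = (\<Sum>k = 0..<d. \<rho> g $$ (i, k) * (LINT h|\<mu>. \<rho> h $$ (k, l) * b ?E h n))"
    proof -
      have "integrable \<mu> (\<lambda>h. \<rho> h $$ (k, l) * b ?E h n)" if "k < d" for k
        by (intro integrable_haar_continuous[OF \<mu>] continuous_on_mult cont that l contb)
      then show ?thesis by (subst Bochner_Integration.integral_sum) auto
    qed
    finally have "Q l g / c n = (\<Sum>k = 0..<d. \<rho> g $$ (i, k) * A n k l)"
      by (simp add: A_def sum_divide_distrib)
    also have "\<dots> = (\<rho> g * AA) $$ (i, l)"
      using car[OF g] ij l by (simp add: AA_def scalar_prod_def)
    finally show ?thesis .
  qed
  have "(\<lambda>g. \<Sum>l = 0..<d. Q l g * (D $$ (l, j) / c n)) \<in> entry_poly"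
    by (intro entry_poly_sum entry_poly.mult Q entry_poly.const) simp
  moreover have "\<rho> g $$ (i, j) = (\<Sum>l = 0..<d. Q l g * (D $$ (l, j) / c n))" if g: "g \<in> SU" for g
  proof -
    \<comment> \<open>Cancelling \<open>AA\<close> by its right inverse expresses
      \<open>\<rho> g\<close> through \<open>\<rho> g * AA\<close>, whose entries are the
      polynomials \<open>Q\<close> up to the constant \<open>c n\<close>.\<close>
    have "\<rho> g = \<rho> g * (AA * D)" using car[OF g] by (simp add: D(2))
    also have "\<dots> = (\<rho> g * AA) * D" by (rule assoc_mult_mat[symmetric, OF car[OF g] AA D(1)])
    finally have "\<rho> g $$ (i, j) = ((\<rho> g * AA) * D) $$ (i, j)" by simp
    also have "\<dots> = (\<Sum>l = 0..<d. (\<rho> g * AA) $$ (i, l) * D $$ (l, j))"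
    proof -
      have "(X * D) $$ (i, j) = (\<Sum>l = 0..<d. X $$ (i, l) * D $$ (l, j))" if "X \<in> carrier_mat d d" for X
        using that D(1) ij by (simp add: scalar_prod_def)
      then show ?thesis using mult_carrier_mat[OF car[OF g] AA] by blast
    qed
    also have "\<dots> = (\<Sum>l = 0..<d. Q l g * (D $$ (l, j) / c n))"
      by (intro sum.cong refl) (simp add: QA[OF g, symmetric])
    finally show ?thesis .
  qed
  ultimately show ?thesis by (rule that)
qed

lemma finite_type_entry_poly:
  assumes "haar_measure (SU :: (complex ^ 'n ^ 'n) set) \<mu>" "finite_type (SU :: (complex ^ 'n ^ 'n) set) f"
  obtains p where "p \<in> entry_poly" "\<And>g. g \<in> SU \<Longrightarrow> f g = p g"
proof -
  have coef: "\<exists>p\<in>entry_poly. \<forall>g\<in>SU. \<phi> g = p g" if \<phi>: "matrix_coefficient (SU :: (complex ^ 'n ^ 'n) set) \<phi>" for \<phi>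
  proof -
    obtain d \<rho> v w where \<rho>: "irreducible_representation SU d \<rho>" and vw: "v \<in> carrier_vec d" "w \<in> carrier_vec d"
      and eq: "\<And>g. g \<in> SU \<Longrightarrow> \<phi> g = (\<rho> g *\<^sub>v v) \<bullet>c w"
      using \<phi> unfolding matrix_coefficient_def by blast
    have rep: "matrix_representation SU d \<rho>" using \<rho> by (simp add: irreducible_representation_def)
    have "\<exists>p. p \<in> entry_poly \<and> (\<forall>g\<in>SU. \<rho> g $$ (i, j) = p g)" if "i < d" "j < d" for i j
      using representation_entry_poly[OF assms(1) rep that] by metis
    then obtain p where p: "\<And>i j. i < d \<Longrightarrow> j < d \<Longrightarrow> p i j \<in> entry_poly"
      "\<And>i j g. i < d \<Longrightarrow> j < d \<Longrightarrow> g \<in> SU \<Longrightarrow> \<rho> g $$ (i, j) = p i j g" by metis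
    have poly: "(\<lambda>g. \<Sum>i = 0..<d. (\<Sum>j = 0..<d. p i j g * vec_index v j) * cnj (vec_index w i)) \<in> entry_poly"
      by (intro entry_poly_sum entry_poly.mult entry_poly.const p) simp_all
    have "\<phi> g = (\<Sum>i = 0..<d. (\<Sum>j = 0..<d. p i j g * vec_index v j) * cnj (vec_index w i))" if g: "g \<in> SU" for g
    proof -
      have car: "\<rho> g \<in> carrier_mat d d" using rep g by (simp add: matrix_representation_def)
      have "\<phi> g = (\<Sum>i = 0..<d. (\<Sum>j = 0..<d. \<rho> g $$ (i, j) * vec_index v j) * cnj (vec_index w i))"
        using car vw by (simp add: eq[OF g] scalar_prod_def)
      also have "\<dots> = (\<Sum>i = 0..<d. (\<Sum>j = 0..<d. p i j g * vec_index v j) * cnj (vec_index w i))"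
        using p(2) g by (intro sum.cong refl arg_cong2[where f = "(*)"]) simp_all
      finally show ?thesis .
    qed
    then show ?thesis by (intro bexI[OF ballI poly])
  qed
  obtain n a \<phi> where \<phi>: "\<forall>i<(n::nat). matrix_coefficient (SU :: (complex ^ 'n ^ 'n) set) (\<phi> i)"
    and f: "\<forall>g\<in>SU. f g = (\<Sum>i<n. a i * \<phi> i g)"
    using assms(2) unfolding finite_type_def by blast
  have "\<forall>i\<in>{..<n}. \<exists>p. p \<in> entry_poly \<and> (\<forall>g\<in>SU. \<phi> i g = p g)"
  proof
    fix i assume "i \<in> {..<n}"
    then have "matrix_coefficient (SU :: (complex ^ 'n ^ 'n) set) (\<phi> i)" using \<phi> by simp
    from coef[OF this] show "\<exists>p. p \<in> entry_poly \<and> (\<forall>g\<in>SU. \<phi> i g = p g)" unfolding Bex_def .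
  qed
  from bchoice[OF this] obtain p
    where p': "\<forall>i\<in>{..<n}. p i \<in> entry_poly \<and> (\<forall>g\<in>SU. \<phi> i g = p i g)" ..
  have p: "p i \<in> entry_poly" "g \<in> SU \<Longrightarrow> \<phi> i g = p i g" if "i < n" for i g
    using p' that by simp_all
  have "(\<lambda>g. \<Sum>i<n. a i * p i g) \<in> entry_poly"
    by (intro entry_poly_sum entry_poly.mult entry_poly.const p) simp
  moreover have "f g = (\<Sum>i<n. a i * p i g)" if "g \<in> SU" for g
    using f p(2) that by simp
  ultimately show ?thesis by (rule that)
qed

subsection \<open>Expansions and spectra\<close>

lemma lookup_map_real: "Poly_Mapping.lookup (Poly_Mapping.map real_of_int m) i = real_of_int (Poly_Mapping.lookup m i)"
  by (simp add: Poly_Mapping.map.rep_eq when_def)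

lemma map_real_add:
  "Poly_Mapping.map real_of_int (m + n) = Poly_Mapping.map real_of_int m + Poly_Mapping.map real_of_int n"
  by (intro poly_mapping_eqI) (simp add: lookup_map_real lookup_add)

lemma coeff_algebra_sum:
  "(\<And>i. i \<in> I \<Longrightarrow> f i \<in> coeff_algebra k) \<Longrightarrow> (\<lambda>x. \<Sum>i\<in>I. f i x) \<in> coeff_algebra k"
  by (induction I rule: infinite_finite_induct) (auto intro: coeff_algebra.intros)

lemma coeff_algebra_cnj: "f \<in> coeff_algebra k \<Longrightarrow> (\<lambda>x. cnj (f x)) \<in> coeff_algebra k"
  by (induction rule: coeff_algebra.induct) (auto intro: coeff_algebra.intros)

definition torus_monomial :: "nat \<Rightarrow> (nat \<Rightarrow>\<^sub>0 int) \<Rightarrow> (nat \<Rightarrow> complex) \<Rightarrow> complex" where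
  "torus_monomial l m z = (\<Prod>j=1..l. z j powi Poly_Mapping.lookup m j)"

lemma torus_norm: "z \<in> torus l \<Longrightarrow> j \<in> {1..l} \<Longrightarrow> norm (z j) = 1"
  by (auto simp: torus_def PiE_iff)

lemma torus_monomial_add:
  assumes "z \<in> torus l"
  shows "torus_monomial l (m + n) z = torus_monomial l m z * torus_monomial l n z"
  unfolding torus_monomial_def prod.distrib[symmetric]
proof (intro prod.cong refl)
  fix j assume "j \<in> {1..l}"
  then have "z j \<noteq> 0" using torus_norm[OF assms] by force
  then show "z j powi Poly_Mapping.lookup (m + n) j = z j powi Poly_Mapping.lookup m j * z j powi Poly_Mapping.lookup n j"
    by (simp add: lookup_add power_int_add)
qed

lemma torus_monomial_uminus:
  assumes "z \<in> torus l"
  shows "torus_monomial l (- m) z = cnj (torus_monomial l m z)"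
  unfolding torus_monomial_def cnj_prod
proof (intro prod.cong refl)
  fix j assume "j \<in> {1..l}"
  then have n: "norm (z j) = 1" by (rule torus_norm[OF assms])
  have "cnj (z j) = inverse (z j)"
    using complex_norm_square[of "z j"] n by (intro inverse_unique[symmetric]) simp
  then have "cnj (z j powi n) = inverse (z j powi n)" for n
    by (simp add: power_int_def power_inverse)
  then show "z j powi Poly_Mapping.lookup (- m) j = cnj (z j powi Poly_Mapping.lookup m j)"
    by (simp add: power_int_minus)
qed

text \<open>Bounds the exponents by a set \<open>S\<close> and does not determine the spectrum: such
  bounds survive sums and products even where coefficients cancel.\<close>

definition expandable ::
  "nat \<Rightarrow> nat \<Rightarrow> (nat \<Rightarrow>\<^sub>0 int) set \<Rightarrow> ((nat \<Rightarrow> real) \<Rightarrow> (nat \<Rightarrow> complex) \<Rightarrow> complex) \<Rightarrow> bool" where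
  "expandable k l S f \<longleftrightarrow> (\<exists>M c. is_expansion k l f M c \<and> M \<subseteq> S)"

lemma is_expansion_iff:
  "is_expansion k l f M c \<longleftrightarrow> finite M \<and> (\<forall>m\<in>M. Poly_Mapping.keys m \<subseteq> {1..l} \<and> c m \<in> coeff_algebra k) \<and>
     (\<forall>x\<in>cube k. \<forall>z\<in>torus l. f x z = (\<Sum>m\<in>M. c m x * torus_monomial l m z))"
  by (simp add: is_expansion_def torus_monomial_def)

lemma expandable_coeff:
  assumes "p \<in> coeff_algebra k" shows "expandable k l {0} (\<lambda>x z. p x)"
proof -
  have "is_expansion k l (\<lambda>x z. p x) {0} (\<lambda>m. p)"
    using assms by (simp add: is_expansion_def)
  then show ?thesis unfolding expandable_def by blast
qed

lemma expandable_phase: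
  assumes "j \<in> {1..l}" shows "expandable k l UNIV (\<lambda>x z. z j)"
proof -
  have "(\<Prod>i=1..l. z i powi Poly_Mapping.lookup (Poly_Mapping.single j 1) i) = z j" for z :: "nat \<Rightarrow> complex"
  proof -
    have "(\<Prod>i=1..l. z i powi Poly_Mapping.lookup (Poly_Mapping.single j 1) i) = (\<Prod>i=1..l. if i = j then z j else 1)"
      by (intro prod.cong refl) (auto simp: lookup_single when_def)
    also have "\<dots> = z j" using assms by simp
    finally show ?thesis .
  qed
  then have "is_expansion k l (\<lambda>x z. z j) {Poly_Mapping.single j 1} (\<lambda>m x. 1)"
    using assms by (simp add: is_expansion_def coeff_algebra.const)
  then show ?thesis unfolding expandable_def by blast
qed

lemma expandable_add:
  assumes "expandable k l S f" "expandable k l S g"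
  shows "expandable k l S (\<lambda>x z. f x z + g x z)"
proof -
  obtain M c N d where M: "is_expansion k l f M c" "M \<subseteq> S" and N: "is_expansion k l g N d" "N \<subseteq> S"
    using assms unfolding expandable_def by blast
  define b where "b = (\<lambda>m x. (if m \<in> M then c m x else 0) + (if m \<in> N then d m x else 0))"
  have fin: "finite M" "finite N" using M N by (auto simp: is_expansion_def)
  have "b m \<in> coeff_algebra k" if "m \<in> M \<union> N" for m
  proof -
    have "(\<lambda>x. if m \<in> M then c m x else 0) \<in> coeff_algebra k" "(\<lambda>x. if m \<in> N then d m x else 0) \<in> coeff_algebra k"
      using M(1) N(1) coeff_algebra.const[of 0 k] unfolding is_expansion_def by (cases "m \<in> M"; cases "m \<in> N"; simp)+
    then show ?thesis unfolding b_def by (rule coeff_algebra.add)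
  qed
  moreover have "f x z + g x z = (\<Sum>m\<in>M \<union> N. b m x * torus_monomial l m z)" if "x \<in> cube k" "z \<in> torus l" for x z
  proof -
    have "(\<Sum>m\<in>M \<union> N. b m x * torus_monomial l m z) =
       (\<Sum>m\<in>M \<union> N. (if m \<in> M then c m x * torus_monomial l m z else 0)) + (\<Sum>m\<in>M \<union> N. (if m \<in> N then d m x * torus_monomial l m z else 0))"
      unfolding sum.distrib[symmetric] b_def by (intro sum.cong refl) (auto simp: distrib_right)
    also have "\<dots> = (\<Sum>m\<in>M. c m x * torus_monomial l m z) + (\<Sum>m\<in>N. d m x * torus_monomial l m z)"
      using fin by (simp add: sum.inter_restrict[symmetric] Int_absorb1)
    finally show ?thesis using M(1) N(1) that by (simp add: is_expansion_iff)
  qed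
  ultimately have "is_expansion k l (\<lambda>x z. f x z + g x z) (M \<union> N) b"
    using M(1) N(1) by (auto simp: is_expansion_iff)
  then show ?thesis using M(2) N(2) unfolding expandable_def by blast
qed

text \<open>Exponents add up to the Minkowski sum, and the new coefficients are the convolution of
  the given ones, obtained by grouping pairs with equal sum.\<close>

lemma expandable_mult:
  assumes "expandable k l S f" "expandable k l T g"
  shows "expandable k l {m + n | m n. m \<in> S \<and> n \<in> T} (\<lambda>x z. f x z * g x z)"
proof -
  obtain M c N d where M: "is_expansion k l f M c" "M \<subseteq> S" and N: "is_expansion k l g N d" "N \<subseteq> T"
    using assms unfolding expandable_def by blast
  let ?add = "\<lambda>(m :: nat \<Rightarrow>\<^sub>0 int, n). m + n"
  define b where "b = (\<lambda>m x. \<Sum>p\<in>{p \<in> M \<times> N. ?add p = m}. c (fst p) x * d (snd p) x)"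
  have fin: "finite M" "finite N" using M N by (auto simp: is_expansion_def)
  have "is_expansion k l (\<lambda>x z. f x z * g x z) (?add ` (M \<times> N)) b"
    unfolding is_expansion_iff
  proof (intro conjI ballI)
    show "finite (?add ` (M \<times> N))" using fin by simp
  next
    fix m assume "m \<in> ?add ` (M \<times> N)"
    then obtain u v where "u \<in> M" "v \<in> N" "m = u + v" by auto
    moreover have "Poly_Mapping.keys u \<subseteq> {1..l}" "Poly_Mapping.keys v \<subseteq> {1..l}"
      using calculation M(1) N(1) by (auto simp: is_expansion_def)
    ultimately show "Poly_Mapping.keys m \<subseteq> {1..l}"
      using Poly_Mapping.keys_add[of u v] by blast
  next
    fix m
    show "b m \<in> coeff_algebra k"
      unfolding b_def using M(1) N(1)
      by (intro coeff_algebra_sum coeff_algebra.mult) (auto simp: is_expansion_def)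
  next
    fix x z assume x: "x \<in> cube k" and z: "z \<in> torus l"
    have "f x z * g x z = (\<Sum>p\<in>M \<times> N. c (fst p) x * d (snd p) x * torus_monomial l (?add p) z)"
      using M(1) N(1) x z unfolding is_expansion_iff
      by (simp add: sum_product sum.cartesian_product case_prod_unfold torus_monomial_add[OF z] mult_ac)
    also have "\<dots> = (\<Sum>m\<in>?add ` (M \<times> N). \<Sum>p\<in>{p \<in> M \<times> N. ?add p = m}. c (fst p) x * d (snd p) x * torus_monomial l (?add p) z)"
      using fin by (intro sum.group[symmetric]) auto
    also have "\<dots> = (\<Sum>m\<in>?add ` (M \<times> N). b m x * torus_monomial l m z)"
      unfolding b_def sum_distrib_right by (intro sum.cong refl) auto
    finally show "f x z * g x z = (\<Sum>m\<in>?add ` (M \<times> N). b m x * torus_monomial l m z)" .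
  qed
  moreover have "?add ` (M \<times> N) \<subseteq> {m + n | m n. m \<in> S \<and> n \<in> T}" using M(2) N(2) by auto
  ultimately show ?thesis unfolding expandable_def by blast
qed

text \<open>On the torus conjugation inverts every phase and so negates the exponents. The
  coefficients remain in the algebra because its nonconstant generators are real.\<close>

lemma expandable_cnj:
  assumes "expandable k l UNIV f"
  shows "expandable k l UNIV (\<lambda>x z. cnj (f x z))"
proof -
  obtain M c where M: "is_expansion k l f M c"
    using assms unfolding expandable_def by blast
  have "cnj (f x z) = (\<Sum>m\<in>uminus ` M. cnj (c (- m) x) * torus_monomial l m z)" if "x \<in> cube k" "z \<in> torus l" for x z
  proof -
    have "(\<Sum>m\<in>uminus ` M. cnj (c (- m) x) * torus_monomial l m z) = (\<Sum>m\<in>M. cnj (c m x) * torus_monomial l (- m) z)"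
      by (subst sum.reindex) (auto simp: inj_on_def)
    then show ?thesis using M that by (simp add: is_expansion_iff torus_monomial_uminus)
  qed
  then have "is_expansion k l (\<lambda>x z. cnj (f x z)) (uminus ` M) (\<lambda>m x. cnj (c (- m) x))"
    using M by (auto simp: is_expansion_iff coeff_algebra_cnj)
  then show ?thesis unfolding expandable_def by blast
qed

lemma expandable_mono: "expandable k l S f \<Longrightarrow> S \<subseteq> T \<Longrightarrow> expandable k l T f"
  unfolding expandable_def by blast

lemma admissible_iff_expandable: "admissible k l f \<longleftrightarrow> expandable k l UNIV f"
  by (simp add: admissible_def expandable_def)

lemma star_algebra_expandable: "star_algebra (\<lambda>f. expandable k l UNIV (\<lambda>x z. f (x, z)))"
  unfolding star_algebra_def
proof (intro conjI allI impI)
  fix c :: complex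
  show "expandable k l UNIV (\<lambda>x z. c)"
    by (rule expandable_mono[OF expandable_coeff[OF coeff_algebra.const]]) simp
next
  fix f g :: "(nat \<Rightarrow> real) \<times> (nat \<Rightarrow> complex) \<Rightarrow> complex"
  assume fg: "expandable k l UNIV (\<lambda>x z. f (x, z))" "expandable k l UNIV (\<lambda>x z. g (x, z))"
  show "expandable k l UNIV (\<lambda>x z. f (x, z) + g (x, z))" by (rule expandable_add[OF fg])
  show "expandable k l UNIV (\<lambda>x z. f (x, z) * g (x, z))"
    by (rule expandable_mono[OF expandable_mult[OF fg]]) simp
next
  fix f :: "(nat \<Rightarrow> real) \<times> (nat \<Rightarrow> complex) \<Rightarrow> complex"
  assume "expandable k l UNIV (\<lambda>x z. f (x, z))"
  then show "expandable k l UNIV (\<lambda>x z. cnj (f (x, z)))" by (rule expandable_cnj)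
qed

text \<open>The lattice points of \<open>P\<close> times the convex hull of \<open>S\<close>. With
  \<open>S\<close> the spectrum of a function, this is the dilated Newton polytope that contains the
  exponents of its \<open>P\<close>-th power.\<close>

definition dilated_hull :: "(nat \<Rightarrow>\<^sub>0 int) set \<Rightarrow> nat \<Rightarrow> (nat \<Rightarrow>\<^sub>0 int) set" where
  "dilated_hull S P = {m. \<exists>y\<in>convex hull (Poly_Mapping.map real_of_int ` S). Poly_Mapping.map real_of_int m = real P *\<^sub>R y}"

text \<open>The induction starts at 1 because for empty \<open>S\<close> the dilated hull is empty,
  whereas the power with exponent 0 is the constant 1.\<close>

lemma expandable_power:
  assumes "expandable k l S f" "1 \<le> P"
  shows "expandable k l (dilated_hull S P) (\<lambda>x z. f x z ^ P)"
  using assms(2)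
proof (induction P rule: dec_induct)
  case base
  have "S \<subseteq> dilated_hull S 1" by (auto simp: dilated_hull_def intro: hull_inc)
  then show ?case using expandable_mono[OF assms(1)] by simp
next
  case (step P)
  let ?H = "convex hull (Poly_Mapping.map real_of_int ` S)"
  have "{m + n | m n. m \<in> S \<and> n \<in> dilated_hull S P} \<subseteq> dilated_hull S (Suc P)"
  proof clarify
    fix m n assume m: "m \<in> S" and n: "n \<in> dilated_hull S P"
    obtain y where y: "y \<in> ?H" "Poly_Mapping.map real_of_int n = real P *\<^sub>R y"
      using n unfolding dilated_hull_def by blast
    let ?m = "Poly_Mapping.map real_of_int m"
    have "?m \<in> ?H" using m by (intro hull_inc) auto
    \<comment> \<open>One point of the hull plus \<open>P\<close> times another is
      \<open>P + 1\<close> times their mean with weights 1 and \<open>P\<close>.\<close>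
    then have "(1 / real (Suc P)) *\<^sub>R ?m + (real P / real (Suc P)) *\<^sub>R y \<in> ?H"
      using y(1) by (intro convexD[OF convex_convex_hull]) (simp_all add: field_simps)
    moreover have "Poly_Mapping.map real_of_int (m + n)
        = real (Suc P) *\<^sub>R ((1 / real (Suc P)) *\<^sub>R ?m + (real P / real (Suc P)) *\<^sub>R y)"
      by (simp add: map_real_add y(2) scaleR_add_right del: of_nat_Suc)
    ultimately show "m + n \<in> dilated_hull S (Suc P)" unfolding dilated_hull_def by blast
  qed
  then show ?case using expandable_mono[OF expandable_mult[OF assms(1) step.IH]] by simp
qed

text \<open>The hull of a finite set is compact, so 0 has positive distance \<open>\<delta>\<close>
  from it, and the points of its dilate have norm at least \<open>P * \<delta>\<close>. Once this
  exceeds the norms of the finitely many exponents in \<open>T\<close>, none of them can cancel such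
  a point.\<close>

lemma eventually_zero_not_in_sum:
  assumes "finite S" "0 \<notin> convex hull (Poly_Mapping.map real_of_int ` S)" "finite T"
  shows "\<forall>\<^sub>F P in sequentially. 0 \<notin> {m + n | m n. m \<in> dilated_hull S P \<and> n \<in> T}"
proof -
  let ?r = "Poly_Mapping.map real_of_int"
  have "closed (convex hull (?r ` S))"
    using assms(1) by (intro compact_imp_closed finite_imp_compact_convex_hull) simp
  then have "open (- (convex hull (?r ` S)))" by (rule open_Compl)
  from openE[OF this Compl_iff[THEN iffD2, OF assms(2)]]
  obtain \<delta> where \<delta>: "0 < \<delta>" "ball 0 \<delta> \<subseteq> - (convex hull (?r ` S))" .
  have \<delta>': "\<delta> \<le> norm y" if "y \<in> convex hull (?r ` S)" for y
    using \<delta>(2) that by force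
  define B where "B = (\<Sum>n\<in>T. norm (?r n))"
  have B: "norm (?r n) \<le> B" if "n \<in> T" for n
    unfolding B_def using that assms(3) by (intro member_le_sum) auto
  have "\<forall>\<^sub>F P in sequentially. B / \<delta> < real P"
    by (rule eventually_compose_filterlim[OF eventually_gt_at_top filterlim_real_sequentially])
  then show ?thesis
  proof eventually_elim
    case (elim P)
    show ?case
    proof
      assume "0 \<in> {m + n | m n. m \<in> dilated_hull S P \<and> n \<in> T}"
      then obtain m n where mn: "m + n = 0" "m \<in> dilated_hull S P" "n \<in> T" by auto
      then obtain y where y: "y \<in> convex hull (?r ` S)" "?r m = real P *\<^sub>R y"
        unfolding dilated_hull_def by blast
      have "?r m + ?r n = 0"
        using map_real_add[of m n] unfolding mn(1) by (metis lookup_map_real lookup_zero of_int_0 poly_mapping_eqI)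
      then have "norm (?r m) = norm (?r n)" by (metis add_eq_0_iff norm_minus_cancel)
      then have "real P * norm y \<le> B" using B[OF mn(3)] by (simp add: y(2))
      moreover have "real P * \<delta> \<le> real P * norm y" using \<delta>'[OF y(1)] by (intro mult_left_mono) auto
      ultimately have "real P * \<delta> \<le> B" by linarith
      then show False using elim \<delta>(1) by (simp add: field_simps)
    qed
  qed
qed

section \<open>Integration over the torus\<close>

lemma integral_torus_monomial:
  assumes "m \<noteq> 0" "Poly_Mapping.keys m \<subseteq> {1..l}"
  shows "(LINT \<theta>|(\<Pi>\<^sub>M j\<in>{1..l}. interval_measure (2 * pi)). torus_monomial l m (\<lambda>j. cis (\<theta> j))) = 0"
proof -
  interpret product_sigma_finite "\<lambda>_::nat. interval_measure (2 * pi)" by (rule product_sigma_finite_interval)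
  obtain j where j: "Poly_Mapping.lookup m j \<noteq> 0" using assms(1) by (metis lookup_zero poly_mapping_eqI)
  then have "j \<in> {1..l}" using assms(2) by (auto simp: in_keys_iff)
  have "(LINT \<theta>|(\<Pi>\<^sub>M j\<in>{1..l}. interval_measure (2 * pi)). torus_monomial l m (\<lambda>j. cis (\<theta> j)))
    = (\<Prod>j\<in>{1..l}. LINT t|interval_measure (2 * pi). cis t powi Poly_Mapping.lookup m j)"
    unfolding torus_monomial_def
  proof (rule product_integral_prod)
    fix j :: nat
    have "continuous_on {0..2*pi} (\<lambda>t. cis (of_int (Poly_Mapping.lookup m j) * t))" by (intro continuous_intros)
    then show "integrable (interval_measure (2 * pi)) (\<lambda>t. cis t powi Poly_Mapping.lookup m j)"
      by (intro finite_measure.integrable_bounded[OF finite_interval_measure, where C=1] measurable_interval_continuous)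
         (simp_all add: cis_power_int)
  qed simp
  also have "\<dots> = 0"
    using j \<open>j \<in> {1..l}\<close> by (intro prod_zero) (auto simp: integral_cis_powi intro!: bexI[of _ j])
  finally show ?thesis .
qed

lemma integrable_torus_monomial:
  "integrable (\<Pi>\<^sub>M j\<in>{1..l}. interval_measure (2 * pi)) (\<lambda>\<theta>. torus_monomial l m (\<lambda>j. cis (\<theta> j)))"
proof -
  interpret product_sigma_finite "\<lambda>_::nat. interval_measure (2 * pi)" by (rule product_sigma_finite_interval)
  show ?thesis unfolding torus_monomial_def
  proof (rule product_integrable_prod)
    fix j :: nat
    have "continuous_on {0..2*pi} (\<lambda>t. cis (of_int (Poly_Mapping.lookup m j) * t))" by (intro continuous_intros)
    then show "integrable (interval_measure (2 * pi)) (\<lambda>t. cis t powi Poly_Mapping.lookup m j)"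
      by (intro finite_measure.integrable_bounded[OF finite_interval_measure, where C=1] measurable_interval_continuous)
         (simp_all add: cis_power_int)
  qed simp
qed

lemma restrict_cis_torus: "(\<lambda>j\<in>{1..l}. cis (\<theta> j)) \<in> torus l"
  by (auto simp: torus_def)

text \<open>In each variable dz / z is i times the angle element, whence the power of i between the
  contour integral and the angular one.\<close>

lemma torus_integral_dz_over_z:
  "torus_integral l (\<lambda>z. g z * (\<Prod>j=1..l. 1 / z j)) =
    \<i> ^ l * (LINT \<theta>|(\<Pi>\<^sub>M j\<in>{1..l}. interval_measure (2 * pi)). g (\<lambda>j\<in>{1..l}. cis (\<theta> j)))"
proof -
  have eq: "(\<Prod>j=1..l. 1 / (\<lambda>j\<in>{1..l}. cis (\<theta> j)) j) * (\<Prod>j=1..l. \<i> * cis (\<theta> j)) = \<i> ^ l" for \<theta>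
  proof -
    have "(\<Prod>j=1..l. 1 / (\<lambda>j\<in>{1..l}. cis (\<theta> j)) j) * (\<Prod>j=1..l. \<i> * cis (\<theta> j)) = (\<Prod>j=1..l. \<i>)"
      unfolding prod.distrib[symmetric] by (intro prod.cong refl) simp
    then show ?thesis by simp
  qed
  have "torus_integral l (\<lambda>z. g z * (\<Prod>j=1..l. 1 / z j)) =
    (LINT \<theta>|(\<Pi>\<^sub>M j\<in>{1..l}. interval_measure (2 * pi)). \<i> ^ l * g (\<lambda>j\<in>{1..l}. cis (\<theta> j)))"
    unfolding torus_integral_def mult.assoc eq by (simp only: mult.commute)
  then show ?thesis by simp
qed

text \<open>Every monomial other than the constant one integrates to 0 over the torus. The number
  \<open>a\<close> stands for the weight at \<open>x\<close>, so the inner integral vanishes for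
  every \<open>x\<close> separately.\<close>

lemma torus_integral_expandable_eq_0:
  assumes f: "expandable k l S f" and S: "0 \<notin> S" and x: "x \<in> cube k"
  shows "torus_integral l (\<lambda>z. f x z * a * (\<Prod>j=1..l. 1 / z j)) = 0"
proof -
  obtain M c where M: "is_expansion k l f M c" "M \<subseteq> S" using f unfolding expandable_def by blast
  let ?T = "\<Pi>\<^sub>M j\<in>{1..l}. interval_measure (2 * pi)"
  have "(LINT \<theta>|?T. f x (\<lambda>j\<in>{1..l}. cis (\<theta> j)) * a) = (LINT \<theta>|?T. (\<Sum>m\<in>M. (c m x * a) * torus_monomial l m (\<lambda>j. cis (\<theta> j))))"
  proof (rule lebesgue_integral_cong)
    fix \<theta> :: "nat \<Rightarrow> real"
    have "torus_monomial l m (\<lambda>j\<in>{1..l}. cis (\<theta> j)) = torus_monomial l m (\<lambda>j. cis (\<theta> j))" for m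
      unfolding torus_monomial_def by (intro prod.cong refl) simp
    moreover have "f x (\<lambda>j\<in>{1..l}. cis (\<theta> j)) = (\<Sum>m\<in>M. c m x * torus_monomial l m (\<lambda>j\<in>{1..l}. cis (\<theta> j)))"
      using M(1) x restrict_cis_torus[of \<theta> l] by (simp only: is_expansion_iff)
    ultimately show "f x (\<lambda>j\<in>{1..l}. cis (\<theta> j)) * a = (\<Sum>m\<in>M. (c m x * a) * torus_monomial l m (\<lambda>j. cis (\<theta> j)))"
      by (simp only: sum_distrib_right) (simp only: mult_ac)
  qed
  also have "\<dots> = (\<Sum>m\<in>M. (c m x * a) * (LINT \<theta>|?T. torus_monomial l m (\<lambda>j. cis (\<theta> j))))"
    by (subst Bochner_Integration.integral_sum)
       (intro integrable_mult_right integrable_torus_monomial, simp only: integral_mult_right_zero)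
  also have "\<dots> = 0"
  proof (intro sum.neutral ballI)
    fix m assume m: "m \<in> M"
    then have "m \<noteq> 0" "Poly_Mapping.keys m \<subseteq> {1..l}" using S M by (auto simp: is_expansion_iff)
    then have "(LINT \<theta>|?T. torus_monomial l m (\<lambda>j. cis (\<theta> j))) = 0"
      by (rule integral_torus_monomial)
    then show "c m x * a * (LINT \<theta>|?T. torus_monomial l m (\<lambda>j. cis (\<theta> j))) = 0"
      by (simp only: mult_zero_right)
  qed
  finally show ?thesis
    using torus_integral_dz_over_z[of l "\<lambda>z. f x z * a"] by simp
qed

subsection \<open>The Haar integral in Euler coordinates\<close>

context coordinate_enumeration
begin

text \<open>Both sides are values of one double integral, over the group and over the parameters, of
  the weighted function \<open>F\<close> at the adjoint of the Euler matrix times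
  \<open>g\<close>.\<close>

lemma haar_average_real:
  fixes F :: "complex ^ 'n ^ 'n \<Rightarrow> real"
  assumes \<mu>: "haar_measure SU \<mu>" and k: "Suc k = CARD('n)" and F: "continuous_on UNIV F"
  shows "euler_integral C k 0 0 (\<lambda>A. F (adjoint_matrix A)) = euler_integral C k 0 0 (\<lambda>_. 1) * integral\<^sup>L \<mu> F"
proof -
  let ?M = "group_params k 0 0"
  let ?J = "\<lambda>\<omega>. J_SU C (Suc k) (radii 0 \<omega>)"
  let ?E = "euler_at k 0 0"
  let ?f = "\<lambda>(g, \<omega>). ?J \<omega> * F (adjoint_matrix (?E \<omega>) ** g)"
  have finM: "finite_measure ?M" by (rule finite_param_measure) auto
  have kle: "Suc k \<le> CARD('n)" using k by simp
  have SU: "SU_sub (Suc k) = SU" unfolding k by (rule SU_sub_CARD)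
  have E: "?E \<omega> \<in> SU" if "\<omega> \<in> space ?M" for \<omega>
    using euler_at_SU_sub[OF kle that] unfolding SU .
  have id: "(\<lambda>g. g) \<in> borel_measurable \<mu>"
    by (rule measurable_haar_continuous[OF \<mu> continuous_on_id])
  have meas: "?f \<in> borel_measurable (\<mu> \<Otimes>\<^sub>M ?M)"
    unfolding case_prod_unfold
  proof (intro borel_measurable_times)
    show "(\<lambda>w. ?J (snd w)) \<in> borel_measurable (\<mu> \<Otimes>\<^sub>M ?M)"
      by (rule measurable_compose[OF measurable_snd measurable_J_SU])
    have "continuous_on UNIV (\<lambda>w. F (adjoint_matrix (fst w) ** snd w))"
      by (intro continuous_on_compose2[OF F] continuous_on_matrix_mult continuous_on_adjoint_matrix
          continuous_on_fst continuous_on_snd continuous_on_id) auto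
    then show "(\<lambda>w. F (adjoint_matrix (?E (snd w)) ** fst w)) \<in> borel_measurable (\<mu> \<Otimes>\<^sub>M ?M)"
      by (rule borel_measurable_continuous_Pair[OF measurable_compose[OF measurable_snd measurable_euler]
          measurable_compose[OF measurable_fst id]])
  qed
  from compact_imp_bounded[OF compact_continuous_image[OF continuous_on_subset[OF F subset_UNIV] compact_SU]]
  obtain B1 where B1: "\<forall>y\<in>F ` SU. norm y \<le> B1" unfolding bounded_iff ..
  obtain B2 where B2: "\<forall>x. (\<forall>i\<in>{1..num_radial k}. x i \<in> {0..1}) \<longrightarrow> \<bar>J_SU C (Suc k) x\<bar> \<le> B2"
    using J_SU_bounded[of k C] ..
  have bdd: "norm (?f w) \<le> B2 * B1" if w: "w \<in> space (\<mu> \<Otimes>\<^sub>M ?M)" for w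
  proof -
    have g: "fst w \<in> SU" and \<omega>: "snd w \<in> space ?M"
      using w by (auto simp: space_pair_measure space_haar[OF \<mu>])
    have 1: "\<bar>?J (snd w)\<bar> \<le> B2" by (intro B2[rule_format] radii_mem[OF \<omega>])
    have 2: "\<bar>F (adjoint_matrix (?E (snd w)) ** fst w)\<bar> \<le> B1"
      using B1 SU_mult[OF SU_adjoint[OF E[OF \<omega>]] g] by simp
    have "0 \<le> B2" using 1 by linarith
    with 1 2 show ?thesis unfolding case_prod_unfold real_norm_def abs_mult by (intro mult_mono) simp_all
  qed
  have "integral\<^sup>L (\<mu> \<Otimes>\<^sub>M ?M) ?f = (LINT \<omega>|?M. LINT g|\<mu>. ?J \<omega> * F (adjoint_matrix (?E \<omega>) ** g))"
    using integral_pair_bounded(2)[OF finite_haar[OF \<mu>] finM meas bdd] by simp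
  \<comment> \<open>With \<open>g\<close> integrated first, the adjoint Euler matrix is a left
    factor, which invariance of the Haar measure removes.\<close>
  also have "\<dots> = (LINT \<omega>|?M. ?J \<omega> * integral\<^sup>L \<mu> F)"
  proof (rule lebesgue_integral_cong)
    fix \<omega> assume "\<omega> \<in> space ?M"
    from integral_haar_mult[OF \<mu> SU_adjoint[OF E[OF this]] continuous_on_subset[OF F subset_UNIV]]
    show "(LINT g|\<mu>. ?J \<omega> * F (adjoint_matrix (?E \<omega>) ** g)) = ?J \<omega> * integral\<^sup>L \<mu> F" by simp
  qed
  also have "\<dots> = euler_integral C k 0 0 (\<lambda>_. 1) * integral\<^sup>L \<mu> F"
    unfolding euler_integral_def by simp
  finally have 1: "integral\<^sup>L (\<mu> \<Otimes>\<^sub>M ?M) ?f = euler_integral C k 0 0 (\<lambda>_. 1) * integral\<^sup>L \<mu> F" .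
  have "integral\<^sup>L (\<mu> \<Otimes>\<^sub>M ?M) ?f = (LINT g|\<mu>. LINT \<omega>|?M. ?J \<omega> * F (adjoint_matrix (?E \<omega>) ** g))"
    using integral_pair_bounded(1)[OF finite_haar[OF \<mu>] finM meas bdd] by simp
  \<comment> \<open>With the parameters integrated first, the argument is the adjoint of
    \<open>adjoint_matrix g\<close> times the Euler matrix, so \<open>g\<close> is removed by left
    invariance of the Euler integral.\<close>
  also have "\<dots> = (LINT g|\<mu>. euler_integral C k 0 0 (\<lambda>A. F (adjoint_matrix A)))"
  proof (rule lebesgue_integral_cong)
    fix g assume "g \<in> space \<mu>"
    then have "adjoint_matrix g \<in> SU_sub (Suc k)" unfolding SU by (simp add: space_haar[OF \<mu>] SU_adjoint)
    moreover have "continuous_on UNIV (\<lambda>A. F (adjoint_matrix A))"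
      by (intro continuous_on_compose2[OF F] continuous_on_adjoint_matrix continuous_on_id) auto
    ultimately have "euler_integral C k 0 0 (\<lambda>A. F (adjoint_matrix (adjoint_matrix g ** A)))
      = euler_integral C k 0 0 (\<lambda>A. F (adjoint_matrix A))"
      by (rule euler_integral_left_invariant[OF kle])
    then show "(LINT \<omega>|?M. ?J \<omega> * F (adjoint_matrix (?E \<omega>) ** g)) = euler_integral C k 0 0 (\<lambda>A. F (adjoint_matrix A))"
      by (simp add: adjoint_matrix_mult euler_integral_def)
  qed
  also have "\<dots> = euler_integral C k 0 0 (\<lambda>A. F (adjoint_matrix A))"
    by (simp add: space_haar[OF \<mu>] measure_haar[OF \<mu>])
  finally show ?thesis using 1 by simp
qed

text \<open>Real and imaginary parts are treated separately, because the invariance rests on an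
  approximation by real exponentials.\<close>

lemma haar_average:
  fixes F :: "complex ^ 'n ^ 'n \<Rightarrow> complex"
  assumes \<mu>: "haar_measure SU \<mu>" and k: "Suc k = CARD('n)" and F: "continuous_on UNIV F"
  shows "euler_integral C k 0 0 (\<lambda>A. F (adjoint_matrix A))
    = complex_of_real (euler_integral C k 0 0 (\<lambda>_. 1)) * integral\<^sup>L \<mu> F"
proof -
  have FA: "continuous_on UNIV (\<lambda>A. F (adjoint_matrix A))"
    by (intro continuous_on_compose2[OF F] continuous_on_adjoint_matrix continuous_on_id) auto
  note int = integrable_euler_integrand[OF eq_refl[OF k] FA, of 0 0 C]
  note intF = integrable_haar_continuous[OF \<mu> continuous_on_subset[OF F subset_UNIV]]
  have "Re (euler_integral C k 0 0 (\<lambda>A. F (adjoint_matrix A))) = euler_integral C k 0 0 (\<lambda>A. Re (F (adjoint_matrix A)))"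
    unfolding euler_integral_def by (subst integral_Re[OF int, symmetric]) simp
  also have "\<dots> = euler_integral C k 0 0 (\<lambda>_. 1) * (LINT g|\<mu>. Re (F g))"
    by (rule haar_average_real[OF \<mu> k]) (intro continuous_on_Re F)
  also have "(LINT g|\<mu>. Re (F g)) = Re (integral\<^sup>L \<mu> F)" by (rule integral_Re[OF intF])
  finally have re: "Re (euler_integral C k 0 0 (\<lambda>A. F (adjoint_matrix A))) = euler_integral C k 0 0 (\<lambda>_. 1) * Re (integral\<^sup>L \<mu> F)" .
  have "Im (euler_integral C k 0 0 (\<lambda>A. F (adjoint_matrix A))) = euler_integral C k 0 0 (\<lambda>A. Im (F (adjoint_matrix A)))"
    unfolding euler_integral_def by (subst integral_Im[OF int, symmetric]) simp
  also have "\<dots> = euler_integral C k 0 0 (\<lambda>_. 1) * (LINT g|\<mu>. Im (F g))"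
    by (rule haar_average_real[OF \<mu> k]) (intro continuous_on_Im F)
  also have "(LINT g|\<mu>. Im (F g)) = Im (integral\<^sup>L \<mu> F)" by (rule integral_Im[OF intF])
  finally have im: "Im (euler_integral C k 0 0 (\<lambda>A. F (adjoint_matrix A))) = euler_integral C k 0 0 (\<lambda>_. 1) * Im (integral\<^sup>L \<mu> F)" .
  show ?thesis using re im by (intro complex_eqI) simp_all
qed

text \<open>Identifies the iterated contour integral of the conjecture with the integral over the
  product measure used in the induction; the two differ only by a power of i.\<close>

lemma cube_torus_integral_eq:
  fixes Q :: "complex ^ 'n ^ 'n \<Rightarrow> complex"
  assumes k: "Suc k \<le> CARD('n)" and Q: "continuous_on UNIV Q"
  shows "cube_integral (num_radial k) (\<lambda>x. torus_integral (num_phase k) (\<lambda>z.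
      Q (euler k x z) * complex_of_real (J_SU C (Suc k) x) * (\<Prod>j=1..num_phase k. 1 / z j)))
    = \<i> ^ num_phase k * euler_integral C k 0 0 Q"
proof -
  let ?X = "\<Pi>\<^sub>M i\<in>{1..num_radial k}. interval_measure 1" and ?T = "\<Pi>\<^sub>M j\<in>{1..num_phase k}. interval_measure (2 * pi)"
  let ?f = "\<lambda>\<omega>. J_SU C (Suc k) (radii 0 \<omega>) *\<^sub>R Q (euler_at k 0 0 \<omega>)"
  have par: "group_params k 0 0 = ?X \<Otimes>\<^sub>M ?T" by (simp only: param_measure_def add_0)
  obtain B where B: "\<And>A \<omega>. A \<in> {mat 1} \<Longrightarrow> \<omega> \<in> space (group_params k 0 0) \<Longrightarrow>
    norm (J_SU C (Suc k) (radii 0 \<omega>) *\<^sub>R Q (A ** euler_at k 0 0 \<omega>)) \<le> B"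
    using bounded_euler_integrand[OF k _ Q, of "{mat 1}" 0 0 C] by auto
  have bdd: "norm (?f \<omega>) \<le> B" if "\<omega> \<in> space (?X \<Otimes>\<^sub>M ?T)" for \<omega>
    using B[OF insertI1, of \<omega>] that unfolding par matrix_mul_lid by blast
  have "cube_integral (num_radial k) (\<lambda>x. torus_integral (num_phase k) (\<lambda>z.
      Q (euler k x z) * complex_of_real (J_SU C (Suc k) x) * (\<Prod>j=1..num_phase k. 1 / z j)))
    = (LINT x|?X. \<i> ^ num_phase k * (LINT \<theta>|?T. Q (euler k x (\<lambda>j\<in>{1..num_phase k}. cis (\<theta> j))) * complex_of_real (J_SU C (Suc k) x)))"
    unfolding cube_integral_def by (subst torus_integral_dz_over_z) (rule refl)
  also have "\<dots> = \<i> ^ num_phase k * (LINT x|?X. LINT \<theta>|?T. ?f (x, \<theta>))"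
  proof -
    have "Q (euler k x (\<lambda>j\<in>{1..num_phase k}. cis (\<theta> j))) * complex_of_real (J_SU C (Suc k) x) = ?f (x, \<theta>)" for x \<theta>
    proof -
      have "euler k x (\<lambda>j\<in>{1..num_phase k}. cis (\<theta> j)) = euler_at k 0 0 (x, \<theta>)"
        by (rule euler_cong) simp_all
      then show ?thesis by (simp add: scaleR_conv_of_real)
    qed
    then show ?thesis by (simp only: integral_mult_right_zero)
  qed
  also have "(LINT x|?X. LINT \<theta>|?T. ?f (x, \<theta>)) = integral\<^sup>L (?X \<Otimes>\<^sub>M ?T) ?f"
    by (rule integral_pair_bounded(1)[OF finite_measure_PiM_interval finite_measure_PiM_interval
          measurable_euler_integrand[OF Q, of C k 0 0 "{0+1..0 + num_radial k}" "{0+1..0 + num_phase k}", unfolded par] bdd, symmetric]) auto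
  also have "\<dots> = euler_integral C k 0 0 Q" unfolding euler_integral_def par ..
  finally show ?thesis .
qed

lemma expandable_euler:
  assumes "p \<in> entry_poly"
  shows "expandable (num_radial k) (num_phase k) UNIV (\<lambda>x z. p (adjoint_matrix (euler k x z)))"
proof -
  let ?P = "\<lambda>f. expandable (num_radial k) (num_phase k) UNIV (\<lambda>x z. f (x, z))"
  have P: "star_algebra ?P" by (rule star_algebra_expandable)
  have "?P (\<lambda>w. euler k (fst w) (snd w) $ i $ j)" for i j
  proof (rule star_algebra_euler[OF P])
    show "\<forall>i\<in>{1..num_radial k}. ?P (\<lambda>w. complex_of_real (fst w i)) \<and> ?P (\<lambda>w. complex_of_real (sqrt (1 - (fst w i)\<^sup>2)))"
      using expandable_mono[OF expandable_coeff[OF coeff_algebra.coord]]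
        expandable_mono[OF expandable_coeff[OF coeff_algebra.sqrt]] by simp
    show "\<forall>j\<in>{1..num_phase k}. ?P (\<lambda>w. snd w j)"
      using expandable_phase by simp
  qed
  then have "?P (\<lambda>w. adjoint_matrix (euler k (fst w) (snd w)) $ i $ j)" for i j
    unfolding adjoint_matrix_nth by (rule star_algebra_cnj[OF P])
  from star_algebra_entry_poly[OF P assms, of "\<lambda>w. adjoint_matrix (euler k (fst w) (snd w))", OF this]
  show ?thesis by simp
qed

lemma mathieu_conjecture_SU:
  assumes k: "Suc k = CARD('n)" and C: "\<And>M. 2 \<le> M \<Longrightarrow> 0 < C M"
    and conj: "admissible_conjecture_SU C CARD('n)"
  shows "mathieu_conjecture (SU :: (complex ^ 'n ^ 'n) set)"
  unfolding mathieu_conjecture_def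
proof (intro allI impI)
  fix \<mu> :: "(complex ^ 'n ^ 'n) measure" and f h
  assume \<mu>: "haar_measure SU \<mu>" and f: "finite_type (SU :: (complex ^ 'n ^ 'n) set) f"
    and h: "finite_type (SU :: (complex ^ 'n ^ 'n) set) h" and zero: "\<forall>P\<ge>1. (LINT g|\<mu>. f g ^ P) = 0"
  let ?K = "num_radial k" and ?L = "num_phase k"
  obtain p where p: "p \<in> entry_poly" "\<And>g. g \<in> SU \<Longrightarrow> f g = p g"
    using finite_type_entry_poly[OF \<mu> f] by metis
  obtain r where r: "r \<in> entry_poly" "\<And>g. g \<in> SU \<Longrightarrow> h g = r g"
    using finite_type_entry_poly[OF \<mu> h] by metis
  define w where "w = complex_of_real (euler_integral C k 0 0 (\<lambda>_. 1))"
  have w: "w \<noteq> 0"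
    unfolding w_def using euler_integral_one_pos[of k C 0 0] k C by simp
  \<comment> \<open>Used in both directions: to verify the hypothesis of the conjecture for the
    pull-back of \<open>f\<close>, and to return from the pull-back of the product to the Haar
    integral.\<close>
  have transfer: "cube_integral ?K (\<lambda>x. torus_integral ?L (\<lambda>z.
      Q (adjoint_matrix (euler k x z)) * complex_of_real (J_SU C (Suc k) x) * (\<Prod>j=1..?L. 1 / z j)))
    = \<i> ^ ?L * (w * integral\<^sup>L \<mu> Q)" if Q: "Q \<in> entry_poly" for Q
  proof -
    have c: "continuous_on UNIV Q" by (rule continuous_on_entry_poly[OF Q])
    have "continuous_on UNIV (\<lambda>A. Q (adjoint_matrix A))"
      by (intro continuous_on_compose2[OF c] continuous_on_adjoint_matrix continuous_on_id) auto
    from cube_torus_integral_eq[OF eq_refl[OF k] this, of C] show ?thesis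
      unfolding haar_average[OF \<mu> k c] w_def .
  qed
  let ?q = "\<lambda>x z. p (adjoint_matrix (euler k x z))"
  have KL: "CARD('n) * (CARD('n) - 1) div 2 = ?K" "CARD('n) * (CARD('n) + 1) div 2 - 1 = ?L"
    unfolding k[symmetric] num_radial_eq num_phase_eq by simp_all
  have adm: "admissible ?K ?L ?q"
    unfolding admissible_iff_expandable by (rule expandable_euler[OF p(1)])
  have "cube_integral ?K (\<lambda>x. torus_integral ?L (\<lambda>z.
      ?q x z ^ P * complex_of_real (J_SU C (Suc k) x) * (\<Prod>j=1..?L. 1 / z j))) = 0" if "1 \<le> P" for P
  proof -
    have "(LINT g|\<mu>. p g ^ P) = (LINT g|\<mu>. f g ^ P)"
      using p(2) by (intro Bochner_Integration.integral_cong refl) (simp add: space_haar[OF \<mu>])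
    then show ?thesis
      using transfer[OF entry_poly_power[OF p(1), of P]] zero that by simp
  qed
  then have vanish: "\<forall>P\<ge>1. cube_integral ?K (\<lambda>x. torus_integral ?L (\<lambda>z.
      ?q x z ^ P * complex_of_real (J_SU C (Suc k) x) * (\<Prod>j=1..?L. 1 / z j))) = 0"
    by (intro allI impI)
  note conj' = conj[unfolded admissible_conjecture_SU_def Let_def KL, unfolded k[symmetric]]
  have hull: "0 \<notin> convex hull (Poly_Mapping.map real_of_int ` spectrum ?K ?L ?q)"
    by (rule conj'[THEN spec, THEN mp, THEN mp, OF adm vanish])
  obtain M c where M: "is_expansion ?K ?L ?q M c"
    using adm unfolding admissible_def by blast
  \<comment> \<open>An expansion may list exponents whose coefficient vanishes on the cube. Dropping
    them leaves a finite set contained in the spectrum, so the conclusion of the conjecture applies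
    to its hull.\<close>
  define S where "S = {m \<in> M. \<exists>x\<in>cube ?K. c m x \<noteq> 0}"
  have "finite M" using M by (simp add: is_expansion_def)
  have S: "is_expansion ?K ?L ?q S c"
    unfolding is_expansion_iff
  proof (intro conjI ballI)
    show "finite S" using \<open>finite M\<close> by (simp add: S_def)
  next
    fix x z assume xz: "x \<in> cube ?K" "z \<in> torus ?L"
    have "?q x z = (\<Sum>m\<in>M. c m x * torus_monomial ?L m z)"
      using M xz unfolding is_expansion_iff by blast
    also have "\<dots> = (\<Sum>m\<in>S. c m x * torus_monomial ?L m z)"
      using \<open>finite M\<close> xz(1) by (intro sum.mono_neutral_right) (auto simp: S_def)
    finally show "?q x z = (\<Sum>m\<in>S. c m x * torus_monomial ?L m z)" .
  qed (use M in \<open>auto simp: is_expansion_def S_def\<close>)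
  have "S \<subseteq> spectrum ?K ?L ?q" using M by (auto simp: S_def spectrum_def)
  then have "convex hull (Poly_Mapping.map real_of_int ` S) \<subseteq> convex hull (Poly_Mapping.map real_of_int ` spectrum ?K ?L ?q)"
    by (intro hull_mono image_mono)
  with hull have hullS: "0 \<notin> convex hull (Poly_Mapping.map real_of_int ` S)" by blast
  have expS: "expandable ?K ?L S ?q" using S unfolding expandable_def by blast
  obtain T d where T: "is_expansion ?K ?L (\<lambda>x z. r (adjoint_matrix (euler k x z))) T d"
    using expandable_euler[OF r(1), of k] unfolding expandable_def by blast
  have expT: "expandable ?K ?L T (\<lambda>x z. r (adjoint_matrix (euler k x z)))"
    using T unfolding expandable_def by blast
  have "finite S" "finite T" using S T by (simp_all add: is_expansion_def)
  \<comment> \<open>The additional bound \<open>1 \<le> P\<close> is the one under which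
    \<open>expandable_power\<close> locates the exponents of the power.\<close>
  from eventually_zero_not_in_sum[OF this(1) hullS this(2)] eventually_ge_at_top[of 1]
  show "\<forall>\<^sub>F P in sequentially. (LINT g|\<mu>. f g ^ P * h g) = 0"
  proof eventually_elim
    case (elim P)
    have "cube_integral ?K (\<lambda>x. torus_integral ?L (\<lambda>z.
      (p (adjoint_matrix (euler k x z)) ^ P * r (adjoint_matrix (euler k x z))) * complex_of_real (J_SU C (Suc k) x) * (\<Prod>j=1..?L. 1 / z j)))
      = cube_integral ?K (\<lambda>x. 0)"
      unfolding cube_integral_def
    proof (rule lebesgue_integral_cong)
      fix x assume "x \<in> space (\<Pi>\<^sub>M i\<in>{1..?K}. interval_measure 1)"
      then have "x \<in> cube ?K" by (simp add: cube_def space_PiM space_restrict_space)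
      with torus_integral_expandable_eq_0[OF expandable_mult[OF expandable_power[OF expS elim(2)] expT] elim(1)]
      show "torus_integral ?L (\<lambda>z.
        (p (adjoint_matrix (euler k x z)) ^ P * r (adjoint_matrix (euler k x z))) * complex_of_real (J_SU C (Suc k) x) * (\<Prod>j=1..?L. 1 / z j)) = 0"
        by blast
    qed
    also have "\<dots> = 0" by (simp add: cube_integral_def)
    \<comment> \<open>The factors \<open>w\<close> and the power of i relating the two integrals are
      nonzero and can be cancelled.\<close>
    finally have "(LINT g|\<mu>. p g ^ P * r g) = 0"
      using transfer[OF entry_poly.mult[OF entry_poly_power[OF p(1)] r(1)], of P] w by simp
    moreover have "(LINT g|\<mu>. f g ^ P * h g) = (LINT g|\<mu>. p g ^ P * r g)"
      using p(2) r(2) by (intro Bochner_Integration.integral_cong refl) (simp add: space_haar[OF \<mu>])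
    ultimately show ?case by simp
  qed
qed

end

theorem theorem2p12:
  fixes C :: "nat \<Rightarrow> real"
  assumes "2 \<le> CARD('n::finite)"
    and "\<And>M. 2 \<le> M \<Longrightarrow> 0 < C M"
    and "admissible_conjecture_SU C CARD('n)"
  shows "mathieu_conjecture (SU :: (complex ^ 'n ^ 'n) set)"
proof -
  obtain e where "bij_betw e {1..CARD('n)} (UNIV :: 'n set)"
    using ex_bij_betw_nat_finite_1[of "UNIV :: 'n set"] by auto
  then interpret coordinate_enumeration e by unfold_locales
  show ?thesis
    using mathieu_conjecture_SU[of "CARD('n) - 1" C] assms by simp
qed

end
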